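(* For every integer $k\ge 3$, the classes $\mathcal{C}_k$ and $\mathcal{H}_k$ coincide.
   Context: A hypergraph is a pair $G=(V,E)$ of finite sets with $E\subseteq 2^V$ and $|e|\ge2$ for all $e\in E$. A coloring requires every edge to contain two vertices of different colors; $\chi(G)$ is the chromatic number. $G$ is $(k+1)$-critical if $\chi(G)=k+1$ but $\chi(H)\le k$ for every proper subhypergraph $H$ of $G$. A $(v,w)$-hyperpath is a sequence $(v_1,e_1,\dots,e_{q-1},v_q)$ of distinct vertices and distinct edges with $v_1=v,v_q=w$, $\{v_i,v_{i+1}\}\subseteq e_i$; $\lambda_G(v,w)$ is the maximum number of pairwise edge-disjoint $(v,w)$-hyperpaths and $\lambda(G)=\max_{v\neq w}\lambda_G(v,w)$ ($0$ if $|V(G)|\le1$). $\mathcal{C}_k$ is the class of $(k+1)$-critical hypergraphs $H$ with $\lambda(H)\le k$. Hajós join: for vertex-disjoint hypergraphs $G_1,G_2$, $e_i\in E(G_i)$, $v_i\in e_i$, delete $e_1,e_2$, identify $v_1,v_2$ into a new vertex $v^*$, and add a new edge $e^*$ equal to $(e_1\cup e_2)\setminus\{v_1,v_2\}$ or to $((e_1\cup e_2)\setminus\{v_1,v_2\})\cup\{v^*\}$. An odd wheel is an odd cycle (ordinary edges) plus a new vertex joined by ordinary edges to all cycle vertices. $\mathcal{H}_3$ is the smallest class containing all odd wheels and closed under Hajós joins; for $k\ge4$, $\mathcal{H}_k$ is the smallest class containing $K_{k+1}$ and closed under Hajós joins. *)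

theory Defs
  imports Main
begin

type_synonym 'a hgraph = "'a set \<times> 'a set set"

definition hypergraph :: "'a hgraph \<Rightarrow> bool" where
  "hypergraph G \<longleftrightarrow> finite (fst G) \<and> snd G \<subseteq> Pow (fst G)
     \<and> (\<forall>e\<in>snd G. card e \<ge> 2)"

definition colorable :: "'a hgraph \<Rightarrow> nat \<Rightarrow> bool" where
  "colorable G n \<longleftrightarrow> (\<exists>f :: 'a \<Rightarrow> nat. f ` fst G \<subseteq> {..<n}
     \<and> (\<forall>e\<in>snd G. \<exists>u\<in>e. \<exists>w\<in>e. f u \<noteq> f w))"

definition chi :: "'a hgraph \<Rightarrow> nat" where
  "chi G = (LEAST n. colorable G n)"

definition subhypergraph :: "'a hgraph \<Rightarrow> 'a hgraph \<Rightarrow> bool" where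
  "subhypergraph H G \<longleftrightarrow> hypergraph H \<and> fst H \<subseteq> fst G \<and> snd H \<subseteq> snd G"

definition critical :: "nat \<Rightarrow> 'a hgraph \<Rightarrow> bool" where
  "critical m G \<longleftrightarrow> hypergraph G \<and> chi G = m
     \<and> (\<forall>H. subhypergraph H G \<and> H \<noteq> G \<longrightarrow> chi H < m)"

text \<open>A (v,w)-hyperpath (v_1,e_1,...,e_{q-1},v_q) is represented by the vertex list
  vs = [v_1,...,v_q] and the edge list es = [e_1,...,e_{q-1}].\<close>

definition hyperpath :: "'a hgraph \<Rightarrow> 'a \<Rightarrow> 'a \<Rightarrow> 'a list \<times> 'a set list \<Rightarrow> bool" where
  "hyperpath G v w p \<longleftrightarrow> (let vs = fst p; es = snd p in
     vs \<noteq> [] \<and> length es + 1 = length vs \<and> distinct vs \<and> distinct es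
     \<and> set vs \<subseteq> fst G \<and> set es \<subseteq> snd G \<and> hd vs = v \<and> last vs = w
     \<and> (\<forall>i < length es. {vs ! i, vs ! Suc i} \<subseteq> es ! i))"

definition local_lambda :: "'a hgraph \<Rightarrow> 'a \<Rightarrow> 'a \<Rightarrow> nat" where
  "local_lambda G v w = Max {card P | P. (\<forall>p\<in>P. hyperpath G v w p)
     \<and> (\<forall>p\<in>P. \<forall>q\<in>P. p \<noteq> q \<longrightarrow> set (snd p) \<inter> set (snd q) = {})}"

definition lambda :: "'a hgraph \<Rightarrow> nat" where
  "lambda G = (if card (fst G) \<le> 1 then 0
     else Max {local_lambda G v w | v w. v \<in> fst G \<and> w \<in> fst G \<and> v \<noteq> w})"

definition class_C :: "nat \<Rightarrow> 'a hgraph \<Rightarrow> bool" where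
  "class_C k G \<longleftrightarrow> critical (k + 1) G \<and> lambda G \<le> k"

definition hajos_join :: "'a hgraph \<Rightarrow> 'a hgraph \<Rightarrow> 'a hgraph \<Rightarrow> bool" where
  "hajos_join G1 G2 G \<longleftrightarrow> (\<exists>e1 e2 v1 v2 vs estar.
     fst G1 \<inter> fst G2 = {} \<and> e1 \<in> snd G1 \<and> e2 \<in> snd G2 \<and> v1 \<in> e1 \<and> v2 \<in> e2
     \<and> vs \<notin> fst G1 \<union> fst G2
     \<and> (estar = (e1 \<union> e2) - {v1, v2} \<or> estar = ((e1 \<union> e2) - {v1, v2}) \<union> {vs})
     \<and> (let f = (\<lambda>x. if x = v1 \<or> x = v2 then vs else x) in
        G = (f ` (fst G1 \<union> fst G2),
             (image f) ` ((snd G1 - {e1}) \<union> (snd G2 - {e2})) \<union> {estar})))"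

definition complete_hg :: "nat \<Rightarrow> 'a hgraph \<Rightarrow> bool" where
  "complete_hg n G \<longleftrightarrow> finite (fst G) \<and> card (fst G) = n
     \<and> snd G = {e. e \<subseteq> fst G \<and> card e = 2}"

definition odd_wheel :: "'a hgraph \<Rightarrow> bool" where
  "odd_wheel G \<longleftrightarrow> (\<exists>cs w. odd (length cs) \<and> length cs \<ge> 3 \<and> distinct (w # cs)
     \<and> fst G = insert w (set cs)
     \<and> snd G = {{cs ! i, cs ! ((i + 1) mod length cs)} | i. i < length cs}
               \<union> {{w, cs ! i} | i. i < length cs})"

inductive hajos_closure :: "('a hgraph \<Rightarrow> bool) \<Rightarrow> 'a hgraph \<Rightarrow> bool"
  for base :: "'a hgraph \<Rightarrow> bool" where
  base: "base G \<Longrightarrow> hajos_closure base G"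
| join: "hajos_closure base G1 \<Longrightarrow> hajos_closure base G2 \<Longrightarrow> hajos_join G1 G2 G
          \<Longrightarrow> hajos_closure base G"
| iso: "hajos_closure base G \<Longrightarrow> bij_betw f (fst G) V'
          \<Longrightarrow> hajos_closure base (V', (image f) ` snd G)"

definition class_H :: "nat \<Rightarrow> 'a hgraph \<Rightarrow> bool" where
  "class_H k G \<longleftrightarrow> hajos_closure (if k = 3 then odd_wheel else complete_hg (k + 1)) G"

end

theory Submission
  imports Defs "HOL-Combinatorics.Transposition"
begin

text \<open>By Menger's theorem \<open>lambda G \<le> k\<close> says that any two vertices are separated by a cut of at
  most \<open>k\<close> edges, and criticality makes every cut have at least \<open>k\<close> edges. In this form both
  criticality and the bound on \<open>lambda\<close> pass through Hajos joins in either direction, so it remains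
  to show that every member of \<open>class_C k\<close> is basic or a Hajos join.

  If two vertices have degree above \<open>k\<close>, a cut with exactly \<open>k\<close> edges separates them nontrivially.
  By a theorem of Toft, one side \<open>X\<close> forces a single colour on its ends \<open>h\<close> of the cut edges;
  adding \<open>h\<close> as an edge to the hypergraph inside \<open>X\<close> gives a smaller member of \<open>class_C k\<close>, and all
  vertices of \<open>h\<close> but at most one lie in a single cut edge. By induction the smaller hypergraph is
  a Hajos join in which \<open>h\<close> is either not the new edge, or has an end block attached at a vertex that
  lies in a single cut edge; in both cases the join lifts to the original hypergraph.

  If all vertices but one vertex \<open>w\<close> have degree \<open>k\<close> and the hypergraph is not a Hajos join, then
  removing \<open>w\<close> and any further vertex leaves it connected. Greedy colouring, with \<open>w\<close> and a
  non-neighbour of it coloured alike, shows that \<open>w\<close> is joined to all other vertices by ordinary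
  edges. Repeating this for the rest gives a complete graph if \<open>k \<ge> 4\<close> and an odd wheel if
  \<open>k = 3\<close>.\<close>

text \<open>The obstacle is that \<open>h\<close> can have more than two vertices, even if all edges
  of the original hypergraph are ordinary. A splitting of the smaller hypergraph at \<open>h\<close>
  cuts \<open>h\<close> in two parts, and this corresponds to a splitting of the original only if
  one part is a single vertex \<open>l\<close> that lies in just one cut edge: that cut edge then
  becomes the new edge of the join. For this reason the induction has to produce not any splitting
  but one with an end block at \<open>h\<close>, and it has to steer this block away from the one
  vertex of \<open>h\<close> that may lie in several cut edges. The side of the cut opposite to
  \<open>X\<close> is never reduced; it is carried along with one of the two parts. A Hajos join
  needs disjoint vertex sets and fresh vertices. Splittings are therefore studied in place, as
  \<open>hsplit\<close>, and are turned into joins only in \<open>hajos_closure_split\<close>, where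
  the infinite vertex type supplies the fresh vertices.\<close>

definition monochrom :: "('a \<Rightarrow> nat) \<Rightarrow> 'a set \<Rightarrow> bool" where
  "monochrom f e \<longleftrightarrow> (\<exists>c. \<forall>u\<in>e. f u = c)"

text \<open>Colours are bounded on the whole type and not only on the vertices, so that permuting
  colours and gluing colourings need no vertex set.\<close>

definition proper :: "nat \<Rightarrow> 'a set set \<Rightarrow> ('a \<Rightarrow> nat) \<Rightarrow> bool" where
  "proper k E f \<longleftrightarrow> (\<forall>u. f u < k) \<and> (\<forall>e\<in>E. \<not> monochrom f e)"

text \<open>\<open>(k + 1)\<close>-criticality for \<open>k \<ge> 1\<close>, see
  \<open>critical_iff_crit\<close>. Without isolated vertices every proper subhypergraph misses an
  edge, so it is enough to delete single edges.\<close>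

definition crit :: "nat \<Rightarrow> 'a set \<Rightarrow> 'a set set \<Rightarrow> bool" where
  "crit k V E \<longleftrightarrow> finite V \<and> \<Union>E = V \<and> (\<forall>e\<in>E. 2 \<le> card e)
     \<and> (\<forall>f. \<not> proper k E f) \<and> (\<forall>e\<in>E. \<exists>f. proper k (E - {e}) f)"

definition inside :: "'a set set \<Rightarrow> 'a set \<Rightarrow> 'a set set" where
  "inside E X = {e \<in> E. e \<subseteq> X}"

definition bd :: "'a set set \<Rightarrow> 'a set \<Rightarrow> 'a set set" where
  "bd E X = {e \<in> E. e \<inter> X \<noteq> {} \<and> e - X \<noteq> {}}"

text \<open>By Menger's theorem this is \<open>lambda (V, E) \<le> k\<close>, see \<open>lambda_le_iff\<close> below.\<close>

definition sep_le :: "nat \<Rightarrow> 'a set \<Rightarrow> 'a set set \<Rightarrow> bool" where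
  "sep_le k V E \<longleftrightarrow>
     (\<forall>x\<in>V. \<forall>y\<in>V. x \<noteq> y \<longrightarrow> (\<exists>Z. (x \<in> Z) \<noteq> (y \<in> Z) \<and> card (bd E Z) \<le> k))"

text \<open>An inverse Hajos join carried out in place: \<open>v\<close> plays the roles of \<open>v1\<close>, \<open>v2\<close> and the
  new vertex, \<open>e\<close> is the new edge, and \<open>hpart E A v e\<close> recovers the edges of the factor on \<open>A\<close>.\<close>

definition hsplit :: "'a set \<Rightarrow> 'a set set \<Rightarrow> 'a set \<Rightarrow> 'a set \<Rightarrow> 'a \<Rightarrow> 'a set \<Rightarrow> bool" where
  "hsplit V E A B v e \<longleftrightarrow> A \<union> B = V \<and> A \<inter> B = {v} \<and> e \<in> E
     \<and> e \<inter> (A - {v}) \<noteq> {} \<and> e \<inter> (B - {v}) \<noteq> {} \<and> (\<forall>g\<in>E. g \<noteq> e \<longrightarrow> g \<subseteq> A \<or> g \<subseteq> B)"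

definition hpart :: "'a set set \<Rightarrow> 'a set \<Rightarrow> 'a \<Rightarrow> 'a set \<Rightarrow> 'a set set" where
  "hpart E A v e = insert (insert v (e \<inter> A)) (inside E A)"

subsection \<open>Colourings\<close>

lemma monochrom_cong: "(\<And>u. u \<in> e \<Longrightarrow> f u = g u) \<Longrightarrow> monochrom f e \<longleftrightarrow> monochrom g e"
  unfolding monochrom_def by auto

lemma monochrom_subset: "monochrom f e \<Longrightarrow> e' \<subseteq> e \<Longrightarrow> monochrom f e'"
  unfolding monochrom_def by auto

lemma not_monochrom_iff: "\<not> monochrom f e \<longleftrightarrow> (\<exists>u\<in>e. \<exists>w\<in>e. f u \<noteq> f w)"
  unfolding monochrom_def by metis

lemma monochromD: "monochrom f e \<Longrightarrow> u \<in> e \<Longrightarrow> w \<in> e \<Longrightarrow> f u = f w"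
  unfolding monochrom_def by auto

lemma proper_mono: "proper k E f \<Longrightarrow> E' \<subseteq> E \<Longrightarrow> proper k E' f"
  unfolding proper_def by auto

lemma proper_comp:
  assumes "proper k E f" "inj p" "\<And>c. c < k \<Longrightarrow> p c < k"
  shows "proper k E (p \<circ> f)"
  using assms unfolding proper_def not_monochrom_iff by (auto simp: inj_eq)

lemma transpose_less: "a < k \<Longrightarrow> b < k \<Longrightarrow> c < k \<Longrightarrow> transpose a b c < (k::nat)"
  by (auto simp: transpose_def)

text \<open>Up to a permutation of colours, a colouring restricted to two vertices is determined by
  whether they agree. Pieces sharing at most two vertices can therefore be glued as soon as these
  patterns match.\<close>

lemma proper_align2:
  assumes "proper k E g" "c < k" "d < k" "g x = g y \<longleftrightarrow> c = d"
  obtains g' where "proper k E g'" "g' x = c" "g' y = d" "\<And>u w. g' u = g' w \<longleftrightarrow> g u = g w"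
proof -
  have lt: "g u < k" for u using assms(1) unfolding proper_def by auto
  define p where "p = transpose (g x) c"
  define q where "q = transpose (p (g y)) d"
  have pk: "p b < k" if "b < k" for b
    unfolding p_def using that lt assms(2) by (intro transpose_less)
  have qk: "q b < k" if "b < k" for b
    unfolding q_def using that lt pk assms(3) by (intro transpose_less) auto
  have ip: "inj p" "inj q"
    unfolding p_def q_def by (simp_all add: bij_is_inj)
  have "inj (q \<circ> p)" using ip by (rule inj_compose[rotated])
  then have "proper k E ((q \<circ> p) \<circ> g)"
    using assms(1) pk qk by (intro proper_comp) auto
  moreover have "p (g x) = c" unfolding p_def by simp
  \<comment> \<open>If \<open>c = d\<close> then \<open>q\<close> is the identity; otherwise
    \<open>c\<close> is neither of the two colours that \<open>q\<close> swaps.\<close>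
  moreover have "q c = c"
  proof (cases "c = d")
    case True
    then have "p (g y) = d" using assms(4) \<open>p (g x) = c\<close> by simp
    then show ?thesis using True unfolding q_def by simp
  next
    case False
    then have "g x \<noteq> g y" using assms(4) by simp
    then have "p (g y) \<noteq> c" using ip(1) \<open>p (g x) = c\<close> by (metis injD)
    then show ?thesis using False unfolding q_def by (simp add: transpose_def)
  qed
  moreover have "q (p (g y)) = d" unfolding q_def by simp
  ultimately show ?thesis
    by (intro that[of "(q \<circ> p) \<circ> g"]) (simp_all add: inj_eq[OF ip(1)] inj_eq[OF ip(2)])
qed

lemma proper_align:
  assumes "proper k E g" "c < k"
  obtains g' where "proper k E g'" "g' x = c" "\<And>u w. g' u = g' w \<longleftrightarrow> g u = g w"
  using proper_align2[OF assms(1,2,2), of x x] by auto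

text \<open>The last assumption leaves room for an edge inside neither part, such as the edge of a
  splitting, which is then checked directly on the glued colouring.\<close>

lemma proper_glue:
  assumes "proper k (inside E A) f" "proper k (inside E B) g" "\<And>u. u \<in> A \<inter> B \<Longrightarrow> f u = g u"
    and "\<And>e. e \<in> E' \<Longrightarrow> (e \<in> E \<and> (e \<subseteq> A \<or> e \<subseteq> B)) \<or> \<not> monochrom (\<lambda>x. if x \<in> A then f x else g x) e"
  shows "proper k E' (\<lambda>x. if x \<in> A then f x else g x)"
proof -
  let ?c = "\<lambda>x. if x \<in> A then f x else g x"
  have "\<not> monochrom ?c e" if "e \<in> E'" for e
  proof -
    have "\<not> monochrom ?c e" if "e \<in> E" "e \<subseteq> A"
    proof -
      have "monochrom ?c e = monochrom f e" using that by (intro monochrom_cong) auto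
      then show ?thesis using assms(1) that unfolding proper_def inside_def by auto
    qed
    moreover have "\<not> monochrom ?c e" if "e \<in> E" "e \<subseteq> B"
    proof -
      have "monochrom ?c e = monochrom g e" using that assms(3) by (intro monochrom_cong) auto
      then show ?thesis using assms(2) that unfolding proper_def inside_def by auto
    qed
    ultimately show ?thesis using assms(4)[OF that] by auto
  qed
  then show ?thesis using assms(1,2) unfolding proper_def by auto
qed

subsection \<open>Critical hypergraphs and edge cuts\<close>

lemma crit_finite_edges: "crit k V E \<Longrightarrow> finite E"
  unfolding crit_def by (metis finite_UnionD)

lemma crit_finite_edge: "crit k V E \<Longrightarrow> e \<in> E \<Longrightarrow> finite e"
  unfolding crit_def by (metis Sup_upper finite_subset)

lemma crit_edge_subset: "crit k V E \<Longrightarrow> e \<in> E \<Longrightarrow> e \<subseteq> V"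
  unfolding crit_def by auto

lemma crit_edge_other:
  assumes "crit k V E" "e \<in> E" obtains y where "y \<in> e" "y \<noteq> x"
proof -
  have "\<not> e \<subseteq> {x}"
    using assms card_mono[of "{x}" e] unfolding crit_def by fastforce
  then show ?thesis using that by auto
qed

lemma crit_not_proper: "crit k V E \<Longrightarrow> \<not> proper k E f"
  unfolding crit_def by auto

lemma crit_sub_colourable:
  assumes "crit k V E" "E' \<subseteq> E" "E' \<noteq> E"
  obtains f where "proper k E' f"
proof -
  obtain e where "e \<in> E" "E' \<subseteq> E - {e}" using assms by auto
  then show ?thesis using assms(1) that unfolding crit_def by (meson proper_mono)
qed

lemma crit_inside_colourable:
  assumes "crit k V E" "x \<in> V" "x \<notin> X"
  obtains f where "proper k (inside E X) f"
proof -
  obtain e where "e \<in> E" "x \<in> e" using assms unfolding crit_def by auto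
  then have "inside E X \<subseteq> E" "inside E X \<noteq> E" using assms(3) unfolding inside_def by auto
  then show ?thesis using crit_sub_colourable[OF assms(1)] that by metis
qed

text \<open>A colouring that is not constant on a subset of \<open>e\<close> is not constant on
  \<open>e\<close>, so deleting the larger of two nested edges would not make the hypergraph
  colourable.\<close>

lemma crit_antichain:
  assumes "crit k V E" "e \<in> E" "e' \<in> E" "e' \<subseteq> e"
  shows "e' = e"
proof (rule ccontr)
  assume "e' \<noteq> e"
  obtain f where f: "proper k (E - {e}) f" using assms unfolding crit_def by auto
  then have "\<not> monochrom f e'" using \<open>e' \<noteq> e\<close> assms(3) unfolding proper_def by auto
  then have "\<not> monochrom f e" using assms(4) monochrom_subset by metis
  then have "proper k E f" using f unfolding proper_def by auto
  then show False using assms(1) crit_not_proper by metis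
qed

lemma bd_compl: "\<Union>E \<subseteq> V \<Longrightarrow> bd E (V - X) = bd E X"
  unfolding bd_def by blast

lemma bd_inter: "\<Union>E \<subseteq> V \<Longrightarrow> bd E (X \<inter> V) = bd E X"
  unfolding bd_def by blast

text \<open>Shift the colours outside \<open>X\<close> cyclically: each of the \<open>k\<close> shifts must be spoiled by a cut
  edge, and no edge spoils two shifts.\<close>

lemma crit_cut_shift:
  assumes cr: "crit k V E" and X: "X \<subseteq> V"
    and f: "proper k (inside E X) f" and g: "proper k (inside E (V - X)) g"
  obtains h \<alpha> \<beta> where "inj_on h {..<k}" "h ` {..<k} \<subseteq> bd E X"
    "\<And>s u. s < k \<Longrightarrow> u \<in> h s \<inter> X \<Longrightarrow> f u = \<alpha> (h s)"
    "\<And>s u. s < k \<Longrightarrow> u \<in> h s - X \<Longrightarrow> g u = \<beta> (h s)"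
    "\<And>s. s < k \<Longrightarrow> \<alpha> (h s) = (\<beta> (h s) + s) mod k"
    "\<And>e. e \<in> bd E X \<Longrightarrow> \<alpha> e < k \<and> \<beta> e < k"
proof -
  define c where "c s x = (if x \<in> X then f x else (g x + s) mod k)" for s x
  \<comment> \<open>On an edge that spoils a shift, all ends in \<open>X\<close> share a colour of
    \<open>f\<close> and all ends outside share a colour of \<open>g\<close>, so any choice of end
    reads them off.\<close>
  define \<alpha> where "\<alpha> e = f (SOME u. u \<in> e \<inter> X)" for e
  define \<beta> where "\<beta> e = g (SOME u. u \<in> e - X)" for e
  have fg: "f u < k" "g u < k" for u using f g unfolding proper_def by auto
  have "\<exists>e\<in>bd E X. monochrom (c s) e" if "s < k" for s
  proof -
    \<comment> \<open>Adding \<open>s\<close> modulo \<open>k\<close> permutes the colours, so both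
      sides stay properly coloured and only a cut edge can become monochromatic.\<close>
    have "inj_on (\<lambda>b. (b + s) mod k) {..<k}"
    proof (rule inj_onI)
      fix a b assume "a \<in> {..<k}" "b \<in> {..<k}" "(a + s) mod k = (b + s) mod k"
      then show "a = b" using that by (auto simp: mod_if split: if_splits)
    qed
    then have sh: "(g u + s) mod k = (g w + s) mod k \<longleftrightarrow> g u = g w" for u w
      using fg by (auto dest: inj_onD)
    have "\<not> proper k E (c s)" using cr crit_not_proper by metis
    moreover have "c s u < k" for u using fg that unfolding c_def by (auto simp: mod_less_divisor)
    ultimately obtain e where e: "e \<in> E" "monochrom (c s) e" unfolding proper_def by auto
    have "\<not> e \<subseteq> X"
    proof
      assume "e \<subseteq> X"
      then have "monochrom f e = monochrom (c s) e" by (intro monochrom_cong) (auto simp: c_def)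
      then have "monochrom f e" using e(2) by simp
      then show False using f e(1) \<open>e \<subseteq> X\<close> unfolding proper_def inside_def by auto
    qed
    moreover have "e \<inter> X \<noteq> {}"
    proof
      assume "e \<inter> X = {}"
      then have "e \<subseteq> V - X" using e(1) cr crit_edge_subset by fast
      moreover have "monochrom g e"
        using e(2) \<open>e \<inter> X = {}\<close> sh unfolding monochrom_def c_def
        by (metis disjoint_iff)
      ultimately show False using g e(1) unfolding proper_def inside_def by auto
    qed
    ultimately show ?thesis using e unfolding bd_def by auto
  qed
  then obtain h where h: "\<And>s. s < k \<Longrightarrow> h s \<in> bd E X \<and> monochrom (c s) (h s)" by metis
  have a1: "f u = \<alpha> (h s)" if "s < k" "u \<in> h s \<inter> X" for s u
  proof -
    have "(SOME u. u \<in> h s \<inter> X) \<in> h s \<inter> X" using that(2) by (rule someI)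
    then show ?thesis
      using h[OF that(1)] that(2) monochromD[of "c s" "h s"] unfolding \<alpha>_def c_def
      by (metis (no_types, lifting) IntD1 IntD2)
  qed
  have gs: "g u = g w" if "s < k" "(g u + s) mod k = (g w + s) mod k" for u w s
    using that fg[of u] fg[of w] by (auto simp: mod_if split: if_splits)
  have b1: "g u = \<beta> (h s)" if "s < k" "u \<in> h s - X" for s u
  proof -
    have "(SOME u. u \<in> h s - X) \<in> h s - X" using that(2) by (rule someI)
    then have "c s u = c s (SOME u. u \<in> h s - X)"
      using h[OF that(1)] that(2) monochromD[of "c s" "h s"] by blast
    then show ?thesis
      using that \<open>(SOME u. u \<in> h s - X) \<in> h s - X\<close> gs[OF that(1)] unfolding \<beta>_def c_def by auto
  qed
  have ab: "\<alpha> (h s) = (\<beta> (h s) + s) mod k" if "s < k" for s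
  proof -
    obtain u w where u: "u \<in> h s \<inter> X" "w \<in> h s - X" using h[OF \<open>s < k\<close>] unfolding bd_def by blast
    then have "c s u = c s w" using h[OF that] monochromD by (metis DiffD1 IntD1)
    then show ?thesis using u a1[OF that] b1[OF that] unfolding c_def by auto
  qed
  have lt: "\<alpha> e < k" "\<beta> e < k" for e unfolding \<alpha>_def \<beta>_def using fg by auto
  \<comment> \<open>The shift spoiled by an edge is the difference of its two colours, hence
    determined by the edge.\<close>
  have "inj_on h {..<k}"
  proof (rule inj_onI)
    fix s t assume st: "s \<in> {..<k}" "t \<in> {..<k}" "h s = h t"
    then have "(\<beta> (h s) + s) mod k = (\<beta> (h s) + t) mod k" using ab by (metis lessThan_iff)
    then show "s = t" using st lt(2)[of "h s"] by (auto simp: mod_if split: if_splits)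
  qed
  then show ?thesis using that[of h \<alpha> \<beta>] h a1 b1 ab lt by auto
qed

text \<open>Each side omits a vertex and thus an edge, so both sides are \<open>k\<close>-colourable
  and the \<open>k\<close> shifts use up \<open>k\<close> distinct cut edges.\<close>

lemma crit_cut_ge:
  assumes cr: "crit k V E" and "x \<in> V" "y \<in> V" "(x \<in> X) \<noteq> (y \<in> X)"
  shows "k \<le> card (bd E X)"
proof -
  let ?X = "X \<inter> V"
  obtain a b where ab: "a \<in> V" "a \<notin> ?X" "b \<in> V" "b \<notin> V - ?X" using assms(2-4) by blast
  obtain f where f: "proper k (inside E ?X) f" by (rule crit_inside_colourable[OF cr ab(1,2)])
  obtain g where "proper k (inside E (V - ?X)) g" by (rule crit_inside_colourable[OF cr ab(3,4)])
  with f obtain h where "inj_on h {..<k}" "h ` {..<k} \<subseteq> bd E ?X"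
    using crit_cut_shift[OF cr, of ?X f g] by (metis (no_types, lifting) inf_le2)
  moreover have "finite (bd E ?X)" using crit_finite_edges[OF cr] unfolding bd_def by auto
  ultimately have "k \<le> card (bd E ?X)" by (metis card_image card_lessThan card_mono)
  moreover have "bd E ?X = bd E X" using cr bd_inter unfolding crit_def by blast
  ultimately show ?thesis by simp
qed

lemma bd_singleton:
  assumes "crit k V E" shows "bd E {x} = {e \<in> E. x \<in> e}"
proof -
  have "e - {x} \<noteq> {}" if "e \<in> E" for e
    using crit_edge_other[OF assms that, of x] by blast
  then show ?thesis unfolding bd_def by auto
qed

lemma crit_card_V:
  assumes cr: "crit k V E" "k \<ge> 1" shows "k < card V"
proof (rule ccontr)
  assume "\<not> k < card V"
  then have "card V \<le> card {..<k}" by simp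
  then obtain f :: "'a \<Rightarrow> nat" where f: "inj_on f V" "f ` V \<subseteq> {..<k}"
    using cr(1) card_le_inj[of V "{..<k}"] unfolding crit_def by auto
  have "proper k E (\<lambda>x. if x \<in> V then f x else 0)"
    unfolding proper_def
  proof (intro conjI allI ballI)
    fix u show "(if u \<in> V then f u else 0) < k" using f cr(2) by auto
  next
    fix e assume e: "e \<in> E"
    obtain x where x: "x \<in> e" using crit_edge_other[OF cr(1) e] by blast
    obtain y where y: "y \<in> e" "y \<noteq> x" using crit_edge_other[OF cr(1) e] by blast
    have "f x \<noteq> f y" using f(1) x y crit_edge_subset[OF cr(1) e] by (metis inj_onD subsetD)
    then show "\<not> monochrom (\<lambda>x. if x \<in> V then f x else 0) e"
      using x y crit_edge_subset[OF cr(1) e] unfolding not_monochrom_iff by (metis subsetD)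
  qed
  then show False using crit_not_proper[OF cr(1)] by metis
qed

lemma crit_degree_ge:
  assumes cr: "crit k V E" "k \<ge> 1" and "x \<in> V"
  shows "k \<le> card {e \<in> E. x \<in> e}"
proof -
  have "card V > 1" using crit_card_V[OF cr] cr(2) by simp
  then have "\<not> V \<subseteq> {x}" using card_mono[of "{x}" V] by auto
  then obtain y where "y \<in> V" "y \<noteq> x" by auto
  then show ?thesis using crit_cut_ge[OF cr(1) assms(3), of y "{x}"] bd_singleton[OF cr(1)] by auto
qed

text \<open>With exactly \<open>k\<close> cut edges, each of them spoils exactly one shift. Two
  edges that agree on both sides would spoil the same shift. Two edges that differ on both sides
  would do so after a suitable permutation of the outer colours.\<close>

lemma crit_tight_colours:
  assumes cr: "crit k V E" and X: "X \<subseteq> V" and tight: "card (bd E X) = k"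
    and f: "proper k (inside E X) f" and g: "proper k (inside E (V - X)) g"
  obtains \<alpha> \<beta> where "\<And>e u. e \<in> bd E X \<Longrightarrow> u \<in> e \<inter> X \<Longrightarrow> f u = \<alpha> e"
    "\<And>e u. e \<in> bd E X \<Longrightarrow> u \<in> e - X \<Longrightarrow> g u = \<beta> e"
    "\<And>e e'. e \<in> bd E X \<Longrightarrow> e' \<in> bd E X \<Longrightarrow> e \<noteq> e' \<Longrightarrow> \<alpha> e = \<alpha> e' \<longleftrightarrow> \<beta> e \<noteq> \<beta> e'"
    "\<And>e. e \<in> bd E X \<Longrightarrow> \<alpha> e < k \<and> \<beta> e < k"
proof -
  have fin: "finite (bd E X)" using crit_finite_edges[OF cr] unfolding bd_def by auto
  have onto: "h ` {..<k} = bd E X" if "inj_on h {..<k}" "h ` {..<k} \<subseteq> bd E X" for h :: "nat \<Rightarrow> 'a set"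
    using that tight fin by (metis card_image card_lessThan card_subset_eq)
  obtain h \<alpha> \<beta> where h: "inj_on h {..<k}" "h ` {..<k} \<subseteq> bd E X"
    and a: "\<And>s u. s < k \<Longrightarrow> u \<in> h s \<inter> X \<Longrightarrow> f u = \<alpha> (h s)"
    and b: "\<And>s u. s < k \<Longrightarrow> u \<in> h s - X \<Longrightarrow> g u = \<beta> (h s)"
    and ab: "\<And>s. s < k \<Longrightarrow> \<alpha> (h s) = (\<beta> (h s) + s) mod k"
    and lt: "\<And>e. e \<in> bd E X \<Longrightarrow> \<alpha> e < k \<and> \<beta> e < k"
    by (rule crit_cut_shift[OF cr X f g]) blast
  note surj = onto[OF h]
  have a': "f u = \<alpha> e" if "e \<in> bd E X" "u \<in> e \<inter> X" for e u
  proof -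
    obtain s where "s < k" "e = h s" using \<open>e \<in> bd E X\<close> surj by auto
    then show ?thesis using a that(2) by simp
  qed
  have b': "g u = \<beta> e" if "e \<in> bd E X" "u \<in> e - X" for e u
  proof -
    obtain s where "s < k" "e = h s" using \<open>e \<in> bd E X\<close> surj by auto
    then show ?thesis using b that(2) by simp
  qed
  have ab': "\<alpha> e = \<alpha> e' \<longleftrightarrow> \<beta> e \<noteq> \<beta> e'" if e: "e \<in> bd E X" "e' \<in> bd E X" "e \<noteq> e'" for e e'
  proof
    assume "\<alpha> e = \<alpha> e'"
    show "\<beta> e \<noteq> \<beta> e'"
    proof
      assume "\<beta> e = \<beta> e'"
      have "e \<in> h ` {..<k}" "e' \<in> h ` {..<k}" using e surj by simp_all
      then obtain s t where st: "s < k" "t < k" "e = h s" "e' = h t" by blast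
      then have "(\<beta> e + s) mod k = (\<beta> e + t) mod k"
        using ab \<open>\<alpha> e = \<alpha> e'\<close> \<open>\<beta> e = \<beta> e'\<close> by metis
      then have "s = t" using st lt[OF e(1)] by (auto simp: mod_if split: if_splits)
      then show False using st e(3) by simp
    qed
  next
    assume ne: "\<beta> e \<noteq> \<beta> e'"
    show "\<alpha> e = \<alpha> e'"
    proof (rule ccontr)
      assume "\<alpha> e \<noteq> \<alpha> e'"
      obtain x x' where x: "x \<in> e - X" "x' \<in> e' - X" using e unfolding bd_def by auto
      then have "g x \<noteq> g x'" using ne b' e by auto
      \<comment> \<open>Permuted like this, the outer colours of \<open>e\<close> and
        \<open>e'\<close> equal their inner colours, so both edges would spoil the shift by
        0.\<close>
      then obtain g' where g': "proper k (inside E (V - X)) g'" "g' x = \<alpha> e" "g' x' = \<alpha> e'"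
        "\<And>u w. g' u = g' w \<longleftrightarrow> g u = g w"
        using proper_align2[OF g, of "\<alpha> e" "\<alpha> e'" x x'] lt e \<open>\<alpha> e \<noteq> \<alpha> e'\<close> by metis
      obtain h' \<alpha>' \<beta>' where h': "inj_on h' {..<k}" "h' ` {..<k} \<subseteq> bd E X"
        and A: "\<And>s u. s < k \<Longrightarrow> u \<in> h' s \<inter> X \<Longrightarrow> f u = \<alpha>' (h' s)"
        and B: "\<And>s u. s < k \<Longrightarrow> u \<in> h' s - X \<Longrightarrow> g' u = \<beta>' (h' s)"
        and AB: "\<And>s. s < k \<Longrightarrow> \<alpha>' (h' s) = (\<beta>' (h' s) + s) mod k"
        by (rule crit_cut_shift[OF cr X f g'(1)]) blast
      have lt': "g' u < k" for u using g' unfolding proper_def by auto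
      have zero: "h' 0 = e0" if "e0 \<in> bd E X" "y \<in> e0 - X" "g' y = \<alpha> e0" for e0 y
      proof -
        obtain s where s: "s < k" "e0 = h' s" using onto[OF h'] \<open>e0 \<in> bd E X\<close> by auto
        obtain z where z: "z \<in> e0 \<inter> X" using \<open>e0 \<in> bd E X\<close> unfolding bd_def by auto
        have "\<alpha>' e0 = \<beta>' e0" using A B s z that a' by metis
        moreover have "\<beta>' e0 < k" using B[of s y] s that lt'[of y] by simp
        ultimately have "s = 0" using AB[OF s(1)] s by (auto simp: mod_if split: if_splits)
        then show ?thesis using s by simp
      qed
      have "h' 0 = e" "h' 0 = e'"
        using zero[OF e(1) x(1) g'(2)] zero[OF e(2) x(2) g'(3)] by simp_all
      then show False using e by simp
    qed
  qed
  show ?thesis by (rule that[OF a' b' ab' lt])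
qed

text \<open>Toft: one of the two sides of a cut with exactly \<open>k\<close> edges has this property.\<close>

definition mono_side :: "nat \<Rightarrow> 'a set \<Rightarrow> 'a set set \<Rightarrow> 'a set \<Rightarrow> bool" where
  "mono_side k V E X \<longleftrightarrow>
     (\<forall>f. proper k (inside E X) f \<longrightarrow> monochrom f (X \<inter> \<Union>(bd E X)))
     \<and> (\<forall>g a. proper k (inside E (V - X)) g \<longrightarrow> a < k \<longrightarrow> (\<exists>e\<in>bd E X. \<forall>u\<in>e - X. g u = a))"

text \<open>Any two cut edges agree on exactly one side. As \<open>e1\<close> and \<open>e2\<close>
  agree under \<open>f0\<close>, every outer colouring tells them apart. A cut edge with another
  inner colour than \<open>e1\<close> and \<open>e2\<close> would have the outer colours of both,
  which differ. So all inner colours coincide, the outer colours are pairwise distinct, and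
  \<open>k\<close> edges exhaust the \<open>k\<close> colours.\<close>

lemma mono_sideI:
  assumes cr: "crit k V E" and X: "X \<subseteq> V" and tight: "card (bd E X) = k"
    and f0: "proper k (inside E X) f0" and g0: "proper k (inside E (V - X)) g0"
    and e12: "e1 \<in> bd E X" "e2 \<in> bd E X" "e1 \<noteq> e2"
    and x12: "x1 \<in> e1 \<inter> X" "x2 \<in> e2 \<inter> X" "f0 x1 = f0 x2"
  shows "mono_side k V E X"
  unfolding mono_side_def
proof (intro conjI allI impI)
  fix f assume f: "proper k (inside E X) f"
  obtain \<alpha>0 \<beta>0 where 0: "\<And>e u. e \<in> bd E X \<Longrightarrow> u \<in> e \<inter> X \<Longrightarrow> f0 u = \<alpha>0 e"
    "\<And>e u. e \<in> bd E X \<Longrightarrow> u \<in> e - X \<Longrightarrow> g0 u = \<beta>0 e"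
    "\<And>e e'. e \<in> bd E X \<Longrightarrow> e' \<in> bd E X \<Longrightarrow> e \<noteq> e' \<Longrightarrow> \<alpha>0 e = \<alpha>0 e' \<longleftrightarrow> \<beta>0 e \<noteq> \<beta>0 e'"
    by (rule crit_tight_colours[OF cr X tight f0 g0]) blast
  obtain \<alpha> \<beta> where 1: "\<And>e u. e \<in> bd E X \<Longrightarrow> u \<in> e \<inter> X \<Longrightarrow> f u = \<alpha> e"
    "\<And>e u. e \<in> bd E X \<Longrightarrow> u \<in> e - X \<Longrightarrow> g0 u = \<beta> e"
    "\<And>e e'. e \<in> bd E X \<Longrightarrow> e' \<in> bd E X \<Longrightarrow> e \<noteq> e' \<Longrightarrow> \<alpha> e = \<alpha> e' \<longleftrightarrow> \<beta> e \<noteq> \<beta> e'"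
    by (rule crit_tight_colours[OF cr X tight f g0]) blast
  have "\<alpha>0 e1 = \<alpha>0 e2" using 0(1) e12 x12 by metis
  then have "\<beta>0 e1 \<noteq> \<beta>0 e2" using 0(3) e12 by metis
  moreover have "\<beta> e = \<beta>0 e" if e: "e \<in> bd E X" for e
  proof -
    obtain u where u: "u \<in> e - X" using e unfolding bd_def by auto
    show ?thesis using 0(2)[OF e u] 1(2)[OF e u] by simp
  qed
  ultimately have ne: "\<beta> e1 \<noteq> \<beta> e2" using e12 by metis
  have "\<alpha> e = \<alpha> e1" if e: "e \<in> bd E X" for e
    using e e12 ne 1(3) by metis
  then have "f u = \<alpha> e1" if "u \<in> X \<inter> \<Union>(bd E X)" for u
    using that 1(1) by (metis IntD1 IntD2 IntI Union_iff)
  then show "monochrom f (X \<inter> \<Union>(bd E X))" unfolding monochrom_def by metis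
next
  fix g a assume g: "proper k (inside E (V - X)) g" and a: "a < k"
  obtain \<alpha> \<beta> where 1: "\<And>e u. e \<in> bd E X \<Longrightarrow> u \<in> e \<inter> X \<Longrightarrow> f0 u = \<alpha> e"
    "\<And>e u. e \<in> bd E X \<Longrightarrow> u \<in> e - X \<Longrightarrow> g u = \<beta> e"
    "\<And>e e'. e \<in> bd E X \<Longrightarrow> e' \<in> bd E X \<Longrightarrow> e \<noteq> e' \<Longrightarrow> \<alpha> e = \<alpha> e' \<longleftrightarrow> \<beta> e \<noteq> \<beta> e'"
    "\<And>e. e \<in> bd E X \<Longrightarrow> \<alpha> e < k \<and> \<beta> e < k"
    by (rule crit_tight_colours[OF cr X tight f0 g]) blast
  have "\<alpha> e1 = \<alpha> e2" using 1(1) e12 x12 by metis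
  then have ne: "\<beta> e1 \<noteq> \<beta> e2" using 1(3) e12 by metis
  have "\<alpha> e = \<alpha> e1" if e: "e \<in> bd E X" for e
    using e e12 ne 1(3) by metis
  then have "inj_on \<beta> (bd E X)" using 1(3) by (metis inj_onI)
  moreover have "\<beta> ` bd E X \<subseteq> {..<k}" using 1(4) by auto
  ultimately have "\<beta> ` bd E X = {..<k}"
    using tight by (metis card_image card_lessThan card_subset_eq finite_lessThan)
  then have "a \<in> \<beta> ` bd E X" using a by simp
  then obtain e where "e \<in> bd E X" "\<beta> e = a" by auto
  then show "\<exists>e\<in>bd E X. \<forall>u\<in>e - X. g u = a" using 1(2) by metis
qed

text \<open>Two arbitrary cut edges agree on one of the two sides, and \<open>mono_sideI\<close>
  applies to that side.\<close>

lemma mono_side_exists: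
  assumes cr: "crit k V E" and k: "k \<ge> 2" and X: "X \<subseteq> V" "X \<noteq> {}" "X \<noteq> V"
    and tight: "card (bd E X) = k"
  shows "mono_side k V E X \<or> mono_side k V E (V - X)"
proof -
  obtain f g where fg: "proper k (inside E X) f" "proper k (inside E (V - X)) g"
  proof -
    obtain x y where "x \<in> X" "y \<in> V" "y \<notin> X" using X by auto
    then show thesis
      using crit_inside_colourable[OF cr, of y X] crit_inside_colourable[OF cr, of x "V - X"] X(1) that
      by (metis DiffD2 subsetD)
  qed
  obtain \<alpha> \<beta> where 1: "\<And>e u. e \<in> bd E X \<Longrightarrow> u \<in> e \<inter> X \<Longrightarrow> f u = \<alpha> e"
    "\<And>e u. e \<in> bd E X \<Longrightarrow> u \<in> e - X \<Longrightarrow> g u = \<beta> e"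
    "\<And>e e'. e \<in> bd E X \<Longrightarrow> e' \<in> bd E X \<Longrightarrow> e \<noteq> e' \<Longrightarrow> \<alpha> e = \<alpha> e' \<longleftrightarrow> \<beta> e \<noteq> \<beta> e'"
    by (rule crit_tight_colours[OF cr X(1) tight fg]) blast
  have UV: "\<Union>E \<subseteq> V" using cr unfolding crit_def by auto
  obtain e1 where e1: "e1 \<in> bd E X" using tight k by (metis card.empty ex_in_conv not_numeral_le_zero)
  obtain e2 where e2: "e2 \<in> bd E X" "e2 \<noteq> e1"
  proof (rule ccontr)
    assume "\<not> thesis"
    then have "bd E X \<subseteq> {e1}" using that by auto
    then show False using tight k card_mono[of "{e1}" "bd E X"] by simp
  qed
  obtain x1 y1 where x1: "x1 \<in> e1 \<inter> X" "y1 \<in> e1 - X" using e1 unfolding bd_def by auto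
  obtain x2 y2 where x2: "x2 \<in> e2 \<inter> X" "y2 \<in> e2 - X" using e2 unfolding bd_def by auto
  show ?thesis
  proof (cases "\<alpha> e1 = \<alpha> e2")
    case True
    then have "f x1 = f x2" using 1(1) e1 e2 x1 x2 by metis
    then show ?thesis using mono_sideI[OF cr X(1) tight fg e1 e2(1)] e2 x1 x2 by metis
  next
    case False
    then have "\<beta> e1 = \<beta> e2" using 1(3) e1 e2 by metis
    then have "g y1 = g y2" using 1(2) e1 e2 x1 x2 by metis
    moreover have "bd E (V - X) = bd E X" using bd_compl[OF UV] .
    moreover have "V - (V - X) = X" using X by auto
    moreover have "y1 \<in> e1 \<inter> (V - X)" "y2 \<in> e2 \<inter> (V - X)"
      using x1 x2 e1 e2 UV unfolding bd_def by auto
    ultimately show ?thesis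
      using mono_sideI[OF cr, of "V - X" g f e1 e2 y1 y2] fg e1 e2 tight by auto
  qed
qed

subsection \<open>Splitting along a vertex and an edge\<close>

lemma hsplit_commute: "hsplit V E A B v e \<Longrightarrow> hsplit V E B A v e"
  unfolding hsplit_def by blast

lemma hsplitD:
  assumes "hsplit V E A B v e"
  shows "v \<in> A" "v \<in> B" "A \<union> B = V" "A \<inter> B = {v}" "e \<in> E"
    "g \<in> E \<Longrightarrow> g \<noteq> e \<Longrightarrow> g \<subseteq> A \<or> g \<subseteq> B"
  using assms unfolding hsplit_def by auto

lemma hsplit_witness:
  assumes "hsplit V E A B v e"
  obtains u where "u \<in> e" "u \<in> A" "u \<noteq> v" "u \<notin> B"
proof -
  obtain u where "u \<in> e \<inter> (A - {v})" using assms unfolding hsplit_def by blast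
  moreover have "A \<inter> B = {v}" using assms unfolding hsplit_def by blast
  ultimately show thesis using that by blast
qed

lemma monochrom_parts:
  assumes "monochrom f (insert v (e \<inter> A))" "monochrom f (insert v (e \<inter> B))" "e \<subseteq> A \<union> B"
  shows "monochrom f e"
proof -
  have "f u = f v" if "u \<in> e" for u
    using assms(3) monochromD[OF assms(1), of u v] monochromD[OF assms(2), of u v] that by blast
  then show ?thesis unfolding monochrom_def by blast
qed

text \<open>In a colouring of the factor some \<open>u\<close> in \<open>e\<close> differs from
  \<open>v\<close>. The rest of \<open>E\<close> can be coloured so that it matches at
  \<open>v\<close> and a vertex \<open>z\<close> of \<open>e\<close> outside \<open>A\<close> does
  not get the colour of \<open>u\<close>; then \<open>u\<close> and \<open>z\<close> take care of
  \<open>e\<close>.\<close>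

lemma hsplit_hpart_not_proper:
  assumes cr: "crit k V E" and k: "k \<ge> 3" and sp: "hsplit V E A B v e"
  shows "\<not> proper k (hpart E A v e) f"
proof
  assume f: "proper k (hpart E A v e) f"
  obtain x where x: "x \<in> A" "x \<notin> B" using hsplit_witness[OF sp] by metis
  obtain z where z: "z \<in> e" "z \<in> B" "z \<noteq> v" "z \<notin> A"
    by (rule hsplit_witness[OF hsplit_commute[OF sp]])
  note v = hsplitD(1-5)[OF sp] and oth = hsplitD(6)[OF sp]
  have lt: "f u < k" for u using f unfolding proper_def by auto
  have "\<not> monochrom f (insert v (e \<inter> A))" using f unfolding proper_def hpart_def by auto
  then obtain u where u: "u \<in> e" "u \<in> A" "f u \<noteq> f v" unfolding monochrom_def by auto
  have fA: "proper k (inside E A) f" using f unfolding hpart_def by (rule proper_mono) auto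
  obtain g where g: "proper k (inside E B) g"
    using crit_inside_colourable[OF cr, of x B] x v by auto
  have "\<exists>g'. proper k (inside E B) g' \<and> g' v = f v \<and> g' z \<noteq> f u"
  proof (cases "g z = g v")
    case True
    obtain g' where "proper k (inside E B) g'" "g' v = f v" "\<And>u w. g' u = g' w \<longleftrightarrow> g u = g w"
      using proper_align[OF g lt] by metis
    then show ?thesis using True u by metis
  next
    case False
    \<comment> \<open>A third colour, available because \<open>k \<ge> 3\<close>.\<close>
    obtain d where d: "d < k" "d \<noteq> f u" "d \<noteq> f v"
    proof -
      have "\<not> {..<k} \<subseteq> {f u, f v}"
        using k card_mono[of "{f u, f v}" "{..<k}"] card_insert_le_m1[of 2 "{f v}" "f u"] by auto
      then show thesis using that by auto
    qed
    obtain g' where "proper k (inside E B) g'" "g' v = f v" "g' z = d"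
      using proper_align2[OF g lt[of v] d(1), of v z] False d(3) by metis
    then show ?thesis using d by auto
  qed
  then obtain g' where g': "proper k (inside E B) g'" "g' v = f v" "g' z \<noteq> f u" by auto
  let ?c = "\<lambda>x. if x \<in> A then f x else g' x"
  have "\<not> monochrom ?c e" using u z g'(3) unfolding not_monochrom_iff by (metis (full_types))
  then have "proper k E ?c" using oth g' v by (intro proper_glue[OF fA g'(1)]) auto
  then show False using crit_not_proper[OF cr] by metis
qed

text \<open>Otherwise the factor on \<open>A\<close> would be a subhypergraph of \<open>E\<close>
  missing a vertex, hence \<open>k\<close>-colourable. So the halves of \<open>e\<close> really are
  new edges, and a factor without its new edge is \<open>inside E A\<close>.\<close>

lemma hsplit_edge_notin:
  assumes cr: "crit k V E" and k: "k \<ge> 3" and sp: "hsplit V E A B v e"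
  shows "insert v (e \<inter> A) \<notin> E"
proof
  assume "insert v (e \<inter> A) \<in> E"
  then have "hpart E A v e = inside E A"
    using sp unfolding hpart_def inside_def hsplit_def by auto
  moreover obtain z where "z \<in> V" "z \<notin> A" using hsplit_witness[OF hsplit_commute[OF sp]] hsplitD(3)[OF sp] by (metis UnCI)
  ultimately show False
    using crit_inside_colourable[OF cr] hsplit_hpart_not_proper[OF cr k sp] by metis
qed

text \<open>For an old edge \<open>d\<close> of the factor, colour \<open>E - {d}\<close>. The other
  factor is not colourable, so its half of \<open>e\<close> is monochromatic; since \<open>e\<close>
  is not, the half in \<open>A\<close> is not monochromatic either.\<close>

lemma hsplit_crit:
  assumes cr: "crit k V E" and k: "k \<ge> 3" and sp: "hsplit V E A B v e"
  shows "crit k A (hpart E A v e)"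
proof -
  obtain x where x: "x \<in> e" "x \<in> A" "x \<noteq> v" "x \<notin> B" by (rule hsplit_witness[OF sp])
  obtain z where z: "z \<in> e" "z \<in> B" "z \<noteq> v" "z \<notin> A"
    by (rule hsplit_witness[OF hsplit_commute[OF sp]])
  note v = hsplitD(1-5)[OF sp] and oth = hsplitD(6)[OF sp]
  let ?a = "insert v (e \<inter> A)"
  have finA: "finite A" using cr v(3) unfolding crit_def by auto
  have c2: "\<And>g. g \<in> E \<Longrightarrow> 2 \<le> card g" using cr unfolding crit_def by auto
  have "\<Union>(hpart E A v e) = A"
  proof
    show "\<Union>(hpart E A v e) \<subseteq> A" using v unfolding hpart_def inside_def by auto
    show "A \<subseteq> \<Union>(hpart E A v e)"
    proof
      fix u assume u: "u \<in> A"
      then obtain g where g: "g \<in> E" "u \<in> g" using cr v(3) unfolding crit_def by blast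
      then have "g = e \<or> g \<subseteq> A \<or> u = v" using oth u v by blast
      then show "u \<in> \<Union>(hpart E A v e)" using g u unfolding hpart_def inside_def by auto
    qed
  qed
  moreover have "2 \<le> card g" if "g \<in> hpart E A v e" for g
  proof (cases "g = ?a")
    case True
    have "finite (e \<inter> A)" using finA by auto
    then have "card {v, x} \<le> card ?a" using x by (intro card_mono) auto
    then show ?thesis using True x by simp
  next
    case False
    then show ?thesis using that c2 unfolding hpart_def inside_def by auto
  qed
  moreover have "\<exists>f. proper k (hpart E A v e - {d}) f" if d: "d \<in> hpart E A v e" for d
  proof (cases "d = ?a")
    case True
    obtain f where "proper k (inside E A) f" using crit_inside_colourable[OF cr, of z A] z v by auto
    moreover have "hpart E A v e - {d} \<subseteq> inside E A" using True unfolding hpart_def by auto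
    ultimately show ?thesis using proper_mono by blast
  next
    case False
    then have dA: "d \<in> E" "d \<subseteq> A" using d unfolding hpart_def inside_def by auto
    then obtain c where c: "proper k (E - {d}) c" using cr unfolding crit_def by auto
    have "\<not> d \<subseteq> B"
    proof
      assume "d \<subseteq> B"
      then have "d \<subseteq> {v}" using dA v by auto
      then show False using c2[OF dA(1)] card_mono[of "{v}" d] by auto
    qed
    then have "proper k (inside E B) c" using c proper_mono[of k "E - {d}" c "inside E B"]
      unfolding inside_def by auto
    then have mb: "monochrom c (insert v (e \<inter> B))"
      using hsplit_hpart_not_proper[OF cr k hsplit_commute[OF sp], of c]
      unfolding proper_def hpart_def by auto
    have "\<not> monochrom c e" using c v(5) z dA unfolding proper_def by auto
    moreover have "e \<subseteq> A \<union> B" using crit_edge_subset[OF cr v(5)] v(3) by simp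
    ultimately have "\<not> monochrom c ?a"
      using mb monochrom_parts[of c v e A B] by blast
    then have "proper k (hpart E A v e - {d}) c"
      using c unfolding proper_def hpart_def inside_def by auto
    then show ?thesis by auto
  qed
  ultimately show ?thesis
    using hsplit_hpart_not_proper[OF cr k sp] finA unfolding crit_def by auto
qed

text \<open>Without \<open>d\<close>, the factor on \<open>A\<close> has a colouring that is not
  constant on its half of \<open>e\<close>. The factor on \<open>B\<close> without its new edge has
  a colouring that is constant on the other half. Matched at \<open>v\<close>, the two give
  \<open>e\<close> two colours.\<close>

lemma crit_join_remove:
  assumes sp: "hsplit V E A B v e" and cA: "crit k A (hpart E A v e)" and cB: "crit k B (hpart E B v e)"
    and nA: "insert v (e \<inter> A) \<notin> E" and nB: "insert v (e \<inter> B) \<notin> E"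
    and d: "d \<in> E" "d \<noteq> e" "d \<subseteq> A"
  shows "\<exists>f. proper k (E - {d}) f"
proof -
  obtain z where z: "z \<in> e" "z \<in> B" "z \<noteq> v" "z \<notin> A"
    by (rule hsplit_witness[OF hsplit_commute[OF sp]])
  note v = hsplitD(1-5)[OF sp] and oth = hsplitD(6)[OF sp]
  have "d \<in> hpart E A v e" using d unfolding hpart_def inside_def by auto
  then obtain f where f: "proper k (hpart E A v e - {d}) f" using cA unfolding crit_def by auto
  have "inside (E - {d}) A \<subseteq> hpart E A v e - {d}" unfolding hpart_def inside_def by auto
  with f have fA: "proper k (inside (E - {d}) A) f" by (rule proper_mono)
  have "insert v (e \<inter> A) \<in> hpart E A v e - {d}" using d nA unfolding hpart_def by auto
  then have "\<not> monochrom f (insert v (e \<inter> A))" using f unfolding proper_def by blast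
  then obtain u where u: "u \<in> e" "u \<in> A" "f u \<noteq> f v" unfolding monochrom_def by auto
  have lt: "f u < k" for u using f unfolding proper_def by auto
  have "insert v (e \<inter> B) \<in> hpart E B v e" unfolding hpart_def by auto
  then obtain g where g: "proper k (hpart E B v e - {insert v (e \<inter> B)}) g"
    using cB unfolding crit_def by auto
  have mb: "monochrom g (insert v (e \<inter> B))"
    using g crit_not_proper[OF cB, of g] unfolding proper_def by auto
  have "inside (E - {d}) B \<subseteq> hpart E B v e - {insert v (e \<inter> B)}"
    using nB unfolding hpart_def inside_def by auto
  with g have gB: "proper k (inside (E - {d}) B) g" by (rule proper_mono)
  obtain g' where g': "proper k (inside (E - {d}) B) g'" "g' v = f v" "\<And>u w. g' u = g' w \<longleftrightarrow> g u = g w"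
    by (rule proper_align[OF gB lt[of v], of v]) blast
  have "g z = g v" using monochromD[OF mb, of z v] z by auto
  then have "g' z = f v" using g'(2,3) by metis
  then have "\<not> monochrom (\<lambda>x. if x \<in> A then f x else g' x) e"
    using u z unfolding not_monochrom_iff by (metis (full_types))
  then have "proper k (E - {d}) (\<lambda>x. if x \<in> A then f x else g' x)"
    using oth g' v d by (intro proper_glue[OF fA g'(1)]) auto
  then show ?thesis by auto
qed

text \<open>Converse of \<open>hsplit_crit\<close>: a colouring of \<open>E\<close> would give both
  halves of \<open>e\<close> the single colour of \<open>v\<close>, making \<open>e\<close>
  monochromatic.\<close>

lemma crit_join:
  assumes k: "k \<ge> 2" and sp: "hsplit V E A B v e" and UE: "\<Union>E \<subseteq> V" and c2: "\<forall>g\<in>E. 2 \<le> card g"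
    and cA: "crit k A (hpart E A v e)" and cB: "crit k B (hpart E B v e)"
    and nA: "insert v (e \<inter> A) \<notin> E" and nB: "insert v (e \<inter> B) \<notin> E"
  shows "crit k V E"
proof -
  note v = hsplitD(1-5)[OF sp] and oth = hsplitD(6)[OF sp]
  have cov: "\<exists>g\<in>E. u \<in> g" if a: "crit k A (hpart E A v e)" "v \<in> A" "u \<in> A" for u A
  proof (cases "u = v")
    case True
    \<comment> \<open>The new edge is not in \<open>E\<close>, but \<open>v\<close> has degree at
      least \<open>k \<ge> 2\<close> in the factor, so an old edge covers \<open>v\<close>
      too.\<close>
    have "\<not> {g \<in> hpart E A v e. v \<in> g} \<subseteq> {insert v (e \<inter> A)}"
      using card_mono[of "{insert v (e \<inter> A)}" "{g \<in> hpart E A v e. v \<in> g}"]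
        crit_degree_ge[OF that(1) _ that(2)] k by auto
    then show ?thesis using True unfolding hpart_def inside_def by auto
  next
    case False
    have "u \<in> \<Union>(hpart E A v e)" using a unfolding crit_def by simp
    then obtain g where "g \<in> hpart E A v e" "u \<in> g" by blast
    then show ?thesis using False v(5) unfolding hpart_def inside_def by auto
  qed
  have "V \<subseteq> \<Union>E" using cov[OF cA v(1)] cov[OF cB v(2)] v(3) by blast
  moreover have "finite V" using cA cB v(3) unfolding crit_def by auto
  moreover have "\<not> proper k E f" for f
  proof
    assume f: "proper k E f"
    have "monochrom f (insert v (e \<inter> A))"
      using f crit_not_proper[OF cA, of f] unfolding proper_def hpart_def inside_def by auto
    moreover have "monochrom f (insert v (e \<inter> B))"
      using f crit_not_proper[OF cB, of f] unfolding proper_def hpart_def inside_def by auto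
    moreover have "e \<subseteq> A \<union> B" using UE v by auto
    ultimately have "monochrom f e" using monochrom_parts[of f v e A B] by blast
    then show False using f v(5) unfolding proper_def by auto
  qed
  moreover have "\<exists>f. proper k (E - {d}) f" if d: "d \<in> E" for d
  proof (cases "d = e")
    case True
    have "\<exists>f. proper k (inside E A) f" if a: "crit k A (hpart E A v e)" "insert v (e \<inter> A) \<notin> E" for A
    proof -
      obtain f where "proper k (hpart E A v e - {insert v (e \<inter> A)}) f"
        using a unfolding crit_def hpart_def by auto
      moreover have "inside E A \<subseteq> hpart E A v e - {insert v (e \<inter> A)}"
        using that unfolding hpart_def inside_def by auto
      ultimately show ?thesis using proper_mono by blast
    qed
    then obtain f g where f: "proper k (inside E A) f" and g: "proper k (inside E B) g"
      using cA cB nA nB by metis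
    have "f v < k" using f unfolding proper_def by auto
    then obtain g' where g': "proper k (inside E B) g'" "g' v = f v" using proper_align[OF g] by metis
    then have "proper k (E - {d}) (\<lambda>x. if x \<in> A then f x else g' x)"
      using oth v True by (intro proper_glue[OF f g'(1)]) auto
    then show ?thesis by auto
  next
    case False
    then have "d \<subseteq> A \<or> d \<subseteq> B" using oth d by auto
    then show ?thesis
      using crit_join_remove[OF sp cA cB nA nB d False]
        crit_join_remove[OF hsplit_commute[OF sp] cB cA nB nA d False] by auto
  qed
  ultimately show ?thesis using UE c2 unfolding crit_def by auto
qed

text \<open>Complementary sets have the same cut edges, so the separating set can be made to avoid
  any given vertex.\<close>

lemma sep_leE:
  assumes "sep_le k V E" "\<Union>E \<subseteq> V" "x \<in> V" "y \<in> V" "x \<noteq> y"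
  obtains Z where "Z \<subseteq> V" "(x \<in> Z) \<noteq> (y \<in> Z)" "card (bd E Z) \<le> k" "v \<notin> Z"
proof -
  obtain Z where Z: "(x \<in> Z) \<noteq> (y \<in> Z)" "card (bd E Z) \<le> k"
    using assms unfolding sep_le_def by metis
  let ?Z = "if v \<in> Z then V - Z else Z \<inter> V"
  have "card (bd E ?Z) \<le> k" using Z bd_compl[OF assms(2)] bd_inter[OF assms(2)] by auto
  then show ?thesis using that[of ?Z] Z assms(3,4) by auto
qed

text \<open>Take a separating \<open>Z\<close> without \<open>v\<close>. If the new edge crosses
  \<open>Z\<close>, it must be traded for an edge of \<open>E\<close> that crosses \<open>Z\<close>
  and is not inside \<open>A\<close>. If \<open>e\<close> is not inside \<open>Z\<close>, then
  \<open>e\<close> serves. Otherwise \<open>Z\<close> also cuts the other factor, which is critical,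
  so at least \<open>k\<close> of its edges cross \<open>Z\<close> and one of them is old.\<close>

lemma hsplit_sep_le:
  assumes cr: "crit k V E" and k: "k \<ge> 3" and sp: "hsplit V E A B v e" and le: "sep_le k V E"
  shows "sep_le k A (hpart E A v e)"
  unfolding sep_le_def
proof (intro ballI impI)
  fix x y assume xy: "x \<in> A" "y \<in> A" "x \<noteq> y"
  obtain z where z: "z \<in> e" "z \<in> B" "z \<noteq> v" "z \<notin> A"
    by (rule hsplit_witness[OF hsplit_commute[OF sp]])
  note v = hsplitD(1-5)[OF sp] and oth = hsplitD(6)[OF sp]
  let ?a = "insert v (e \<inter> A)" and ?b = "insert v (e \<inter> B)"
  obtain Z where Z: "(x \<in> Z) \<noteq> (y \<in> Z)" "card (bd E Z) \<le> k" "v \<notin> Z"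
  proof (rule sep_leE[OF le, of x y v])
    show "\<Union>E \<subseteq> V" "x \<in> V" "y \<in> V" "x \<noteq> y" using cr xy v(3) unfolding crit_def by auto
  qed blast
  have fin: "finite (bd E Z)" using crit_finite_edges[OF cr] unfolding bd_def by auto
  have "\<exists>e'\<in>bd E Z. \<not> e' \<subseteq> A" if "?a \<in> bd (hpart E A v e) Z"
  proof (cases "e \<subseteq> Z")
    case False
    have "e \<inter> Z \<noteq> {}" using that Z(3) unfolding bd_def by auto
    then have "e \<in> bd E Z" using False v unfolding bd_def by auto
    then show ?thesis using z by auto
  next
    case True
    have "z \<in> Z" using True z by auto
    then have "k \<le> card (bd (hpart E B v e) Z)"
      using crit_cut_ge[OF hsplit_crit[OF cr k hsplit_commute[OF sp]], of z v Z] z v Z by auto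
    then have "\<not> bd (hpart E B v e) Z \<subseteq> {?b}"
      using k card_mono[of "{?b}" "bd (hpart E B v e) Z"] by auto
    then obtain g where g: "g \<in> bd (hpart E B v e) Z" "g \<noteq> ?b" by auto
    then have "g \<in> bd E Z" "g \<subseteq> B" unfolding bd_def hpart_def inside_def by auto
    moreover have "\<not> g \<subseteq> A"
    proof
      assume "g \<subseteq> A"
      then have "g \<subseteq> {v}" using \<open>g \<subseteq> B\<close> v(4) by auto
      then show False using g(1) Z(3) unfolding bd_def by auto
    qed
    ultimately show ?thesis by auto
  qed
  then obtain e' where e': "?a \<in> bd (hpart E A v e) Z \<longrightarrow> e' \<in> bd E Z \<and> \<not> e' \<subseteq> A" by metis
  define U where "U = (if ?a \<in> bd (hpart E A v e) Z then insert ?a (bd E Z - {e'}) else bd E Z)"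
  have "finite U" using fin unfolding U_def by simp
  moreover have "bd (hpart E A v e) Z \<subseteq> U"
    using e' unfolding U_def bd_def hpart_def inside_def by auto
  ultimately have "card (bd (hpart E A v e) Z) \<le> card U" by (rule card_mono)
  also have "card U \<le> card (bd E Z)"
  proof (cases "?a \<in> bd (hpart E A v e) Z")
    case True
    then have "Suc (card (bd E Z - {e'})) = card (bd E Z)" using e' card.remove[OF fin, of e'] by simp
    then show ?thesis using True fin unfolding U_def by (simp add: card_insert_if)
  qed (simp add: U_def)
  finally have "card (bd (hpart E A v e) Z) \<le> card (bd E Z)" .
  then show "\<exists>Z. (x \<in> Z) \<noteq> (y \<in> Z) \<and> card (bd (hpart E A v e) Z) \<le> k"
    using Z by (meson order_trans)
qed

text \<open>A cut inside \<open>A\<close> that avoids \<open>v\<close> is crossed only by edges of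
  the factor, with \<open>e\<close> in the role of its half.\<close>

lemma join_bd_le:
  assumes fE: "finite E" and sp: "hsplit V E A B v e" and nA: "insert v (e \<inter> A) \<notin> E"
    and Z: "v \<notin> Z" "Z \<subseteq> A"
  shows "card (bd E Z) \<le> card (bd (hpart E A v e) Z)"
proof -
  obtain z where z: "z \<in> e" "z \<in> B" "z \<noteq> v" "z \<notin> A"
    by (rule hsplit_witness[OF hsplit_commute[OF sp]])
  note v = hsplitD(1-5)[OF sp] and oth = hsplitD(6)[OF sp]
  let ?a = "insert v (e \<inter> A)"
  let ?f = "\<lambda>g. if g = ?a then e else g"
  have "bd E Z \<subseteq> ?f ` bd (hpart E A v e) Z"
  proof
    fix g assume g: "g \<in> bd E Z"
    show "g \<in> ?f ` bd (hpart E A v e) Z"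
    proof (cases "g = e")
      case True
      then have "?a \<in> bd (hpart E A v e) Z" using g Z unfolding bd_def hpart_def by auto
      then show ?thesis using True by force
    next
      case False
      have "g \<in> E" using g unfolding bd_def by auto
      have "\<not> g \<subseteq> B"
      proof
        assume "g \<subseteq> B"
        then have "g \<inter> Z \<subseteq> A \<inter> B" using Z(2) by auto
        then show False using g Z(1) v(4) unfolding bd_def by auto
      qed
      then have "g \<in> bd (hpart E A v e) Z" using oth[OF \<open>g \<in> E\<close> False] g
        unfolding bd_def hpart_def inside_def by auto
      moreover have "g \<noteq> ?a" using nA \<open>g \<in> E\<close> by auto
      ultimately show ?thesis by force
    qed
  qed
  moreover have "finite (bd (hpart E A v e) Z)" using fE unfolding bd_def hpart_def inside_def by auto
  ultimately show ?thesis by (rule surj_card_le[rotated])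
qed

text \<open>Vertices in different parts are separated by separating one of them from
  \<open>v\<close> within its own part.\<close>

lemma join_sep_le:
  assumes fE: "finite E" and sp: "hsplit V E A B v e" and UE: "\<Union>E \<subseteq> V"
    and lA: "sep_le k A (hpart E A v e)" and lB: "sep_le k B (hpart E B v e)"
    and nA: "insert v (e \<inter> A) \<notin> E" and nB: "insert v (e \<inter> B) \<notin> E"
  shows "sep_le k V E"
proof -
  have v: "v \<in> A" "v \<in> B" "A \<union> B = V" "A \<inter> B = {v}" using sp unfolding hsplit_def by auto
  have *: "\<exists>Z. (x \<in> Z) \<noteq> (y \<in> Z) \<and> card (bd E Z) \<le> k \<and> Z \<subseteq> A \<and> v \<notin> Z"
    if sp': "hsplit V E A B v e" and lA': "sep_le k A (hpart E A v e)" and nA': "insert v (e \<inter> A) \<notin> E"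
      and xy: "x \<in> A" "y \<in> A" "x \<noteq> y" for A B x y
  proof -
    have "v \<in> A" using sp' unfolding hsplit_def by auto
    then have U: "\<Union>(hpart E A v e) \<subseteq> A" unfolding hpart_def inside_def by auto
    obtain Z where Z: "Z \<subseteq> A" "(x \<in> Z) \<noteq> (y \<in> Z)" "card (bd (hpart E A v e) Z) \<le> k" "v \<notin> Z"
      by (rule sep_leE[OF lA' U xy])
    then show ?thesis using join_bd_le[OF fE sp' nA' Z(4,1)] by (meson order_trans)
  qed
  have **: "\<exists>Z. (x \<in> Z) \<noteq> (y \<in> Z) \<and> card (bd E Z) \<le> k" if "x \<in> A" "y \<in> B" "x \<noteq> v" for x y
  proof -
    have "\<exists>Z. (x \<in> Z) \<noteq> (v \<in> Z) \<and> card (bd E Z) \<le> k \<and> Z \<subseteq> A \<and> v \<notin> Z"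
      using *[OF sp lA nA that(1) v(1) that(3)] .
    then obtain Z where Z: "(x \<in> Z) \<noteq> (v \<in> Z)" "card (bd E Z) \<le> k" "Z \<subseteq> A" "v \<notin> Z" by blast
    then have "y \<notin> Z" using that v by auto
    then show ?thesis using Z by auto
  qed
  show ?thesis unfolding sep_le_def
  proof (intro ballI impI)
    fix x y assume xy: "x \<in> V" "y \<in> V" "x \<noteq> y"
    consider "x \<in> A" "y \<in> A" | "x \<in> B" "y \<in> B" | "x \<in> A" "y \<in> B" "x \<noteq> v" | "y \<in> A" "x \<in> B" "y \<noteq> v"
      using xy v by blast
    then show "\<exists>Z. (x \<in> Z) \<noteq> (y \<in> Z) \<and> card (bd E Z) \<le> k"
    proof cases
      case 1 then show ?thesis using *[OF sp lA nA _ _ xy(3)] by blast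
    next
      case 2 then show ?thesis using *[OF hsplit_commute[OF sp] lB nB _ _ xy(3)] by blast
    next
      case 3 then show ?thesis using ** by blast
    next
      case 4 then show ?thesis using **[of y x] by metis
    qed
  qed
qed

subsection \<open>Closing off one side of a tight cut\<close>

lemma bd_posimodular:
  assumes "finite E"
  shows "card (bd E (Z - X)) + card (bd E (X - Z)) \<le> card (bd E Z) + card (bd E X)"
proof -
  have fin: "finite (bd E Y)" for Y using assms unfolding bd_def by auto
  have "bd E (Z - X) \<union> bd E (X - Z) \<subseteq> bd E Z \<union> bd E X" unfolding bd_def by blast
  moreover have "bd E (Z - X) \<inter> bd E (X - Z) \<subseteq> bd E Z \<inter> bd E X" unfolding bd_def by blast
  ultimately have "card (bd E (Z - X) \<union> bd E (X - Z)) + card (bd E (Z - X) \<inter> bd E (X - Z))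
      \<le> card (bd E Z \<union> bd E X) + card (bd E Z \<inter> bd E X)"
    using fin by (intro add_mono card_mono) auto
  then show ?thesis using card_Un_Int[OF fin fin] by metis
qed

text \<open>If \<open>Z\<close> separates \<open>y\<close> from \<open>u\<close> and does not
  contain \<open>X\<close>, then \<open>X - Z\<close> is a proper cut and has at least
  \<open>k\<close> edges, so posimodularity leaves at most \<open>k\<close> for
  \<open>Z - X\<close>. If \<open>Z\<close> contains \<open>X\<close>, its complement lies outside
  \<open>X\<close>.\<close>

lemma uncross:
  assumes cr: "crit k V E" and X: "X \<subseteq> V" "card (bd E X) \<le> k" and le: "sep_le k V E"
    and y: "y \<in> V - X" and u: "u \<in> V" "u \<noteq> y"
  obtains Z where "Z \<subseteq> V - X" "(y \<in> Z) \<noteq> (u \<in> Z)" "card (bd E Z) \<le> k"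
proof -
  have UV: "\<Union>E \<subseteq> V" using cr unfolding crit_def by auto
  obtain Z where Z: "Z \<subseteq> V" "(y \<in> Z) \<noteq> (u \<in> Z)" "card (bd E Z) \<le> k" "u \<notin> Z"
    using sep_leE[OF le UV _ u(1) u(2)[symmetric], of u] y by blast
  show thesis
  proof (cases "X \<subseteq> Z")
    case True
    then show thesis using that[of "V - Z"] Z y u bd_compl[OF UV, of Z] by auto
  next
    case False
    then obtain x where "x \<in> X" "x \<notin> Z" by auto
    then have "k \<le> card (bd E (X - Z))" using crit_cut_ge[OF cr, of x y "X - Z"] X Z y by auto
    then have "card (bd E (Z - X)) \<le> k"
      using bd_posimodular[OF crit_finite_edges[OF cr], of Z X] X Z by linarith
    then show thesis using that[of "Z - X"] Z y by auto
  qed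
qed

text \<open>The set \<open>h\<close> of the overview.\<close>

definition ends :: "'a set set \<Rightarrow> 'a set \<Rightarrow> 'a set" where
  "ends E X = X \<inter> \<Union>(bd E X)"

definition closed_side :: "'a set set \<Rightarrow> 'a set \<Rightarrow> 'a set set" where
  "closed_side E X = insert (ends E X) (inside E X)"

locale mono_cut =
  fixes k :: nat and V :: "'a set" and E :: "'a set set" and X :: "'a set"
  assumes cr: "crit k V E" and k3: "k \<ge> 3" and XV: "X \<subseteq> V" and tight: "card (bd E X) = k"
    and ms: "mono_side k V E X" and X2: "2 \<le> card X"
begin

lemma finX: "finite X" using cr XV unfolding crit_def by (meson finite_subset)

lemma UE: "\<Union>E = V" using cr unfolding crit_def by auto

lemma edge_cases:
  assumes "g \<in> E"
  obtains "g \<subseteq> X" "g \<in> inside E X" | "g \<inter> X = {}" "g \<subseteq> V - X"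
    | "g \<in> bd E X" "g \<inter> X \<subseteq> ends E X" "g \<inter> X \<noteq> {}" "g - X \<noteq> {}"
  using assms UE unfolding ends_def bd_def inside_def by blast

lemma outside: obtains y where "y \<in> V" "y \<notin> X"
proof -
  have "bd E X \<noteq> {}" using tight k3 by auto
  then show thesis using that UE unfolding bd_def by blast
qed

lemma ends_subset: "ends E X \<subseteq> X" unfolding ends_def by auto

text \<open>A single end would be a cut vertex, and colourings of the two sides could be matched
  there and glued.\<close>

lemma ends_card: "2 \<le> card (ends E X)"
proof (rule ccontr)
  assume "\<not> 2 \<le> card (ends E X)"
  moreover have "bd E X \<noteq> {}" using tight k3 by auto
  then have "ends E X \<noteq> {}" unfolding ends_def bd_def by blast
  moreover have "finite (ends E X)" using finX ends_subset by (rule finite_subset[rotated])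
  ultimately have "card (ends E X) = 1" by (metis One_nat_def Suc_1 card_0_eq less_2_cases not_le)
  then obtain x where x: "ends E X = {x}" by (metis card_1_singletonE)
  then have xX: "x \<in> X" using ends_subset by auto
  let ?W = "insert x (V - X)"
  have "\<not> X \<subseteq> {x}" using X2 card_mono[of "{x}" X] by auto
  then obtain x' where "x' \<in> X" "x' \<noteq> x" by auto
  then obtain c where c: "proper k (inside E ?W) c"
    using crit_inside_colourable[OF cr, of x' ?W] XV by auto
  obtain y where "y \<in> V" "y \<notin> X" by (rule outside)
  then obtain f where f: "proper k (inside E X) f"
    using crit_inside_colourable[OF cr, of y X] by auto
  have "c x < k" using c unfolding proper_def by auto
  then obtain f' where f': "proper k (inside E X) f'" "f' x = c x" using proper_align[OF f] by metis
  have "g \<subseteq> X \<or> g \<subseteq> ?W" if "g \<in> E" for g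
    using that
  proof (cases rule: edge_cases)
    case 3
    then show ?thesis using x UE that by auto
  qed auto
  then have "proper k E (\<lambda>u. if u \<in> X then f' u else c u)"
    using f'(2) by (intro proper_glue[OF f'(1) c]) auto
  then show False using crit_not_proper[OF cr] by metis
qed

text \<open>The two halves of \<open>mono_side\<close> give the two halves of criticality. Suppose a
  colouring of \<open>E - {d}\<close> is constant on the ends, with colour \<open>a\<close>. Then
  some cut edge has the colour \<open>a\<close> on all its outer vertices as well and is
  monochromatic.\<close>

lemma closed_side_crit: "crit k X (closed_side E X)"
proof -
  have "\<Union>(closed_side E X) = X"
  proof
    show "\<Union>(closed_side E X) \<subseteq> X" using ends_subset unfolding closed_side_def inside_def by auto
    show "X \<subseteq> \<Union>(closed_side E X)"
    proof
      fix u assume u: "u \<in> X"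
      then obtain g where "g \<in> E" "u \<in> g" using UE XV by blast
      then show "u \<in> \<Union>(closed_side E X)"
        using u by (cases rule: edge_cases) (auto simp: closed_side_def)
    qed
  qed
  moreover have "2 \<le> card g" if "g \<in> closed_side E X" for g
    using that ends_card cr unfolding closed_side_def inside_def crit_def by auto
  moreover have "\<not> proper k (closed_side E X) f" for f
  proof
    assume f: "proper k (closed_side E X) f"
    then have "proper k (inside E X) f" by (rule proper_mono) (auto simp: closed_side_def)
    then have "monochrom f (ends E X)" using ms unfolding mono_side_def ends_def by auto
    then show False using f unfolding proper_def closed_side_def by auto
  qed
  moreover have "\<exists>f. proper k (closed_side E X - {d}) f" if d: "d \<in> closed_side E X" for d
  proof (cases "d = ends E X")
    case True
    obtain y where "y \<in> V" "y \<notin> X" by (rule outside)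
    then obtain f where "proper k (inside E X) f"
      using crit_inside_colourable[OF cr, of y X] by auto
    then have "proper k (closed_side E X - {d}) f"
      by (rule proper_mono) (auto simp: closed_side_def True)
    then show ?thesis by auto
  next
    case False
    then have dX: "d \<in> E" "d \<subseteq> X" using d unfolding closed_side_def inside_def by auto
    obtain c where c: "proper k (E - {d}) c" using cr dX unfolding crit_def by auto
    have "\<not> monochrom c (ends E X)"
    proof
      assume "monochrom c (ends E X)"
      then obtain a where a: "\<And>u. u \<in> ends E X \<Longrightarrow> c u = a" unfolding monochrom_def by auto
      obtain u where "u \<in> ends E X" using ends_card by fastforce
      then have "a < k" using a c unfolding proper_def by auto
      have "d \<noteq> {}" using cr dX unfolding crit_def by force
      then have "inside E (V - X) \<subseteq> E - {d}" using dX unfolding inside_def by auto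
      then have "proper k (inside E (V - X)) c" using c proper_mono by blast
      then obtain e where e: "e \<in> bd E X" "\<forall>u\<in>e - X. c u = a"
        using ms \<open>a < k\<close> unfolding mono_side_def by blast
      have "c u = a" if "u \<in> e" for u
      proof (cases "u \<in> X")
        case True
        then have "u \<in> ends E X" using e(1) that unfolding ends_def by auto
        then show ?thesis by (rule a)
      qed (use e that in auto)
      then have "monochrom c e" unfolding monochrom_def by auto
      moreover have "e \<in> E - {d}" using e(1) dX(2) unfolding bd_def by auto
      ultimately show False using c unfolding proper_def by auto
    qed
    then have "proper k (closed_side E X - {d}) c"
      using c unfolding proper_def closed_side_def inside_def by auto
    then show ?thesis by auto
  qed
  ultimately show ?thesis using finX unfolding crit_def by auto
qed

text \<open>\<open>uncross\<close> for the complement of \<open>X\<close>, which has the same tight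
  cut.\<close>

lemma separate_inside:
  assumes le: "sep_le k V E" and xy: "x \<in> X" "y \<in> X" "x \<noteq> y"
  obtains Z where "Z \<subseteq> X" "(x \<in> Z) \<noteq> (y \<in> Z)" "card (bd E Z) \<le> k"
proof -
  have eq: "V - (V - X) = X" using XV by auto
  have b: "bd E (V - X) = bd E X" using UE by (simp add: bd_compl)
  obtain Z where "Z \<subseteq> V - (V - X)" "(x \<in> Z) \<noteq> (y \<in> Z)" "card (bd E Z) \<le> k"
    by (rule uncross[OF cr _ _ le, of "V - X" x y]) (use xy XV b tight in auto)
  then show thesis using that eq by auto
qed

text \<open>Choose \<open>Z\<close> inside \<open>X\<close>. If the new edge crosses
  \<open>Z\<close>, then so does a cut edge with an end in \<open>Z\<close>, and this edge is lost
  in the closed side.\<close>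

lemma closed_side_sep_le:
  assumes le: "sep_le k V E"
  shows "sep_le k X (closed_side E X)"
  unfolding sep_le_def
proof (intro ballI impI)
  fix x y assume "x \<in> X" "y \<in> X" "x \<noteq> y"
  then obtain Z where Z: "Z \<subseteq> X" "(x \<in> Z) \<noteq> (y \<in> Z)" "card (bd E Z) \<le> k"
    by (rule separate_inside[OF le])
  let ?f = "\<lambda>g. if g \<subseteq> X then g else ends E X"
  have "bd (closed_side E X) Z \<subseteq> ?f ` bd E Z"
  proof
    fix g assume g: "g \<in> bd (closed_side E X) Z"
    show "g \<in> ?f ` bd E Z"
    proof (cases "g \<in> inside E X")
      case True
      then have "g \<in> bd E Z" "g \<subseteq> X" using g unfolding bd_def inside_def by auto
      then show ?thesis by force
    next
      case False
      then have gh: "g = ends E X" using g unfolding bd_def closed_side_def by auto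
      then obtain u where u: "u \<in> ends E X" "u \<in> Z" using g unfolding bd_def by auto
      then obtain e where e: "e \<in> bd E X" "u \<in> e" unfolding ends_def by auto
      then have "e \<in> bd E Z" "\<not> e \<subseteq> X" using u Z(1) unfolding bd_def by auto
      then show ?thesis using gh by force
    qed
  qed
  moreover have "finite (bd E Z)" using crit_finite_edges[OF cr] unfolding bd_def by auto
  ultimately have "card (bd (closed_side E X) Z) \<le> card (bd E Z)" by (rule surj_card_le[rotated])
  then show "\<exists>Z. (x \<in> Z) \<noteq> (y \<in> Z) \<and> card (bd (closed_side E X) Z) \<le> k"
    using Z by (meson order_trans)
qed

definition single_end :: "'a \<Rightarrow> 'a set \<Rightarrow> bool" where
  "single_end z e \<longleftrightarrow> e \<in> bd E X \<and> z \<in> e \<and> (\<forall>e'\<in>bd E X. z \<in> e' \<longrightarrow> e' = e)"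

text \<open>Separate \<open>a\<close> from \<open>b\<close> by some \<open>Z\<close> inside
  \<open>X\<close>. The closed side is critical, so at least \<open>k\<close> of its edges cross
  \<open>Z\<close>, and at most one of them is new. Hence \<open>k - 1\<close> of the at most
  \<open>k\<close> edges of \<open>E\<close> crossing \<open>Z\<close> lie inside \<open>X\<close>,
  which leaves room for one cut edge at the end that belongs to \<open>Z\<close>.\<close>

lemma single_end_exists:
  assumes le: "sep_le k V E" and ab: "a \<in> ends E X" "b \<in> ends E X" "a \<noteq> b"
  shows "\<exists>z\<in>{a, b}. \<exists>e. single_end z e"
proof -
  have abX: "a \<in> X" "b \<in> X" using ab ends_subset by auto
  obtain Z where Z: "Z \<subseteq> X" "(a \<in> Z) \<noteq> (b \<in> Z)" "card (bd E Z) \<le> k"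
    by (rule separate_inside[OF le abX ab(3)])
  define z where "z = (if a \<in> Z then a else b)"
  have z: "z \<in> Z" "z \<in> {a, b}" "z \<in> ends E X" using Z ab unfolding z_def by auto
  let ?I = "{g \<in> bd E Z. g \<subseteq> X}" and ?F = "{e \<in> bd E X. z \<in> e}"
  have fin: "finite (bd E Y)" for Y using crit_finite_edges[OF cr] unfolding bd_def by auto
  have finI: "finite ?I" using fin[of Z] by simp
  have "k \<le> card (bd (closed_side E X) Z)"
    using crit_cut_ge[OF closed_side_crit abX Z(2)] .
  also have "\<dots> \<le> card (insert (ends E X) ?I)"
    using finI by (intro card_mono) (auto simp: bd_def closed_side_def inside_def)
  also have "\<dots> \<le> card ?I + 1" using finI by (simp add: card_insert_if)
  finally have "k \<le> card ?I + 1" .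
  moreover have "card (?I \<union> ?F) \<le> card (bd E Z)"
    using fin z Z(1) by (intro card_mono) (auto simp: bd_def)
  moreover have "card (?I \<union> ?F) = card ?I + card ?F"
    using fin[of Z] fin[of X] by (intro card_Un_disjoint) (simp_all, auto simp: bd_def)
  ultimately have F1: "card ?F \<le> Suc 0" using Z(3) by linarith
  obtain e where e: "e \<in> bd E X" "z \<in> e" using z(3) unfolding ends_def by auto
  have "e' = e" if "e' \<in> bd E X" "z \<in> e'" for e'
    using F1 fin[of X] that e by (auto simp: card_le_Suc0_iff_eq)
  then show ?thesis using e z unfolding single_end_def by blast
qed

section \<open>Lifting a splitting of the closed side\<close>

text \<open>Splitting at an old edge leaves the ends in one part, and everything outside
  \<open>X\<close> can be attached to that part.\<close>

lemma split_extend: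
  assumes sp: "hsplit X (closed_side E X) A B v e" and ne: "ends E X \<noteq> e" and hA: "ends E X \<subseteq> A"
  shows "hsplit V E (A \<union> (V - X)) B v e"
proof -
  note D = hsplitD[OF sp]
  have eI: "e \<in> inside E X" using D(5) ne unfolding closed_side_def by auto
  have "g \<subseteq> A \<union> (V - X) \<or> g \<subseteq> B" if "g \<in> E" "g \<noteq> e" for g
    using that(1)
  proof (cases rule: edge_cases)
    case 1
    then show ?thesis using D(6)[of g] that(2) unfolding closed_side_def by auto
  next
    case 3
    then show ?thesis using hA UE that(1) by blast
  qed auto
  moreover have "A \<union> (V - X) \<union> B = V" "(A \<union> (V - X)) \<inter> B = {v}" using D(1-4) XV by auto
  moreover have "e \<inter> (A \<union> (V - X) - {v}) \<noteq> {}" "e \<inter> (B - {v}) \<noteq> {}"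
    using sp unfolding hsplit_def by auto
  ultimately show ?thesis using eI unfolding hsplit_def inside_def by auto
qed

text \<open>All cut edges avoid \<open>A - {v}\<close> except the only one at \<open>l\<close>,
  which becomes the edge of the splitting.\<close>

lemma split_at_ends:
  assumes v: "v \<in> X" "A \<union> B = X" "A \<inter> B = {v}" and l: "l \<in> A" "l \<noteq> v"
    and cov: "\<And>g. g \<in> inside E X \<Longrightarrow> g \<subseteq> A \<or> g \<subseteq> B" and hA: "ends E X \<subseteq> insert l B"
    and e: "single_end l e"
  shows "hsplit V E A (B \<union> (V - X)) v e"
proof -
  have e': "e \<in> bd E X" "l \<in> e" "\<And>e'. e' \<in> bd E X \<Longrightarrow> l \<in> e' \<Longrightarrow> e' = e"
    using e unfolding single_end_def by auto
  have "g \<subseteq> A \<or> g \<subseteq> B \<union> (V - X)" if "g \<in> E" "g \<noteq> e" for g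
    using that(1)
  proof (cases rule: edge_cases)
    case 1
    then show ?thesis using cov by auto
  next
    case 3
    then have "l \<notin> g" using e'(3) that(2) by blast
    then show ?thesis using 3 hA UE that(1) by blast
  qed auto
  moreover have "A \<union> (B \<union> (V - X)) = V" unfolding Un_assoc[symmetric] v(2) using XV by auto
  moreover have "A \<inter> (V - X) = {}" using v(2) by auto
  then have "A \<inter> (B \<union> (V - X)) = {v}" using v(3) by (simp add: Int_Un_distrib)
  moreover have "e \<inter> (A - {v}) \<noteq> {}" using e'(2) l by auto
  moreover have "e \<inter> (B \<union> (V - X) - {v}) \<noteq> {}"
  proof -
    obtain y where "y \<in> e" "y \<notin> X" using e'(1) unfolding bd_def by auto
    moreover have "y \<in> V" using \<open>y \<in> e\<close> e'(1) UE unfolding bd_def by auto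
    ultimately show ?thesis using v(1) by auto
  qed
  ultimately show ?thesis using e'(1) unfolding hsplit_def bd_def by auto
qed

text \<open>By \<open>single_end_exists\<close> all ends but at most one lie in a single cut edge.
  The assumption \<open>tree\<close>, later supplied by \<open>large_edge_split\<close>, is applied
  with this exceptional end as \<open>b\<close>.\<close>

lemma splits:
  assumes le: "sep_le k V E"
    and tree: "\<And>b. 3 \<le> card (ends E X) \<Longrightarrow> \<exists>A B v e. hsplit X (closed_side E X) A B v e
      \<and> (ends E X \<noteq> e \<or> (\<exists>l. l \<noteq> b \<and> e \<inter> (A - {v}) = {l}))"
  shows "\<exists>A B v e. hsplit V E A B v e"
proof (cases "card (ends E X) = 2")
  case True
  then obtain a' b' where ab': "ends E X = {a', b'}" "a' \<noteq> b'" by (meson card_2_iff)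
  then obtain a b e where ab: "ends E X = {a, b}" "a \<noteq> b" and e: "single_end a e"
    using single_end_exists[OF le, of a' b'] by auto
  \<comment> \<open>With only two ends no splitting of the closed side is required: \<open>b\<close>
    is the split vertex, and the only cut edge at \<open>a\<close> is the edge of the
    splitting.\<close>
  have "hsplit V E X ({b} \<union> (V - X)) b e"
    using ab ends_subset e by (intro split_at_ends[where l = a]) (auto simp: inside_def)
  then show ?thesis by blast
next
  case False
  then have "3 \<le> card (ends E X)" using ends_card by simp
  obtain b where b: "\<And>l. l \<in> ends E X \<Longrightarrow> l \<noteq> b \<Longrightarrow> \<exists>e. single_end l e"
    using single_end_exists[OF le] by (metis insert_iff singletonD)
  obtain A B v e where sp: "hsplit X (closed_side E X) A B v e"
    and alt: "ends E X \<noteq> e \<or> (\<exists>l. l \<noteq> b \<and> e \<inter> (A - {v}) = {l})"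
    using tree[OF \<open>3 \<le> card (ends E X)\<close>] by metis
  note D = hsplitD[OF sp]
  show ?thesis
  proof (cases "ends E X = e")
    case False
    then have "ends E X \<subseteq> A \<or> ends E X \<subseteq> B" using D(6)[of "ends E X"] unfolding closed_side_def by auto
    then show ?thesis using split_extend[OF sp False] split_extend[OF hsplit_commute[OF sp] False] by blast
  next
    case True
    then obtain l where l: "l \<noteq> b" "e \<inter> (A - {v}) = {l}" using alt by auto
    then obtain F where "single_end l F" using b[of l] True by auto
    moreover have "g \<subseteq> A \<or> g \<subseteq> B" if "g \<in> inside E X" for g
    proof (cases "g = e")
      case True
      \<comment> \<open>If the ends formed an old edge, the closed side would be a subhypergraph of
        \<open>E\<close> missing a vertex, hence colourable.\<close>
      have "\<not> e \<in> E"
      proof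
        assume "e \<in> E"
        then have "closed_side E X = inside E X"
          using \<open>ends E X = e\<close> ends_subset unfolding closed_side_def inside_def by auto
        moreover obtain y where "y \<in> V" "y \<notin> X" by (rule outside)
        ultimately show False
          using crit_inside_colourable[OF cr] crit_not_proper[OF closed_side_crit] by metis
      qed
      then show ?thesis using True that unfolding inside_def by auto
    next
      case False
      then show ?thesis using D(6)[of g] that unfolding closed_side_def by auto
    qed
    moreover have "ends E X \<subseteq> insert l B" using l D(1-4) True ends_subset by auto
    ultimately have "hsplit V E A (B \<union> (V - X)) v F"
      using D(1-4) l by (intro split_at_ends[where l = l]) auto
    then show ?thesis by blast
  qed
qed

end

section \<open>Splittings at a prescribed large edge\<close>

text \<open>The new edge of the factor stays in one part \<open>C\<close>, so \<open>B\<close> can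
  be attached to \<open>C\<close> and the splitting survives in \<open>E\<close>.\<close>

lemma hpart_split_outer:
  assumes sp: "hsplit V E A B v e" and sp': "hsplit A (hpart E A v e) C D u g" and ne: "insert v (e \<inter> A) \<noteq> g"
    and aC: "insert v (e \<inter> A) \<subseteq> C" and eV: "e \<subseteq> V"
  shows "hsplit V E (C \<union> B) D u g" "g \<noteq> e"
proof -
  note S = hsplitD[OF sp] and T = hsplitD[OF sp']
  have g: "g \<in> E" "g \<subseteq> A" using T(5) ne unfolding hpart_def inside_def by auto
  show "g \<noteq> e" using g S sp unfolding hsplit_def by blast
  have "v \<in> C" using aC by auto
  have "B \<inter> D \<subseteq> {u}" using S(4) T(3,4) \<open>v \<in> C\<close> by blast
  have "e \<subseteq> C \<union> B" using eV aC S(3) by blast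
  moreover have "d \<subseteq> C \<union> B \<or> d \<subseteq> D" if d: "d \<in> E" "d \<noteq> g" "d \<noteq> e" for d
    using S(6)[OF d(1,3)] T(6)[of d] d unfolding hpart_def inside_def by blast
  ultimately have "\<forall>d\<in>E. d \<noteq> g \<longrightarrow> d \<subseteq> C \<union> B \<or> d \<subseteq> D" by blast
  moreover have "C \<union> B \<union> D = V" using S(3) T(3) by auto
  moreover have "(C \<union> B) \<inter> D = {u}" using T(4) \<open>B \<inter> D \<subseteq> {u}\<close> by auto
  moreover have "g \<inter> (C \<union> B - {u}) \<noteq> {}" "g \<inter> (D - {u}) \<noteq> {}"
    using sp' unfolding hsplit_def by auto
  ultimately show "hsplit V E (C \<union> B) D u g" using g unfolding hsplit_def by auto
qed

text \<open>Here the factor is split at its new edge, which meets the block \<open>C\<close> apart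
  from \<open>u\<close> only in an old vertex \<open>l\<close> of \<open>e\<close>. So
  \<open>e\<close> takes over as the edge of the splitting and \<open>B\<close> goes to the opposite
  part.\<close>

lemma hpart_split_inner:
  assumes sp: "hsplit V E A B v e" and nA: "insert v (e \<inter> A) \<notin> E"
    and sp': "hsplit A (hpart E A v e) C D u (insert v (e \<inter> A))"
    and l: "insert v (e \<inter> A) \<inter> (C - {u}) = {l}" "l \<noteq> v"
  shows "hsplit V E C (D \<union> B) u e" "e \<inter> (C - {u}) = {l}" "l \<in> e \<inter> A - {v}"
proof -
  note S = hsplitD[OF sp] and T = hsplitD[OF sp']
  have lA: "l \<in> e" "l \<in> A" "l \<in> C" "l \<noteq> u" using l T(3) by auto
  show "l \<in> e \<inter> A - {v}" using lA l by auto
  have "v \<notin> C - {u}"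
  proof
    assume "v \<in> C - {u}"
    then have "v \<in> {l}" using l(1) by blast
    then show False using l(2) by simp
  qed
  moreover have "C \<subseteq> A" using T(3) by auto
  then have "C \<inter> B \<subseteq> {v}" using S(4) by auto
  ultimately have CB: "C \<inter> B \<subseteq> {u}" by auto
  show el: "e \<inter> (C - {u}) = {l}" using l lA T(3) by blast
  obtain z where z: "z \<in> e" "z \<in> B" "z \<noteq> v" "z \<notin> A"
    by (rule hsplit_witness[OF hsplit_commute[OF sp]])
  have "u \<in> A" using T by auto
  then have "z \<in> e \<inter> (D \<union> B - {u})" using z by auto
  moreover have "d \<subseteq> C \<or> d \<subseteq> D \<union> B" if d: "d \<in> E" "d \<noteq> e" for d
    using S(6)[OF d] T(6)[of d] d nA unfolding hpart_def inside_def by blast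
  moreover have "C \<union> (D \<union> B) = V" using S(3) T(3) by auto
  moreover have "C \<inter> (D \<union> B) = {u}" using T(4) CB by (simp add: Int_Un_distrib Un_absorb2)
  moreover have "e \<inter> (C - {u}) \<noteq> {}" using el by simp
  ultimately show "hsplit V E C (D \<union> B) u e" using S(5) unfolding hsplit_def by blast
qed

text \<open>In the last alternative \<open>A\<close> is an end block, attached to \<open>h\<close> at a single vertex other than \<open>b\<close>.\<close>

lemma large_edge_split:
  fixes V :: "'a set"
  assumes IH: "\<And>(V' :: 'a set) E'. card V' < n \<Longrightarrow> crit k V' E' \<Longrightarrow> sep_le k V' E' \<Longrightarrow>
      (\<forall>e\<in>E'. card e = 2) \<or> (\<exists>A B v e. hsplit V' E' A B v e)"
    and k: "k \<ge> 3"
  shows "card V < n \<Longrightarrow> crit k V E \<Longrightarrow> sep_le k V E \<Longrightarrow> h \<in> E \<Longrightarrow> 3 \<le> card h \<Longrightarrow>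
    \<exists>A B v e. hsplit V E A B v e \<and> (h \<noteq> e \<or> (\<exists>l. l \<noteq> b \<and> e \<inter> (A - {v}) = {l}))"
proof (induction "card V" arbitrary: V E h b rule: less_induct)
  case less
  \<comment> \<open>The edge \<open>h\<close> has at least three vertices, which rules out the first
    alternative of \<open>IH\<close>.\<close>
  obtain A' B' v e where "hsplit V E A' B' v e"
    using IH[OF less.prems(1-3)] less.prems(4,5) by fastforce
  moreover from this have "b \<notin> A' - {v} \<or> b \<notin> B' - {v}" unfolding hsplit_def by blast
  \<comment> \<open>With this choice of \<open>A\<close>, a vertex of \<open>e\<close> in
    \<open>A - {v}\<close> is automatically different from \<open>b\<close>.\<close>
  ultimately obtain A B where sp: "hsplit V E A B v e" and b: "b \<notin> A - {v}"
    using hsplit_commute by metis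
  note S = hsplitD[OF sp]
  show ?case
  proof (cases "h = e \<and> card (e \<inter> (A - {v})) \<noteq> 1")
    case False
    then have "h \<noteq> e \<or> (\<exists>l. l \<noteq> b \<and> e \<inter> (A - {v}) = {l})"
    proof (cases "h = e")
      case True
      then have "card (e \<inter> (A - {v})) = 1" using False by simp
      then obtain l where l: "e \<inter> (A - {v}) = {l}" by (rule card_1_singletonE)
      have "l \<in> e \<inter> (A - {v})" unfolding l by simp
      then have "l \<noteq> b" using b by auto
      with l show ?thesis by (intro disjI2 exI[of _ l] conjI)
    qed simp
    with sp show ?thesis by (intro exI conjI)
  next
    case True
    let ?a = "insert v (e \<inter> A)"
    have finV: "finite V" using less.prems(2) unfolding crit_def by auto
    obtain z where z: "z \<in> B" "z \<notin> A" using hsplit_witness[OF hsplit_commute[OF sp]] by metis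
    then have "card A < card V" using finV S(3) by (intro psubset_card_mono) auto
    have finA: "finite A" using finV S(3) by auto
    have "e \<inter> (A - {v}) \<noteq> {}" using sp unfolding hsplit_def by auto
    then have "card (e \<inter> (A - {v})) > 0" using finA by (simp add: card_gt_0_iff)
    then have "card (e \<inter> (A - {v})) \<ge> 2" using True by simp
    moreover have "?a = insert v (e \<inter> (A - {v}))" by auto
    moreover have "card (insert v (e \<inter> (A - {v}))) = Suc (card (e \<inter> (A - {v})))"
      using finA by (intro card_insert_disjoint) auto
    ultimately have "3 \<le> card ?a" by simp
    moreover have "?a \<in> hpart E A v e" unfolding hpart_def by auto
    moreover note cA = hsplit_crit[OF less.prems(2) k sp]
    moreover have "sep_le k A (hpart E A v e)" using hsplit_sep_le[OF less.prems(2) k sp less.prems(3)] .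
    \<comment> \<open>The half \<open>?a\<close> of \<open>h\<close> is again a large edge, so the
      factor on \<open>A\<close> is searched next. The vertex to avoid is now \<open>v\<close>, so
      that a leaf found at \<open>?a\<close> is a vertex of \<open>h\<close> in
      \<open>A - {v}\<close>, hence not \<open>b\<close>.\<close>
    ultimately obtain C D u g where sp': "hsplit A (hpart E A v e) C D u g"
      and alt: "?a \<noteq> g \<or> (\<exists>l. l \<noteq> v \<and> g \<inter> (C - {u}) = {l})"
      using less.hyps[OF \<open>card A < card V\<close>, of "hpart E A v e" ?a v] less.prems(1) \<open>card A < card V\<close>
      by auto
    note nA = hsplit_edge_notin[OF less.prems(2) k sp]
    show ?thesis
    proof (cases "?a = g")
      case False
      have eV: "e \<subseteq> V" using crit_edge_subset[OF less.prems(2) S(5)] .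
      have "\<exists>A' B'. hsplit V E A' B' u g \<and> g \<noteq> e"
      proof (cases "?a \<subseteq> C")
        case True
        show ?thesis using hpart_split_outer[OF sp sp' False True eV] by (intro exI conjI)
      next
        case nC: False
        then have "?a \<subseteq> D" using False hsplitD(6)[OF sp', of ?a] unfolding hpart_def by auto
        then show ?thesis
          using hpart_split_outer[OF sp hsplit_commute[OF sp'] False _ eV] by (intro exI conjI)
      qed
      then obtain A' B' where "hsplit V E A' B' u g" "h \<noteq> g" using True by auto
      then show ?thesis by (intro exI conjI disjI1)
    next
      case eq: True
      then obtain l where l: "l \<noteq> v" "?a \<inter> (C - {u}) = {l}" using alt by auto
      note I = hpart_split_inner[OF sp nA sp'[folded eq] l(2,1)]
      have "l \<noteq> b" using I(3) b by auto
      with I(1,2) show ?thesis by (intro exI conjI disjI2)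
    qed
  qed
qed

subsection \<open>Greedy colouring towards a root\<close>

text \<open>Connectivity of \<open>U\<close> under the traces of the edges: an edge may also contain
  vertices outside \<open>U\<close>.\<close>

definition conn_on :: "'a set set \<Rightarrow> 'a set \<Rightarrow> bool" where
  "conn_on E U \<longleftrightarrow> (\<forall>T. T \<noteq> {} \<and> T \<subset> U \<longrightarrow> (\<exists>e\<in>E. e \<inter> T \<noteq> {} \<and> e \<inter> (U - T) \<noteq> {}))"

lemma conn_onE:
  assumes "conn_on E U" "T \<noteq> {}" "T \<subset> U"
  obtains e x y where "e \<in> E" "x \<in> e" "x \<in> T" "y \<in> e" "y \<in> U" "y \<notin> T"
proof -
  obtain e where "e \<in> E" "e \<inter> T \<noteq> {}" "e \<inter> (U - T) \<noteq> {}"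
    using assms unfolding conn_on_def by meson
  then show thesis using that by auto
qed

text \<open>Each edge of \<open>D\<close> forbids at most one colour at \<open>u\<close>, the colour
  of some other vertex of that edge.\<close>

lemma recolour:
  assumes fin: "finite D" and card: "card D < k" and D: "\<And>e. e \<in> D \<Longrightarrow> \<exists>y\<in>e. y \<noteq> u"
  shows "\<exists>c<k. \<forall>e\<in>D. \<not> monochrom (f(u := c)) e \<or> u \<notin> e"
proof -
  obtain y where y: "\<And>e. e \<in> D \<Longrightarrow> y e \<in> e \<and> y e \<noteq> u" using D by metis
  have "card ((\<lambda>e. f (y e)) ` D) < k" using card_image_le[OF fin] card by (rule le_less_trans)
  then have "\<not> {..<k} \<subseteq> (\<lambda>e. f (y e)) ` D"
    using card_mono[of "(\<lambda>e. f (y e)) ` D" "{..<k}"] fin by auto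
  then obtain c where c: "c < k" "c \<notin> (\<lambda>e. f (y e)) ` D" by auto
  have "\<not> monochrom (f(u := c)) e" if "e \<in> D" "u \<in> e" for e
  proof
    assume "monochrom (f(u := c)) e"
    then have "(f(u := c)) u = (f(u := c)) (y e)" using that y[OF that(1)] monochromD by metis
    then have "c = f (y e)" using y[OF that(1)] by simp
    then show False using c that by auto
  qed
  then show ?thesis using c by auto
qed

lemma recolour_proper:
  assumes f: "proper k {e\<in>E. u \<notin> e} f" and fin: "finite E" and E: "\<And>e. e \<in> E \<Longrightarrow> \<exists>y\<in>e. y \<noteq> u"
    and deg: "card {e\<in>E. u \<in> e} < k"
  obtains c where "c < k" "proper k E (f(u := c))"
proof -
  obtain c where c: "c < k" "\<forall>e\<in>{e\<in>E. u \<in> e}. \<not> monochrom (f(u := c)) e \<or> u \<notin> e"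
    using recolour[of "{e\<in>E. u \<in> e}" k u f] fin deg E by auto
  have "\<not> monochrom (f(u := c)) e" if "e \<in> E" for e
  proof (cases "u \<in> e")
    case False
    then have "monochrom (f(u := c)) e = monochrom f e" by (intro monochrom_cong) auto
    then show ?thesis using f that False unfolding proper_def by auto
  qed (use c that in auto)
  then have "proper k E (f(u := c))" using f c unfolding proper_def by auto
  then show thesis using that c by auto
qed

text \<open>\<open>P T\<close> says that any colouring of the edges disjoint from \<open>T\<close>
  can be completed on \<open>T\<close>, up to the edges at \<open>r\<close>. The set
  \<open>T\<close> grows from \<open>{r}\<close>, so the vertices added last are coloured first.
  When \<open>u\<close> receives its colour, an edge \<open>e0\<close> through \<open>u\<close>
  still meets the uncoloured set \<open>T\<close>, so at most \<open>k - 1\<close> edges constrain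
  \<open>u\<close>.\<close>

lemma greedy_colouring:
  assumes finU: "finite U" and finE: "finite E" and conn: "conn_on E U" and r: "r \<in> U"
    and E: "\<And>e u. e \<in> E \<Longrightarrow> \<exists>y\<in>e. y \<noteq> u"
    and deg: "\<And>u. u \<in> U \<Longrightarrow> u \<noteq> r \<Longrightarrow> card {e\<in>E. u \<in> e} \<le> k"
    and f0: "proper k {e\<in>E. e \<inter> U = {}} f0"
  obtains f where "proper k {e\<in>E. r \<notin> e} f" "\<And>x. x \<notin> U \<Longrightarrow> f x = f0 x"
proof -
  define P where "P T \<longleftrightarrow> (\<forall>f0. proper k {e\<in>E. e \<inter> T = {}} f0 \<longrightarrow>
    (\<exists>f. proper k {e\<in>E. r \<notin> e} f \<and> (\<forall>x. x \<notin> T \<longrightarrow> f x = f0 x)))" for T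
  have step: "\<exists>u\<in>U - T. P (insert u T)" if T: "P T" "r \<in> T" "T \<subset> U" for T
  proof -
    obtain e0 x u where e0': "e0 \<in> E" "x \<in> e0" "x \<in> T" "u \<in> e0" "u \<in> U" "u \<notin> T"
      by (rule conn_onE[OF conn, of T]) (use T in auto)
    then have e0: "e0 \<in> E" "e0 \<inter> T \<noteq> {}" "u \<in> e0" "u \<in> U - T" by auto
    have "P (insert u T)" unfolding P_def
    proof (intro allI impI)
      fix f0 assume f0: "proper k {e \<in> E. e \<inter> insert u T = {}} f0"
      let ?D = "{e\<in>E. e \<inter> T = {}}"
      have "{e\<in>?D. u \<in> e} \<subseteq> {e\<in>E. u \<in> e} - {e0}" using e0 by auto
      moreover have "card ({e\<in>E. u \<in> e} - {e0}) < card {e\<in>E. u \<in> e}"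
        using finE e0 by (intro psubset_card_mono) auto
      moreover have "finite ({e\<in>E. u \<in> e} - {e0})" using finE by auto
      ultimately have "card {e\<in>?D. u \<in> e} < card {e\<in>E. u \<in> e}"
        by (meson card_mono le_less_trans)
      then have "card {e\<in>?D. u \<in> e} < k" using deg[of u] e0 T by force
      moreover have "{e\<in>?D. u \<notin> e} = {e \<in> E. e \<inter> insert u T = {}}" by auto
      ultimately obtain c where c: "c < k" "proper k ?D (f0(u := c))"
        using recolour_proper[of k ?D u f0] f0 finE E by auto
      then obtain f where "proper k {e\<in>E. r \<notin> e} f" "\<forall>x. x \<notin> T \<longrightarrow> f x = (f0(u := c)) x"
        using T(1) unfolding P_def by blast
      then show "\<exists>f. proper k {e\<in>E. r \<notin> e} f \<and> (\<forall>x. x \<notin> insert u T \<longrightarrow> f x = f0 x)" by auto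
    qed
    then show ?thesis using e0 by auto
  qed
  let ?S = "{T. T \<subseteq> U \<and> r \<in> T \<and> P T}"
  have "finite ?S" using finU by auto
  moreover have "{r} \<in> ?S" using r unfolding P_def by auto
  ultimately obtain M where M: "M \<in> ?S" "\<And>T. T \<in> ?S \<Longrightarrow> M \<subseteq> T \<Longrightarrow> M = T"
    using finite_has_maximal2[of ?S "{r}"] by auto
  have "M = U"
  proof (rule ccontr)
    assume "M \<noteq> U"
    then obtain u where u: "u \<in> U - M" "P (insert u M)" using step[of M] M(1) by auto
    then have "insert u M \<in> ?S" using M(1) by simp
    then have "M = insert u M" by (rule M(2)) auto
    then show False using u by auto
  qed
  then have "P U" using M(1) by simp
  then obtain f where "proper k {e\<in>E. r \<notin> e} f" "\<forall>x. x \<notin> U \<longrightarrow> f x = f0 x"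
    using f0 unfolding P_def by meson
  then show thesis using that by simp
qed

lemma crit_conn:
  assumes cr: "crit k V E" "k \<ge> 1" shows "conn_on E V"
  unfolding conn_on_def
proof (intro allI impI)
  fix T assume T: "T \<noteq> {} \<and> T \<subset> V"
  then obtain x y where "x \<in> T" "y \<in> V - T" by auto
  then have "k \<le> card (bd E T)" using crit_cut_ge[OF cr(1), of x y T] T by auto
  then have "bd E T \<noteq> {}" using cr(2) by auto
  moreover have "\<Union>E = V" using cr unfolding crit_def by auto
  ultimately show "\<exists>e\<in>E. e \<inter> T \<noteq> {} \<and> e \<inter> (V - T) \<noteq> {}" unfolding bd_def by blast
qed

text \<open>Criticality of the basic hypergraphs comes from here. The vertex \<open>w\<close>, whose
  degree is not bounded, is precoloured; the greedy colouring ends at a vertex \<open>r\<close> of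
  \<open>d\<close>, where the deletion of \<open>d\<close> frees a colour.\<close>

lemma low_edge_removal:
  assumes finV: "finite V" and UE: "\<Union>E \<subseteq> V" and c2: "\<And>e. e \<in> E \<Longrightarrow> 2 \<le> card e" and k: "k \<ge> 1"
    and conn: "conn_on E (V - {w})" and deg: "\<And>u. u \<in> V - {w} \<Longrightarrow> card {e\<in>E. u \<in> e} \<le> k"
    and d: "d \<in> E"
  shows "\<exists>f. proper k (E - {d}) f"
proof -
  have finE: "finite E" using finV UE by (meson finite_UnionD finite_subset)
  have oth: "\<exists>y\<in>e. y \<noteq> u" if "e \<in> E" for e u
    using c2[OF that] card_mono[of "{u}" e] by fastforce
  obtain r where r: "r \<in> d" "r \<noteq> w" using oth[OF d] by metis
  have emp: "{e \<in> E. e \<inter> (V - {w}) = {}} = {}" using oth[of _ w] UE by blast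
  then have f0: "proper k {e \<in> E. e \<inter> (V - {w}) = {}} (\<lambda>_. 0)"
    using k unfolding emp proper_def by simp
  have rV: "r \<in> V - {w}" using r UE d by auto
  obtain f where f: "proper k {e\<in>E. r \<notin> e} f"
    by (rule greedy_colouring[OF _ finE conn rV _ _ f0]) (use finV oth deg in auto)
  have "{e \<in> E - {d}. r \<in> e} \<subset> {e\<in>E. r \<in> e}" using d r by auto
  then have "card {e \<in> E - {d}. r \<in> e} < card {e\<in>E. r \<in> e}" using finE by (intro psubset_card_mono) auto
  then have "card {e \<in> E - {d}. r \<in> e} < k" using deg[OF rV] by linarith
  moreover have "proper k {e \<in> E - {d}. r \<notin> e} f" using f by (rule proper_mono) auto
  moreover have "finite (E - {d})" "\<And>e. e \<in> E - {d} \<Longrightarrow> \<exists>y\<in>e. y \<noteq> r" using finE oth by auto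
  ultimately obtain c where "proper k (E - {d}) (f(r := c))"
    using recolour_proper[of k "E - {d}" r f] by metis
  then show ?thesis by blast
qed

subsection \<open>Separating pairs\<close>

text \<open>Colourings of the two sides with the same pattern on \<open>w\<close>, \<open>c\<close>
  can be aligned and glued. So one side always gives \<open>w\<close> and \<open>c\<close> equal
  colours and the other always different ones.\<close>

lemma same_type_contradiction:
  assumes cr: "crit k V E" and cov: "\<And>e. e \<in> E \<Longrightarrow> e \<subseteq> A \<or> e \<subseteq> B" and AB: "A \<inter> B = {w, c}"
    and f: "proper k (inside E A) f" and g: "proper k (inside E B) g"
    and same: "f w = f c \<longleftrightarrow> g w = g c"
  shows False
proof -
  have lt: "f u < k" for u using f unfolding proper_def by auto
  obtain g' where g': "proper k (inside E B) g'" "g' w = f w" "g' c = f c"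
    by (rule proper_align2[OF g lt[of w] lt[of c], of w c]) (use same in auto)
  have "proper k E (\<lambda>x. if x \<in> A then f x else g' x)"
    by (rule proper_glue[OF f g'(1)]) (use AB g' cov in auto)
  then show False using crit_not_proper[OF cr] by metis
qed

text \<open>The side of \<open>T\<close> forces equal colours on \<open>w\<close> and
  \<open>c\<close>, the side of \<open>T'\<close> different ones. Counting the edges at
  \<open>c\<close> leaves exactly one on the side of \<open>T'\<close>, and this edge together with
  the vertex \<open>w\<close> gives the splitting.\<close>

lemma separating_pair_split_aux:
  assumes cr: "crit k V E" and k: "k \<ge> 2" and wc: "w \<in> V" "c \<in> V" "c \<noteq> w"
    and T: "T \<union> T' = V - {w, c}" "T \<inter> T' = {}" "T \<noteq> {}" "T' \<noteq> {}"
    and no: "\<And>e. e \<in> E \<Longrightarrow> e \<inter> T = {} \<or> e \<inter> T' = {}"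
    and deg: "card {e\<in>E. c \<in> e} \<le> k"
    and f0: "proper k (inside E (insert w (insert c T))) f0" "f0 w = f0 c"
  shows "\<exists>A B v e. hsplit V E A B v e"
proof -
  let ?A = "insert w (insert c T)" and ?B = "insert w (insert c T')"
  have UE: "\<Union>E = V" using cr unfolding crit_def by auto
  have finE: "finite E" using crit_finite_edges[OF cr] .
  have wT: "w \<notin> T" "c \<notin> T" "w \<notin> T'" "c \<notin> T'" using T(1) by auto
  have AB: "?A \<inter> ?B = {w, c}" using wT T(2) by auto
  have cov: "e \<subseteq> ?A \<or> e \<subseteq> ?B" if "e \<in> E" for e
  proof -
    have "e \<subseteq> T \<union> T' \<union> {w, c}" using that UE T(1) by auto
    then show ?thesis using no[OF that] by blast
  qed
  have oth: "\<exists>y\<in>e. y \<noteq> u" if "e \<in> E" for e u using crit_edge_other[OF cr that] by metis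
  have neB: "g w \<noteq> g c" if "proper k (inside E ?B) g" for g
    using same_type_contradiction[OF cr cov AB f0(1) that] f0(2) by auto
  obtain t where t: "t \<in> T" using T(3) by auto
  then have "t \<in> V" "t \<notin> ?B" using T by auto
  then obtain g0 where g0: "proper k (inside E ?B) g0" by (rule crit_inside_colourable[OF cr])
  have eqA: "f w = f c" if "proper k (inside E ?A) f" for f
    using same_type_contradiction[OF cr cov AB that g0] neB[OF g0] by auto
  have "{w, c} \<notin> E"
  proof
    assume "{w, c} \<in> E"
    then have "\<not> monochrom f0 {w, c}" using f0(1) unfolding proper_def inside_def by auto
    then show False using f0(2) unfolding monochrom_def by auto
  qed
  let ?DA = "{e \<in> inside E ?A. c \<in> e}" and ?DB = "{e \<in> inside E ?B. c \<in> e}"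
  have fin: "finite ?DA" "finite ?DB" using finE unfolding inside_def by auto
  \<comment> \<open>Otherwise \<open>c\<close> could be recoloured even with \<open>{w, c}\<close>
    as an additional edge, giving \<open>w\<close> and \<open>c\<close> different colours on this
    side.\<close>
  have "k \<le> Suc (card ?DA)"
  proof (rule ccontr)
    assume "\<not> k \<le> Suc (card ?DA)"
    moreover have "{e \<in> insert {w, c} (inside E ?A). c \<in> e} = insert {w, c} ?DA" by auto
    moreover have "card (insert {w, c} ?DA) \<le> Suc (card ?DA)" using fin by (simp add: card_insert_if)
    ultimately have "card {e \<in> insert {w, c} (inside E ?A). c \<in> e} < k" by simp
    moreover have "{e \<in> insert {w, c} (inside E ?A). c \<notin> e} \<subseteq> inside E ?A" by auto
    then have "proper k {e \<in> insert {w, c} (inside E ?A). c \<notin> e} f0" by (rule proper_mono[OF f0(1)])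
    moreover have "finite (insert {w, c} (inside E ?A))" using finE unfolding inside_def by auto
    moreover have "\<exists>y\<in>e. y \<noteq> c" if "e \<in> insert {w, c} (inside E ?A)" for e
      using that oth[of e c] wc(3) unfolding inside_def by auto
    ultimately obtain d where d: "proper k (insert {w, c} (inside E ?A)) (f0(c := d))"
      using recolour_proper[of k "insert {w, c} (inside E ?A)" c f0] by metis
    then have "proper k (inside E ?A) (f0(c := d))" by (rule proper_mono) auto
    then have "(f0(c := d)) w = (f0(c := d)) c" by (rule eqA)
    then have "monochrom (f0(c := d)) {w, c}" unfolding monochrom_def by auto
    then show False using d unfolding proper_def by auto
  qed
  \<comment> \<open>Otherwise \<open>c\<close> could simply take the colour of \<open>w\<close> on
    the other side.\<close>
  moreover have "?DB \<noteq> {}"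
  proof
    assume DB: "?DB = {}"
    have "proper k (inside E ?B) (g0(c := g0 w))"
      unfolding proper_def
    proof (intro conjI ballI allI)
      fix u show "(g0(c := g0 w)) u < k" using g0 unfolding proper_def by auto
    next
      fix e assume e: "e \<in> inside E ?B"
      then have "c \<notin> e" using DB by auto
      then have "monochrom (g0(c := g0 w)) e = monochrom g0 e" by (intro monochrom_cong) auto
      then show "\<not> monochrom (g0(c := g0 w)) e" using e g0 unfolding proper_def by auto
    qed
    then show False using neB[of "g0(c := g0 w)"] wc(3) by auto
  qed
  moreover have "card ?DA + card ?DB \<le> k"
  proof -
    have "?DA \<inter> ?DB = {}"
    proof (rule ccontr)
      assume "?DA \<inter> ?DB \<noteq> {}"
      then obtain e where e: "e \<in> E" "e \<subseteq> {w, c}" "c \<in> e" using AB unfolding inside_def by blast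
      then have "w \<in> e" using oth[OF e(1), of c] by auto
      then have "e = {w, c}" using e by auto
      then show False using e(1) \<open>{w, c} \<notin> E\<close> by simp
    qed
    then have "card ?DA + card ?DB = card (?DA \<union> ?DB)" using fin by (simp add: card_Un_disjoint)
    also have "\<dots> \<le> card {e\<in>E. c \<in> e}" using finE by (intro card_mono) (auto simp: inside_def)
    finally show ?thesis using deg by linarith
  qed
  moreover have "card ?DB > 0" using \<open>?DB \<noteq> {}\<close> fin by (simp add: card_gt_0_iff)
  ultimately have "card ?DB = 1" by linarith
  then obtain g where g: "?DB = {g}" by (rule card_1_singletonE)
  then have gm: "g \<in> E" "g \<subseteq> ?B" "c \<in> g" unfolding inside_def by blast+
  have "hsplit V E ?A (insert w T') w g"
    unfolding hsplit_def
  proof (intro conjI ballI impI)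
    show "?A \<union> insert w T' = V" using T(1) wc by auto
    show "?A \<inter> insert w T' = {w}" using wT T(2) by auto
    show "g \<in> E" using gm by simp
    show "g \<inter> (?A - {w}) \<noteq> {}" using gm wc by auto
    show "g \<inter> (insert w T' - {w}) \<noteq> {}"
    proof
      assume "g \<inter> (insert w T' - {w}) = {}"
      then have "g \<subseteq> {w, c}" using gm(2) by auto
      moreover have "w \<in> g" using calculation oth[OF gm(1), of c] by auto
      ultimately have "g = {w, c}" using gm by auto
      then show False using gm(1) \<open>{w, c} \<notin> E\<close> by simp
    qed
    fix e assume e: "e \<in> E" "e \<noteq> g"
    show "e \<subseteq> ?A \<or> e \<subseteq> insert w T'"
    proof (cases "e \<subseteq> ?A")
      case False
      then have "e \<subseteq> ?B" using cov[OF e(1)] by auto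
      moreover from this have "c \<notin> e" using g e unfolding inside_def by blast
      ultimately show ?thesis by auto
    qed simp
  qed
  then show ?thesis by blast
qed

lemma separating_pair_split:
  assumes cr: "crit k V E" and k: "k \<ge> 2" and wc: "w \<in> V" "c \<in> V" "c \<noteq> w"
    and T: "T \<union> T' = V - {w, c}" "T \<inter> T' = {}" "T \<noteq> {}" "T' \<noteq> {}"
    and no: "\<And>e. e \<in> E \<Longrightarrow> e \<inter> T = {} \<or> e \<inter> T' = {}"
    and deg: "card {e\<in>E. c \<in> e} \<le> k"
  shows "\<exists>A B v e. hsplit V E A B v e"
proof -
  let ?A = "insert w (insert c T)" and ?B = "insert w (insert c T')"
  have UE: "\<Union>E = V" using cr unfolding crit_def by auto
  have wT: "w \<notin> T" "c \<notin> T" "w \<notin> T'" "c \<notin> T'" using T(1) by auto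
  have AB: "?A \<inter> ?B = {w, c}" using wT T(2) by auto
  have cov: "e \<subseteq> ?A \<or> e \<subseteq> ?B" if "e \<in> E" for e
  proof -
    have "e \<subseteq> T \<union> T' \<union> {w, c}" using that UE T(1) by auto
    then show ?thesis using no[OF that] by blast
  qed
  obtain t t' where t: "t \<in> T" "t' \<in> T'" using T by auto
  then have tt: "t \<in> V" "t \<notin> ?B" "t' \<in> V" "t' \<notin> ?A" using T by auto
  obtain f where f: "proper k (inside E ?A) f" by (rule crit_inside_colourable[OF cr tt(3,4)])
  obtain g where g: "proper k (inside E ?B) g" by (rule crit_inside_colourable[OF cr tt(1,2)])
  show ?thesis
  proof (cases "f w = f c")
    case True
    then show ?thesis using separating_pair_split_aux[OF cr k wc T no deg f] by blast
  next
    case False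
    then have gg: "g w = g c" using same_type_contradiction[OF cr cov AB f g] by auto
    have "T' \<union> T = V - {w, c}" "T' \<inter> T = {}" using T by auto
    moreover have "e \<inter> T' = {} \<or> e \<inter> T = {}" if "e \<in> E" for e using no[OF that] by auto
    ultimately show ?thesis
      using separating_pair_split_aux[OF cr k wc _ _ T(4,3) _ deg g gg] by blast
  qed
qed

subsection \<open>At most one vertex of large degree\<close>

locale low_unsplittable =
  fixes k :: nat and V :: "'a set" and E :: "'a set set" and w :: 'a
  assumes cr: "crit k V E" and k3: "k \<ge> 3" and wV: "w \<in> V"
    and low: "\<And>u. u \<in> V - {w} \<Longrightarrow> card {e\<in>E. u \<in> e} \<le> k"
    and unsplittable: "\<And>A B v e. \<not> hsplit V E A B v e"
begin

lemma UE: "\<Union>E = V" using cr unfolding crit_def by auto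
lemma finV: "finite V" using cr unfolding crit_def by auto
lemma finE: "finite E" using crit_finite_edges[OF cr] .
lemma oth: "e \<in> E \<Longrightarrow> \<exists>y\<in>e. y \<noteq> u" using crit_edge_other[OF cr] by metis

lemma conn_minus:
  assumes c: "c \<in> V" "c \<noteq> w" shows "conn_on E (V - {w, c})"
  unfolding conn_on_def
proof (intro allI impI, rule ccontr)
  fix T assume T: "T \<noteq> {} \<and> T \<subset> V - {w, c}"
    and no: "\<not> (\<exists>e\<in>E. e \<inter> T \<noteq> {} \<and> e \<inter> (V - {w, c} - T) \<noteq> {})"
  have "T \<union> (V - {w, c} - T) = V - {w, c}" "T \<inter> (V - {w, c} - T) = {}" "T \<noteq> {}" "V - {w, c} - T \<noteq> {}"
    using T by auto
  moreover have "card {e\<in>E. c \<in> e} \<le> k" using low c by auto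
  moreover have "e \<inter> T = {} \<or> e \<inter> (V - {w, c} - T) = {}" if "e \<in> E" for e using no that by auto
  ultimately show False
    using separating_pair_split[OF cr _ wV c, of T "V - {w, c} - T"] unsplittable k3 by auto
qed

lemma conn_w: "conn_on E (V - {w})"
  unfolding conn_on_def
proof (intro allI impI)
  fix T assume T: "T \<noteq> {} \<and> T \<subset> V - {w}"
  define T' where "T' = V - {w} - T"
  have T': "T' \<noteq> {}" "T \<inter> T' = {}" "T \<union> T' = V - {w}" using T unfolding T'_def by auto
  have "3 \<le> card (V - {w})" using crit_card_V[OF cr] k3 wV by simp
  moreover have "card {a, b} \<le> 2" for a b :: 'a by (simp add: card_insert_if)
  ultimately have "V - {w} \<noteq> {a, b}" for a b by (metis Suc_n_not_le_n numeral_2_eq_2 numeral_3_eq_3 order_trans)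
  then have "\<not> (\<exists>a b. T = {a} \<and> T' = {b})" using T'(3) by (metis insert_is_Un)
  \<comment> \<open>With at least three vertices besides \<open>w\<close>, some vertex can be
    deleted without emptying \<open>T\<close> or its complement.\<close>
  then obtain c where c: "c \<in> V - {w}" "T - {c} \<noteq> {}" "T' - {c} \<noteq> {}"
  proof -
    assume a: "\<not> (\<exists>a b. T = {a} \<and> T' = {b})" and th: "\<And>c. c \<in> V - {w} \<Longrightarrow> T - {c} \<noteq> {} \<Longrightarrow> T' - {c} \<noteq> {} \<Longrightarrow> thesis"
    obtain a b where ab: "a \<in> T" "b \<in> T'" using T T' by auto
    show thesis
    proof (cases "T = {a}")
      case True
      then have "T' - {b} \<noteq> {}" using a ab by auto
      then show thesis using th[of b] True ab T' by auto
    next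
      case False
      then show thesis using th[of a] ab T' by auto
    qed
  qed
  have "T - {c} \<subset> V - {w, c}" "V - {w, c} - (T - {c}) \<subseteq> T'" using T c unfolding T'_def by auto
  then obtain e where "e \<in> E" "e \<inter> (T - {c}) \<noteq> {}" "e \<inter> (V - {w, c} - (T - {c})) \<noteq> {}"
    using conn_minus[of c] c unfolding conn_on_def by (metis DiffD1 DiffD2 singletonI)
  then show "\<exists>e\<in>E. e \<inter> T \<noteq> {} \<and> e \<inter> (V - {w} - T) \<noteq> {}"
    using \<open>V - {w, c} - (T - {c}) \<subseteq> T'\<close> unfolding T'_def by blast
qed

text \<open>Give \<open>w\<close> and \<open>b\<close> the same colour and colour greedily towards \<open>r\<close>: the two edges \<open>e\<close>, \<open>f\<close>
  forbid only one colour at \<open>r\<close>.\<close>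

lemma common_neighbour:
  assumes b: "b \<in> V" "b \<noteq> w" "{w, b} \<notin> E" and r: "r \<noteq> w" "r \<noteq> b"
    and e: "e \<in> E" "w \<in> e" "r \<in> e" and f: "f \<in> E" "b \<in> f" "r \<in> f"
  shows "e = f"
proof (rule ccontr)
  assume ne: "e \<noteq> f"
  let ?U = "V - {w, b}"
  \<comment> \<open>An edge inside \<open>{w, b}\<close> would be \<open>{w, b}\<close> itself, so
    \<open>w\<close> and \<open>b\<close> may both be given the colour 0.\<close>
  have emp: "{d \<in> E. d \<inter> ?U = {}} = {}"
  proof (rule ccontr)
    assume "{d \<in> E. d \<inter> ?U = {}} \<noteq> {}"
    then obtain d where d: "d \<in> E" "d \<subseteq> {w, b}" using UE by blast
    then have "w \<in> d" "b \<in> d" using oth[OF d(1), of w] oth[OF d(1), of b] by auto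
    then have "d = {w, b}" using d by auto
    then show False using d b by simp
  qed
  then have f0: "proper k {d \<in> E. d \<inter> ?U = {}} (\<lambda>_. 0)"
    using k3 unfolding emp proper_def by simp
  have rU: "r \<in> ?U" using r e UE by auto
  obtain g where g: "proper k {d\<in>E. r \<notin> d} g" "\<And>x. x \<notin> ?U \<Longrightarrow> g x = 0"
    by (rule greedy_colouring[OF _ finE conn_minus[OF b(1,2)] rU _ _ f0]) (use finV oth low in auto)
  \<comment> \<open>The pair \<open>{w, r}\<close> stands in for \<open>e\<close> and
    \<open>f\<close>: keeping \<open>r\<close> off the colour 0 of \<open>w\<close> and
    \<open>b\<close> settles both, so fewer than \<open>k\<close> constraints remain at
    \<open>r\<close>.\<close>
  let ?D = "insert {w, r} ({d\<in>E. r \<in> d} - {e, f})"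
  have "{e, f} \<subseteq> {d\<in>E. r \<in> d}" using e f by auto
  then have "card ({d\<in>E. r \<in> d} - {e, f}) = card {d\<in>E. r \<in> d} - card {e, f}"
    "card {e, f} \<le> card {d\<in>E. r \<in> d}"
    using finE by (simp_all add: card_Diff_subset card_mono)
  moreover have "card {e, f} = 2" using ne by simp
  moreover have "card {d\<in>E. r \<in> d} \<le> k" using low rU by auto
  moreover have "card ?D \<le> Suc (card ({d\<in>E. r \<in> d} - {e, f}))"
    using finE by (simp add: card_insert_if)
  ultimately have "card ?D < k" by linarith
  moreover have "finite ?D" using finE by simp
  moreover have "\<exists>y\<in>d. y \<noteq> r" if "d \<in> ?D" for d using that oth[of d r] r by auto
  ultimately obtain c where c: "c < k" "\<forall>d\<in>?D. \<not> monochrom (g(r := c)) d \<or> r \<notin> d"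
    using recolour[of ?D k r g] by blast
  have "\<not> monochrom (g(r := c)) {w, r}" using c by auto
  then have "c \<noteq> 0" using g(2)[of w] r unfolding monochrom_def by auto
  have "\<not> monochrom (g(r := c)) d" if d: "d \<in> E" for d
  proof (cases "r \<in> d")
    case False
    then have "monochrom (g(r := c)) d = monochrom g d" by (intro monochrom_cong) auto
    then show ?thesis using g(1) d False unfolding proper_def by auto
  next
    case True
    show ?thesis
    proof
      assume m: "monochrom (g(r := c)) d"
      then have "d = e \<or> d = f" using c True d by blast
      then have "(g(r := c)) r = (g(r := c)) w \<or> (g(r := c)) r = (g(r := c)) b"
        using monochromD[OF m] e f by metis
      then show False using g(2)[of w] g(2)[of b] r \<open>c \<noteq> 0\<close> by auto
    qed
  qed
  then have "proper k E (g(r := c))" using g(1) c(1) unfolding proper_def by auto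
  then show False using crit_not_proper[OF cr] by metis
qed

text \<open>\<open>?N\<close> is the set of ordinary neighbours of \<open>w\<close>. By
  connectivity, if \<open>?N\<close> is neither empty nor everything, some edge \<open>f\<close>
  joins a vertex \<open>r\<close> of \<open>?N\<close> to a non-neighbour; then
  \<open>common_neighbour\<close> identifies \<open>f\<close> with \<open>{w, r}\<close>. If
  \<open>?N\<close> is empty, it identifies an edge through \<open>w\<close> and \<open>r\<close>
  with a second edge at \<open>r\<close>.\<close>

lemma joined:
  assumes "u \<in> V - {w}" shows "{w, u} \<in> E"
proof -
  let ?N = "{u \<in> V - {w}. {w, u} \<in> E}"
  have "?N \<noteq> {}"
  proof
    assume N: "?N = {}"
    obtain e where e: "e \<in> E" "w \<in> e" using wV UE by auto
    obtain r where r: "r \<in> e" "r \<noteq> w" using oth[OF e(1), of w] by auto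
    then have rV: "r \<in> V" using e UE by auto
    have "\<not> {d\<in>E. r \<in> d} \<subseteq> {e}"
      using crit_degree_ge[OF cr _ rV] k3 card_mono[of "{e}" "{d\<in>E. r \<in> d}"] by auto
    then obtain f where f: "f \<in> E" "r \<in> f" "f \<noteq> e" by auto
    obtain b where b: "b \<in> f" "b \<noteq> r" using oth[OF f(1), of r] by auto
    show False
    proof (cases "b = w")
      case False
      then have "{w, b} \<notin> E" using N b f UE by auto
      then have "e = f" using common_neighbour[of b r e f] False b r e f UE by auto
      then show False using f by simp
    next
      case True
      have "f \<noteq> {w, r}" using N rV r f(1) by auto
      then obtain b' where b': "b' \<in> f" "b' \<noteq> w" "b' \<noteq> r" using True b f by auto
      then have "{w, b'} \<notin> E" using N f UE by auto
      then have "e = f" using common_neighbour[of b' r e f] b' r e f UE by auto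
      then show False using f by simp
    qed
  qed
  moreover have "\<not> ?N \<subset> V - {w}"
  proof
    assume "?N \<subset> V - {w}"
    then obtain f r b where f: "f \<in> E" and rb': "r \<in> f" "r \<in> ?N" "b \<in> f" "b \<in> V - {w}" "b \<notin> ?N"
      by (rule conn_onE[OF conn_w \<open>?N \<noteq> {}\<close>])
    then have rb: "r \<in> f" "r \<in> ?N" "b \<in> f" "b \<in> V" "b \<noteq> w" "{w, b} \<notin> E" by auto
    then have "{w, r} = f" using common_neighbour[of b r "{w, r}" f] f by auto
    then have "b = w \<or> b = r" using rb by auto
    then show False using rb by auto
  qed
  ultimately show ?thesis using assms by blast
qed

lemma edges_at_w:
  assumes "e \<in> E" "w \<in> e" obtains u where "u \<in> V - {w}" "e = {w, u}"
proof -
  obtain u where u: "u \<in> e" "u \<noteq> w" using oth[OF assms(1)] by metis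
  then have "u \<in> V - {w}" using assms UE by auto
  moreover from this have "{w, u} = e" using crit_antichain[OF cr assms(1) joined] u assms by auto
  ultimately show thesis using that by auto
qed

definition rest :: "'a set set" where "rest = {e\<in>E. w \<notin> e}"

lemma rest_degree:
  assumes "u \<in> V - {w}" shows "Suc (card {e\<in>rest. u \<in> e}) = card {e\<in>E. u \<in> e}"
proof -
  have "{e\<in>E. u \<in> e} = insert {w, u} {e\<in>rest. u \<in> e}"
    using assms joined unfolding rest_def by (auto elim: edges_at_w)
  moreover have "{w, u} \<notin> {e\<in>rest. u \<in> e}" unfolding rest_def by auto
  ultimately show ?thesis using finE unfolding rest_def by simp
qed

text \<open>Since \<open>w\<close> is joined to all other vertices, its colour occurs nowhere else
  and can be taken to be the last one, \<open>k - 1\<close>.\<close>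

lemma rest_crit: "crit (k - 1) (V - {w}) rest"
  unfolding crit_def
proof (intro conjI ballI allI)
  show "finite (V - {w})" using finV by simp
  show "\<Union>rest = V - {w}"
  proof
    show "\<Union>rest \<subseteq> V - {w}" using UE unfolding rest_def by auto
    show "V - {w} \<subseteq> \<Union>rest"
    proof
      fix u assume u: "u \<in> V - {w}"
      then have "card {e\<in>rest. u \<in> e} \<noteq> 0" using rest_degree[OF u] crit_degree_ge[OF cr, of u] k3 by auto
      then have "{e\<in>rest. u \<in> e} \<noteq> {}" by (metis card.empty)
      then show "u \<in> \<Union>rest" by blast
    qed
  qed
  show "2 \<le> card e" if "e \<in> rest" for e using that cr unfolding crit_def rest_def by auto
  show "\<not> proper (k - 1) rest f" for f
  proof
    assume f: "proper (k - 1) rest f"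
    have fk: "f u < k - 1" for u using f unfolding proper_def by auto
    have "\<not> monochrom (f(w := k - 1)) e" if e: "e \<in> E" for e
    proof (cases "w \<in> e")
      case True
      then obtain u where "u \<in> V - {w}" "e = {w, u}" using edges_at_w[OF e] by metis
      then show ?thesis using fk[of u] unfolding not_monochrom_iff by auto
    next
      case False
      then have "monochrom (f(w := k - 1)) e = monochrom f e" by (intro monochrom_cong) auto
      then show ?thesis using f e False unfolding proper_def rest_def by auto
    qed
    moreover have "(f(w := k - 1)) u < k" for u using fk[of u] k3 by auto
    ultimately have "proper k E (f(w := k - 1))" unfolding proper_def by auto
    then show False using crit_not_proper[OF cr] by metis
  qed
  fix d assume d: "d \<in> rest"
  then obtain f where f: "proper k (E - {d}) f" using cr unfolding crit_def rest_def by auto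
  have "k - 1 < k" using k3 by simp
  then obtain g where g: "proper k (E - {d}) g" "g w = k - 1" using proper_align[OF f] by metis
  have gu: "g u < k - 1" if "u \<in> V - {w}" for u
  proof -
    have "{w, u} \<noteq> d" using d unfolding rest_def by auto
    then have "\<not> monochrom g {w, u}" using g(1) joined[OF that] unfolding proper_def by auto
    then have "g u \<noteq> k - 1" using g(2) unfolding monochrom_def by auto
    moreover have "g u < k" using g(1) unfolding proper_def by auto
    ultimately show ?thesis by auto
  qed
  have "proper (k - 1) (rest - {d}) (\<lambda>u. if u \<in> V - {w} then g u else 0)"
    unfolding proper_def
  proof (intro conjI allI ballI)
    fix u show "(if u \<in> V - {w} then g u else 0) < k - 1" using gu k3 by auto
  next
    fix e assume e: "e \<in> rest - {d}"
    then have "e \<subseteq> V - {w}" using UE unfolding rest_def by auto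
    then have "monochrom (\<lambda>u. if u \<in> V - {w} then g u else 0) e = monochrom g e"
      by (intro monochrom_cong) auto
    then show "\<not> monochrom (\<lambda>u. if u \<in> V - {w} then g u else 0) e"
      using g(1) e unfolding proper_def rest_def by auto
  qed
  then show "\<exists>f. proper (k - 1) (rest - {d}) f" by auto
qed

lemma rest_low: "u \<in> V - {w} \<Longrightarrow> card {e\<in>rest. u \<in> e} \<le> k - 1"
  using rest_degree[of u] low[of u] by linarith

lemma rest_conn_minus:
  assumes c: "c \<in> V - {w}" shows "conn_on rest (V - {w} - {c})"
  unfolding conn_on_def
proof (intro allI impI)
  fix T assume T: "T \<noteq> {} \<and> T \<subset> V - {w} - {c}"
  have eq: "V - {w} - {c} = V - {w, c}" by auto
  have "T \<noteq> {} \<and> T \<subset> V - {w, c}" using T unfolding eq .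
  then obtain e where e: "e \<in> E" "e \<inter> T \<noteq> {}" "e \<inter> (V - {w, c} - T) \<noteq> {}"
    using conn_minus[of c] c unfolding conn_on_def by (metis DiffD1 DiffD2 singletonI)
  have "w \<notin> e"
  proof
    assume "w \<in> e"
    then obtain u where "e = {w, u}" using edges_at_w[OF e(1)] by metis
    then show False using e T by auto
  qed
  then show "\<exists>e\<in>rest. e \<inter> T \<noteq> {} \<and> e \<inter> (V - {w} - {c} - T) \<noteq> {}"
    using e unfolding rest_def eq by auto
qed

end

text \<open>The split vertex has degree at least \<open>k\<close> in both factors, hence at least
  \<open>k - 1\<close> old edges on each side, and \<open>2 * (k - 1) > k\<close>. This shows that
  \<open>rest\<close> is again unsplittable.\<close>

lemma low_not_hsplit:
  assumes cr: "crit k V E" and k: "k \<ge> 3" and low: "\<And>u. u \<in> V \<Longrightarrow> card {e\<in>E. u \<in> e} \<le> k"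
  shows "\<not> hsplit V E A B v e"
proof
  assume sp: "hsplit V E A B v e"
  note D = hsplitD[OF sp]
  have fE: "finite E" by (rule crit_finite_edges[OF cr])
  have deg: "k \<le> Suc (card {g\<in>inside E A. v \<in> g})" if "hsplit V E A B v e" for A B
  proof -
    have "k \<le> card {g\<in>hpart E A v e. v \<in> g}"
      using crit_degree_ge[OF hsplit_crit[OF cr k that]] hsplitD(1)[OF that] k by auto
    also have "\<dots> \<le> card (insert (insert v (e \<inter> A)) {g\<in>inside E A. v \<in> g})"
      using fE by (intro card_mono) (auto simp: hpart_def inside_def)
    also have "\<dots> \<le> Suc (card {g\<in>inside E A. v \<in> g})"
      using fE by (simp add: card_insert_if inside_def)
    finally show ?thesis .
  qed
  have "g \<notin> inside E B" if g: "g \<in> inside E A" for g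
  proof
    assume "g \<in> inside E B"
    then have "g \<in> E" "g \<subseteq> {v}" using g D(4) unfolding inside_def by auto
    then show False using crit_edge_other[OF cr, of g v] by auto
  qed
  then have "card ({g\<in>inside E A. v \<in> g} \<union> {g\<in>inside E B. v \<in> g})
      = card {g\<in>inside E A. v \<in> g} + card {g\<in>inside E B. v \<in> g}"
    using fE by (intro card_Un_disjoint) (auto simp: inside_def)
  moreover have "card ({g\<in>inside E A. v \<in> g} \<union> {g\<in>inside E B. v \<in> g}) \<le> card {g\<in>E. v \<in> g}"
    using fE by (intro card_mono) (auto simp: inside_def)
  moreover have "card {g\<in>E. v \<in> g} \<le> k" using low D by auto
  ultimately show False using deg[OF sp] deg[OF hsplit_commute[OF sp]] k by linarith
qed

text \<open>For \<open>k \<ge> 4\<close> the hypergraph \<open>rest\<close> satisfies the locale for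
  \<open>k - 1\<close>, with any of its vertices in the role of \<open>w\<close>. So all pairs are
  edges, and the degree bound limits the number of vertices.\<close>

lemma (in low_unsplittable) complete:
  assumes k4: "k \<ge> 4"
  shows "complete_hg (k + 1) (V, E)"
proof -
  have unsp: "\<not> hsplit (V - {w}) rest A B v e" for A B v e
    by (rule low_not_hsplit[OF rest_crit _ rest_low]) (use k4 in auto)
  have H: "low_unsplittable (k - 1) (V - {w}) rest x" if "x \<in> V - {w}" for x
    by unfold_locales (use rest_crit k4 that rest_low unsp in auto)
  have pair: "{x, y} \<in> E" if xy: "x \<in> V" "y \<in> V" "x \<noteq> y" for x y
  proof -
    consider "x = w" | "y = w" | "x \<in> V - {w}" "y \<in> V - {w} - {x}" using xy by auto
    then show ?thesis
    proof cases
      case 1 then show ?thesis using joined that by auto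
    next
      case 2 then show ?thesis using joined[of x] that by (auto simp: insert_commute)
    next
      case 3 then show ?thesis using low_unsplittable.joined[OF H] unfolding rest_def by auto
    qed
  qed
  have "card e = 2" if e: "e \<in> E" for e
  proof (cases "w \<in> e")
    case True
    then show ?thesis using edges_at_w[OF e] by (metis DiffD2 card_2_iff insertI1)
  next
    case False
    then have er: "e \<in> rest" using e unfolding rest_def by auto
    obtain x where x: "x \<in> e" using oth[OF e] by auto
    then have "x \<in> V - {w}" using False e UE by auto
    then obtain u where "u \<noteq> x" "e = {x, u}" using low_unsplittable.edges_at_w[OF H er x] by auto
    then show ?thesis by auto
  qed
  then have Eeq: "E = {e. e \<subseteq> V \<and> card e = 2}" using UE pair by (auto simp: card_2_iff)
  have "V - {w} \<noteq> {}" using crit_card_V[OF cr] k3 card_mono[of "{w}" V] by auto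
  then obtain x where x: "x \<in> V - {w}" by auto
  have "inj_on (\<lambda>y. {x, y}) (V - {x})" by (auto simp: inj_on_def doubleton_eq_iff)
  then have "card V - 1 = card ((\<lambda>y. {x, y}) ` (V - {x}))"
    using x finV by (simp add: card_image)
  also have "\<dots> \<le> card {e\<in>E. x \<in> e}" using x finE pair by (intro card_mono) auto
  also have "\<dots> \<le> k" using low[OF x] .
  finally have "card V = k + 1" using crit_card_V[OF cr] k3 by linarith
  then show ?thesis using Eeq finV unfolding complete_hg_def by auto
qed

subsection \<open>Odd cycles\<close>

lemma two_regular_edges:
  assumes "finite E" "card {e\<in>E. u \<in> e} \<le> 2" "a \<in> E" "b \<in> E" "u \<in> a" "u \<in> b" "a \<noteq> b" "e \<in> E" "u \<in> e"
  shows "e = a \<or> e = b"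
proof -
  have "{a, b} = {e\<in>E. u \<in> e}" using assms by (intro card_seteq) auto
  then show ?thesis using assms(8,9) by blast
qed

text \<open>A longest path closes up to a cycle, which by the degree bound and connectivity is
  everything. An even cycle would be 2-colourable.\<close>

lemma two_critical_cycle:
  assumes cr: "crit 2 V E" and c2: "\<And>e. e \<in> E \<Longrightarrow> card e = 2"
    and low: "\<And>u. u \<in> V \<Longrightarrow> card {e\<in>E. u \<in> e} \<le> 2"
  obtains cs where "odd (length cs)" "length cs \<ge> 3" "distinct cs" "set cs = V"
    "E = {{cs ! i, cs ! ((i + 1) mod length cs)} | i. i < length cs}"
proof -
  have finV: "finite V" and UE: "\<Union>E = V" using cr unfolding crit_def by auto
  have finE: "finite E" by (rule crit_finite_edges[OF cr])
  define path where "path xs \<longleftrightarrow> xs \<noteq> [] \<and> distinct xs \<and> set xs \<subseteq> V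
    \<and> (\<forall>i. Suc i < length xs \<longrightarrow> {xs ! i, xs ! Suc i} \<in> E)" for xs
  have "V \<noteq> {}" using crit_card_V[OF cr] by auto
  then obtain v0 where "v0 \<in> V" by auto
  then have "path [v0]" unfolding path_def by simp
  moreover have "length xs \<le> card V" if "path xs" for xs
    using that finV unfolding path_def by (metis card_mono distinct_card)
  ultimately obtain xs where xs: "path xs" and max: "\<And>ys. path ys \<Longrightarrow> length ys \<le> length xs"
    using ex_has_greatest_nat[of path "[v0]" length "Suc (card V)"] by (metis le_imp_less_Suc)
  define n where "n = length xs"
  have dist: "xs ! i = xs ! j \<longleftrightarrow> i = j" if "i < n" "j < n" for i j
    using xs that unfolding path_def n_def by (simp add: nth_eq_iff_index_eq)
  have step: "{xs ! i, xs ! Suc i} \<in> E" if "Suc i < n" for i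
    using xs that unfolding path_def n_def by simp
  have inV: "xs ! i \<in> V" if "i < n" for i using xs that unfolding path_def n_def by auto
  have n0: "n > 0" using xs unfolding path_def n_def by simp
  define x where "x = xs ! (n - 1)"
  have xl: "x = last xs" using n0 unfolding x_def n_def by (simp add: last_conv_nth)
  have xV: "x \<in> V" unfolding x_def using inV n0 by simp
  have closed: "y \<in> set xs" if y: "{x, y} \<in> E" for y
  proof (rule ccontr)
    assume "y \<notin> set xs"
    moreover have "y \<in> V" using y UE by auto
    moreover have "{(xs @ [y]) ! i, (xs @ [y]) ! Suc i} \<in> E" if i: "Suc i < length (xs @ [y])" for i
    proof (cases "Suc i < n")
      case True
      then show ?thesis using step[OF True] unfolding n_def by (simp add: nth_append)
    next
      case False
      then have "i = n - 1" "Suc i = n" using i unfolding n_def by auto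
      then show ?thesis using y n0 unfolding x_def n_def by (simp add: nth_append)
    qed
    ultimately have "path (xs @ [y])" using xs unfolding path_def by auto
    then show False using max by fastforce
  qed
  have "2 \<le> card {e\<in>E. x \<in> e}" using crit_degree_ge[OF cr _ xV] by simp
  then obtain a b where ab: "a \<in> E" "b \<in> E" "x \<in> a" "x \<in> b" "a \<noteq> b"
    by (auto simp: numeral_2_eq_2 card_le_Suc_iff)
  have "\<exists>i<n - 1. e = {x, xs ! i}" if e: "e \<in> E" "x \<in> e" for e
  proof -
    obtain y where y: "e = {x, y}" "y \<noteq> x" using c2[OF e(1)] e(2) by (auto simp: card_2_iff)
    then obtain i where i: "i < n" "y = xs ! i" using closed e by (metis in_set_conv_nth n_def)
    then have "i \<noteq> n - 1" using y unfolding x_def by auto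
    then show ?thesis using i y by (intro exI[of _ i]) auto
  qed
  then obtain i j where ij: "i < n - 1" "j < n - 1" "a = {x, xs ! i}" "b = {x, xs ! j}" using ab by metis
  \<comment> \<open>One of the two neighbours of the last vertex \<open>x\<close> is not its
    predecessor \<open>xs ! (n - 2)\<close>.\<close>
  then have "\<exists>j. Suc j < n - 1 \<and> {x, xs ! j} \<in> E"
  proof -
    have "i \<noteq> j" using ij ab by auto
    then have "Suc i < n - 1 \<or> Suc j < n - 1" using ij(1,2) by linarith
    then show ?thesis using ij ab by auto
  qed
  then obtain j where j: "Suc j < n - 1" "{x, xs ! j} \<in> E" by auto
  have n3: "n \<ge> 3" using j by simp
  \<comment> \<open>An inner vertex of the path would have a third edge besides its two path
    edges.\<close>
  have "j = 0"
  proof (rule ccontr)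
    assume "j \<noteq> 0"
    then obtain j' where j': "j = Suc j'" by (cases j) auto
    have "{x, xs ! j} = {xs ! j', xs ! j} \<or> {x, xs ! j} = {xs ! j, xs ! Suc j}"
    proof (rule two_regular_edges[OF finE low])
      show "xs ! j \<in> V" using inV j by simp
      show "{xs ! j', xs ! j} \<in> E" "{xs ! j, xs ! Suc j} \<in> E" using step[of j'] step[of j] j j' by auto
      show "{xs ! j', xs ! j} \<noteq> {xs ! j, xs ! Suc j}" using j j' dist by (auto simp: doubleton_eq_iff)
    qed (use j in auto)
    then show False using j j' dist unfolding x_def by (auto simp: doubleton_eq_iff)
  qed
  define C where "C i = {xs ! i, xs ! ((i + 1) mod n)}" for i
  have Clast: "C (n - 1) = {x, xs ! 0}" using n0 unfolding C_def x_def by simp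
  have Cstep: "C i = {xs ! i, xs ! Suc i}" if "Suc i < n" for i using that unfolding C_def by simp
  have CE: "C i \<in> E" if "i < n" for i
  proof (cases "Suc i < n")
    case True then show ?thesis using Cstep step by simp
  next
    case False
    then have "i = n - 1" using that by simp
    then show ?thesis using Clast j \<open>j = 0\<close> by simp
  qed
  have at: "e \<in> C ` {..<n}" if e: "e \<in> E" "xs ! i \<in> e" and i: "i < n" for e i
  proof -
    define p where "p = (if i = 0 then n - 1 else i - 1)"
    have p: "p < n" "xs ! i \<in> C p" "C p \<noteq> C i"
    proof -
      show "p < n" unfolding p_def using i by auto
      show "xs ! i \<in> C p" unfolding p_def using Clast Cstep[of "i - 1"] i by auto
      consider "i = 0" | "i \<noteq> 0" "Suc i < n" | "i = n - 1" "i \<noteq> 0" using i by linarith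
      then show "C p \<noteq> C i"
      proof cases
        case 1
        then show ?thesis using Clast Cstep[of 0] n3 dist unfolding p_def x_def
          by (auto simp: doubleton_eq_iff)
      next
        case 2
        then show ?thesis using Cstep[of i] Cstep[of "i - 1"] n3 dist unfolding p_def
          by (auto simp: doubleton_eq_iff)
      next
        case 3
        then show ?thesis using Clast Cstep[of "i - 1"] n3 dist unfolding p_def x_def
          by (auto simp: doubleton_eq_iff)
      qed
    qed
    have "e = C p \<or> e = C i"
    proof (rule two_regular_edges[OF finE low[OF inV[OF i]] CE[OF p(1)] CE[OF i] p(2) _ p(3) e])
      show "xs ! i \<in> C i" unfolding C_def by simp
    qed
    then show ?thesis using p i by auto
  qed
  have CV: "C i \<subseteq> set xs" if "i < n" for i
    using that unfolding C_def n_def by (auto intro!: nth_mem mod_less_divisor)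
  have setV: "set xs = V"
  proof (rule ccontr)
    assume "set xs \<noteq> V"
    then have T: "set xs \<noteq> {}" "set xs \<subset> V" using xs unfolding path_def by auto
    have conn: "conn_on E V" using crit_conn[OF cr] by simp
    obtain e s y where e: "e \<in> E" "s \<in> e" "s \<in> set xs" "y \<in> e" "y \<notin> set xs"
      by (rule conn_onE[OF conn T])
    then obtain i where i: "i < n" "s = xs ! i" by (metis in_set_conv_nth n_def)
    then obtain i' where "i' < n" "e = C i'" using at[of e i] e by auto
    then show False using CV[of i'] e by auto
  qed
  have Eeq: "E = C ` {..<n}"
  proof
    show "C ` {..<n} \<subseteq> E" using CE by auto
    show "E \<subseteq> C ` {..<n}"
    proof
      fix e assume e: "e \<in> E"
      obtain s where s: "s \<in> e" using c2[OF e] by fastforce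
      then have "s \<in> set xs" using e UE setV by auto
      then obtain i where "i < n" "s = xs ! i" by (metis in_set_conv_nth n_def)
      then show "e \<in> C ` {..<n}" using at e s by auto
    qed
  qed
  have "odd n"
  proof (rule ccontr)
    assume ev: "\<not> odd n"
    define f where "f u = (SOME i. i < n \<and> xs ! i = u) mod 2" for u
    have f: "f (xs ! i) = i mod 2" if "i < n" for i
    proof -
      have "(SOME i'. i' < n \<and> xs ! i' = xs ! i) = i" using that dist by (intro some_equality) auto
      then show ?thesis unfolding f_def by simp
    qed
    have "\<not> monochrom f (C i)" if i: "i < n" for i
    proof (cases "Suc i < n")
      case True
      have "f (xs ! i) \<noteq> f (xs ! Suc i)" using f[of i] f[of "Suc i"] True by (simp add: mod_Suc)
      then show ?thesis unfolding not_monochrom_iff Cstep[OF True] by blast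
    next
      case False
      then have "i = n - 1" using i by simp
      have "odd (n - 1)" using ev n0 by simp
      then have "f (xs ! (n - 1)) = 1" using f[of "n - 1"] n0
        by (metis diff_less less_numeral_extra(1) odd_iff_mod_2_eq_one)
      moreover have "f (xs ! 0) = 0" using f[of 0] n0 by simp
      ultimately have "f x \<noteq> f (xs ! 0)" unfolding x_def by simp
      then show ?thesis unfolding not_monochrom_iff \<open>i = n - 1\<close> Clast by blast
    qed
    then have "proper 2 E f" unfolding proper_def Eeq by (auto simp: f_def)
    then show False using crit_not_proper[OF cr] by metis
  qed
  moreover have "distinct xs" using xs unfolding path_def by simp
  moreover have "E = {{xs ! i, xs ! ((i + 1) mod length xs)} | i. i < length xs}"
    unfolding Eeq C_def n_def by auto
  ultimately show thesis using that[of xs] n3 setV unfolding n_def by simp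
qed

context low_unsplittable
begin

text \<open>A large edge \<open>e\<close> could be replaced by \<open>e - {x}\<close>; then \<open>x\<close> has degree at most one, and greedy
  colouring towards \<open>x\<close> succeeds.\<close>

lemma rest_edges_card2:
  assumes "k = 3" and e: "e \<in> rest" shows "card e = 2"
proof (rule ccontr)
  assume "card e \<noteq> 2"
  have crr: "crit 2 (V - {w}) rest" using rest_crit \<open>k = 3\<close> by simp
  have finr: "finite rest" by (rule crit_finite_edges[OF crr])
  have fine: "finite e" by (rule crit_finite_edge[OF crr e])
  have e3: "3 \<le> card e" using \<open>card e \<noteq> 2\<close> crr e unfolding crit_def by fastforce
  then obtain x where x: "x \<in> e" by fastforce
  then have xV: "x \<in> V - {w}" using crit_edge_subset[OF crr e] by auto
  define R where "R = insert (e - {x}) (rest - {e})"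
  have cardx: "card (e - {x}) \<ge> 2" using e3 x fine by simp
  have othR: "\<exists>y\<in>g. y \<noteq> u" if "g \<in> R" for g u
  proof (cases "g = e - {x}")
    case True
    then have "\<not> g \<subseteq> {u}" using cardx card_mono[of "{u}" g] by auto
    then show ?thesis by auto
  next
    case False
    then have "g \<in> rest" using that unfolding R_def by auto
    then show ?thesis using crit_edge_other[OF crr] by metis
  qed
  have degx: "card {g\<in>R. x \<in> g} < 2"
  proof -
    have "{g\<in>R. x \<in> g} \<subset> {g\<in>rest. x \<in> g}" using e x unfolding R_def by auto
    then have "card {g\<in>R. x \<in> g} < card {g\<in>rest. x \<in> g}" using finr by (intro psubset_card_mono) auto
    then show ?thesis using rest_low[OF xV] \<open>k = 3\<close> by simp
  qed
  have degR: "card {g\<in>R. u \<in> g} \<le> 2" if u: "u \<in> V - {w}" for u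
  proof -
    have "{g\<in>R. u \<in> g} \<subseteq> (\<lambda>g. if g = e then e - {x} else g) ` {g\<in>rest. u \<in> g}"
    proof
      fix g assume g: "g \<in> {g\<in>R. u \<in> g}"
      show "g \<in> (\<lambda>g. if g = e then e - {x} else g) ` {g\<in>rest. u \<in> g}"
      proof (cases "g = e - {x}")
        case True
        then have "e \<in> {g\<in>rest. u \<in> g}" using g e by auto
        then show ?thesis using True by force
      next
        case False
        then have "g \<in> {g\<in>rest. u \<in> g}" "g \<noteq> e" using g unfolding R_def by auto
        then show ?thesis by force
      qed
    qed
    moreover have "finite {g\<in>rest. u \<in> g}" using finr by simp
    ultimately have "card {g\<in>R. u \<in> g} \<le> card {g\<in>rest. u \<in> g}" by (rule surj_card_le[rotated])
    then show ?thesis using rest_low[OF u] \<open>k = 3\<close> by simp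
  qed
  obtain h where h: "h \<in> rest" "x \<in> h" "h \<noteq> e"
  proof -
    have "2 \<le> card {g\<in>rest. x \<in> g}" using crit_degree_ge[OF crr _ xV] by simp
    then have "\<not> {g\<in>rest. x \<in> g} \<subseteq> {e}" using card_mono[of "{e}" "{g\<in>rest. x \<in> g}"] by auto
    then show thesis using that by auto
  qed
  obtain h' where h': "h' \<in> h" "h' \<noteq> x" using crit_edge_other[OF crr h(1)] by metis
  have h'V: "h' \<in> V - {w}" using h' crit_edge_subset[OF crr h(1)] by auto
  have hR: "h \<in> R" using h unfolding R_def by auto
  have "conn_on R (V - {w})"
    unfolding conn_on_def
  proof (intro allI impI)
    fix T assume T: "T \<noteq> {} \<and> T \<subset> V - {w}"
    show "\<exists>g\<in>R. g \<inter> T \<noteq> {} \<and> g \<inter> (V - {w} - T) \<noteq> {}"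
    \<comment> \<open>Connectivity without \<open>x\<close> yields a crossing edge that survives the
      shrinking of \<open>e\<close>. It does not apply if \<open>x\<close> alone forms one of the
      parts, and then \<open>h\<close> crosses.\<close>
    proof (cases "T - {x} \<noteq> {} \<and> V - {w} - {x} - T \<noteq> {}")
      case True
      then have T': "T - {x} \<noteq> {}" "T - {x} \<subset> V - {w} - {x}" using T by auto
      obtain g s y where g: "g \<in> rest" "s \<in> g" "s \<in> T - {x}" "y \<in> g" "y \<in> V - {w} - {x}" "y \<notin> T - {x}"
        by (rule conn_onE[OF rest_conn_minus[OF xV] T'])
      let ?g = "if g = e then e - {x} else g"
      have "?g \<in> R" "s \<in> ?g \<inter> T" "y \<in> ?g \<inter> (V - {w} - T)" using g unfolding R_def by auto
      then show ?thesis by blast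
    next
      case False
      moreover have "V - {w} - T \<noteq> {}" using T by auto
      ultimately have "T = {x} \<or> V - {w} - T = {x}" using T by auto
      then have "h \<inter> T \<noteq> {} \<and> h \<inter> (V - {w} - T) \<noteq> {}"
      proof
        assume "T = {x}"
        then have "x \<in> h \<inter> T" "h' \<in> h \<inter> (V - {w} - T)" using h h' h'V by auto
        then show ?thesis by blast
      next
        assume eq: "V - {w} - T = {x}"
        have "h' \<in> T"
        proof (rule ccontr)
          assume "h' \<notin> T"
          then have "h' \<in> V - {w} - T" using h'V by auto
          then show False using h' unfolding eq by simp
        qed
        then show ?thesis using h h' eq by auto
      qed
      then show ?thesis using hR by blast
    qed
  qed
  have emp: "{g \<in> R. g \<inter> (V - {w}) = {}} = {}"
  proof -
    have "g \<subseteq> V - {w}" if "g \<in> R" for g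
      using that crit_edge_subset[OF crr] e unfolding R_def by blast
    then show ?thesis using othR by blast
  qed
  have f0: "proper 2 {g \<in> R. g \<inter> (V - {w}) = {}} (\<lambda>_. 0)" unfolding emp proper_def by simp
  have finR: "finite R" using finr unfolding R_def by simp
  obtain f where f: "proper 2 {g\<in>R. x \<notin> g} f"
    by (rule greedy_colouring[OF _ finR \<open>conn_on R (V - {w})\<close> xV othR degR f0]) (use finV in auto)
  obtain c where c: "proper 2 R (f(x := c))"
    by (rule recolour_proper[OF f finR othR degx])
  have "\<not> monochrom (f(x := c)) (e - {x})" using c unfolding proper_def R_def by auto
  then have "\<not> monochrom (f(x := c)) e" using monochrom_subset by blast
  then have "proper 2 rest (f(x := c))" using c unfolding proper_def R_def by auto
  then show False using crit_not_proper[OF crr] by metis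
qed

lemma wheel:
  assumes k: "k = 3" shows "odd_wheel (V, E)"
proof -
  have crr: "crit 2 (V - {w}) rest" using rest_crit k by simp
  have lw: "\<And>u. u \<in> V - {w} \<Longrightarrow> card {e\<in>rest. u \<in> e} \<le> 2" using rest_low k by simp
  obtain cs where cs: "odd (length cs)" "length cs \<ge> 3" "distinct cs" "set cs = V - {w}"
    "rest = {{cs ! i, cs ! ((i + 1) mod length cs)} | i. i < length cs}"
    by (rule two_critical_cycle[OF crr rest_edges_card2[OF k] lw])
  have "E = rest \<union> {{w, u} | u. u \<in> V - {w}}"
    using joined unfolding rest_def by (auto elim: edges_at_w)
  also have "{{w, u} | u. u \<in> V - {w}} = {{w, cs ! i} | i. i < length cs}"
    unfolding cs(4)[symmetric] by (auto simp: in_set_conv_nth)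
  finally have "E = rest \<union> {{w, cs ! i} | i. i < length cs}" .
  moreover have "V = insert w (set cs)" "distinct (w # cs)" using cs wV by auto
  ultimately show ?thesis unfolding odd_wheel_def using cs by (intro exI[of _ cs] exI[of _ w]) simp
qed

end

section \<open>Every non-basic member of the class has a splitting\<close>

abbreviation hajos_base :: "nat \<Rightarrow> 'a hgraph \<Rightarrow> bool" where
  "hajos_base k \<equiv> (if k = 3 then odd_wheel else complete_hg (k + 1))"

text \<open>Hence a smaller member of the class with an edge of three or more vertices is not basic
  and must split.\<close>

lemma hajos_base_card2:
  assumes "hajos_base k (V, E)" "e \<in> E" shows "card e = 2"
proof (cases "k = 3")
  case True
  then obtain cs w where cs: "length cs \<ge> 3" "distinct (w # cs)"
    "E = {{cs ! i, cs ! ((i + 1) mod length cs)} | i. i < length cs} \<union> {{w, cs ! i} | i. i < length cs}"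
    using assms(1) unfolding odd_wheel_def by auto
  have "cs ! i \<noteq> cs ! ((i + 1) mod length cs)" if "i < length cs" for i
  proof -
    have "(i + 1) mod length cs \<noteq> i" using that cs(1) by (cases "Suc i = length cs") auto
    moreover have "(i + 1) mod length cs < length cs" using that by (intro mod_less_divisor) auto
    ultimately show ?thesis using that cs(2) by (simp add: nth_eq_iff_index_eq)
  qed
  moreover have "w \<noteq> cs ! i" if "i < length cs" for i using cs(2) that by auto
  ultimately show ?thesis using assms(2) cs(3) by auto
qed (use assms in \<open>auto simp: complete_hg_def\<close>)

lemma critical_base_or_split:
  assumes "k \<ge> 3" "crit k V E" "sep_le k V E"
  shows "hajos_base k (V, E) \<or> (\<exists>A B v e. hsplit V E A B v e)"
  using assms(2,3)
proof (induction "card V" arbitrary: V E rule: less_induct)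
  case less
  note cr = less.prems(1) and le = less.prems(2)
  have finV: "finite V" and UE: "\<Union>E = V" using cr unfolding crit_def by auto
  show ?case
  proof (cases "\<exists>w\<in>V. \<forall>u\<in>V - {w}. card {e\<in>E. u \<in> e} \<le> k")
    case True
    then obtain w where w: "w \<in> V" "\<And>u. u \<in> V - {w} \<Longrightarrow> card {e\<in>E. u \<in> e} \<le> k" by auto
    show ?thesis
    proof (cases "\<exists>A B v e. hsplit V E A B v e")
      case False
      then interpret low_unsplittable k V E w
        using cr assms(1) w by unfold_locales auto
      show ?thesis
      proof (cases "k = 3")
        case True then show ?thesis using wheel by simp
      next
        case False then show ?thesis using complete assms(1) by simp
      qed
    qed simp
  next
    case False
    have "V \<noteq> {}" using crit_card_V[OF cr] assms(1) by auto
    then obtain w where "w \<in> V" by auto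
    then obtain x where x: "x \<in> V" "k < card {e\<in>E. x \<in> e}" using False by (meson DiffD1 not_le)
    have "\<not> (\<forall>u\<in>V - {x}. card {e\<in>E. u \<in> e} \<le> k)" using False x(1) by blast
    then obtain y where y: "y \<in> V" "y \<noteq> x" "k < card {e\<in>E. y \<in> e}" by (auto simp: not_le)
    obtain Z where Z: "Z \<subseteq> V" "(x \<in> Z) \<noteq> (y \<in> Z)" "card (bd E Z) \<le> k"
      by (rule sep_leE[OF le, of x y x]) (use UE x y in auto)
    have tight: "card (bd E Z) = k" using crit_cut_ge[OF cr x(1) y(1) Z(2)] Z(3) by simp
    \<comment> \<open>A side consisting of one vertex is cut off by all edges at that vertex, here
      more than \<open>k\<close>.\<close>
    have big: "2 \<le> card Y" if "Y \<subseteq> V" "card (bd E Y) = k" "u \<in> Y" "k < card {e\<in>E. u \<in> e}" for Y u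
    proof (rule ccontr)
      assume "\<not> 2 \<le> card Y"
      moreover have "finite Y" using that(1) finV by (rule finite_subset)
      ultimately have "Y = {u}" using that(3) card_mono[of Y "{u, _}"]
        by (metis One_nat_def Suc_1 Suc_leI card_1_singletonE card_gt_0_iff empty_iff le_neq_implies_less less_2_cases not_le singletonD)
      then show False using that(2,4) bd_singleton[OF cr, of u] by simp
    qed
    have bdc: "bd E (V - Z) = bd E Z" using UE by (simp add: bd_compl)
    have ZZ: "2 \<le> card Z" "2 \<le> card (V - Z)"
      using big[of Z x] big[of Z y] big[of "V - Z" x] big[of "V - Z" y] Z x y tight bdc by auto
    have "Z \<noteq> {}" "Z \<noteq> V" using Z x y by auto
    then have "mono_side k V E Z \<or> mono_side k V E (V - Z)"
      using mono_side_exists[OF cr _ Z(1) _ _ tight] assms(1) by simp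
    then obtain X where X: "mono_side k V E X" "X \<subset> V" "card (bd E X) = k" "2 \<le> card X"
    proof
      assume "mono_side k V E Z"
      then show thesis using that[of Z] ZZ(1) tight Z(1) \<open>Z \<noteq> V\<close> by auto
    next
      assume "mono_side k V E (V - Z)"
      moreover have "V - Z \<subset> V" using Z(1) \<open>Z \<noteq> {}\<close> by auto
      ultimately show thesis using that[of "V - Z"] ZZ(2) tight bdc by simp
    qed
    interpret mono_cut k V E X
      using cr assms(1) X by unfold_locales auto
    have "card X < card V" using X finV by (intro psubset_card_mono)
    have "\<exists>A B v e. hsplit V E A B v e"
    proof (rule splits[OF le])
      fix b assume "3 \<le> card (ends E X)"
      show "\<exists>A B v e. hsplit X (closed_side E X) A B v e
          \<and> (ends E X \<noteq> e \<or> (\<exists>l. l \<noteq> b \<and> e \<inter> (A - {v}) = {l}))"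
      \<comment> \<open>With the bound \<open>card V\<close>, the induction hypothesis reaches the
        closed side and all factors split off from it.\<close>
      proof (rule large_edge_split[OF _ assms(1) \<open>card X < card V\<close> closed_side_crit
            closed_side_sep_le[OF le] _ \<open>3 \<le> card (ends E X)\<close>])
        fix V' :: "'a set" and E'
        assume "card V' < card V" "crit k V' E'" "sep_le k V' E'"
        then show "(\<forall>e\<in>E'. card e = 2) \<or> (\<exists>A B v e. hsplit V' E' A B v e)"
          using less.hyps[of V' E'] hajos_base_card2 by blast
      qed (simp add: closed_side_def)
    qed
    then show ?thesis by simp
  qed
qed

subsection \<open>Critical hypergraphs in terms of \<open>crit\<close>\<close>

lemma proper_colorable: "proper k E f \<Longrightarrow> colorable (V, E) k"
  unfolding proper_def colorable_def not_monochrom_iff by auto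

lemma colorable_proper:
  assumes "colorable (V, E) k" "k \<ge> 1" "\<Union>E \<subseteq> V"
  obtains f where "proper k E f"
proof -
  obtain f where f: "f ` V \<subseteq> {..<k}" "\<And>e. e \<in> E \<Longrightarrow> \<not> monochrom f e"
    using assms(1) unfolding colorable_def not_monochrom_iff by auto
  \<comment> \<open>\<open>proper\<close> bounds the colours outside \<open>V\<close> too; the
    default value 0 is admissible because \<open>k \<ge> 1\<close>.\<close>
  have "\<not> monochrom (\<lambda>u. if u \<in> V then f u else 0) e" if "e \<in> E" for e
  proof -
    have "monochrom (\<lambda>u. if u \<in> V then f u else 0) e = monochrom f e"
      using that assms(3) by (intro monochrom_cong) auto
    then show ?thesis using f that by simp
  qed
  then have "proper k E (\<lambda>u. if u \<in> V then f u else 0)"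
    using f(1) assms(2) unfolding proper_def by auto
  then show thesis by (rule that)
qed

text \<open>\<open>chi\<close> is a \<open>LEAST\<close>, so some colouring has to exist first: an
  injective one works because every edge has two vertices.\<close>

lemma chi_le_iff:
  assumes "hypergraph G" shows "chi G \<le> n \<longleftrightarrow> colorable G n"
proof
  have mono: "colorable G m" if "colorable G l" "l \<le> m" for l m
    using that unfolding colorable_def by (meson lessThan_subset_iff order_trans)
  obtain f :: "'a \<Rightarrow> nat" where f: "inj_on f (fst G)" "f ` fst G = {..<card (fst G)}"
    using assms ex_bij_betw_finite_nat[of "fst G"] unfolding hypergraph_def bij_betw_def
    by (auto simp: atLeast0LessThan)
  have "\<exists>u\<in>e. \<exists>w\<in>e. f u \<noteq> f w" if e: "e \<in> snd G" for e
  proof -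
    have "e \<subseteq> fst G" "2 \<le> card e" using assms e unfolding hypergraph_def by auto
    then have "\<not> card e \<le> Suc 0" "finite e" by (simp, metis card.infinite not_numeral_le_zero)
    then obtain u w where "u \<in> e" "w \<in> e" "u \<noteq> w" by (auto simp: card_le_Suc0_iff_eq)
    then show ?thesis using f(1) \<open>e \<subseteq> fst G\<close> by (metis inj_onD subsetD)
  qed
  then have "colorable G (card (fst G))" using f unfolding colorable_def by auto
  then have "colorable G (chi G)" unfolding chi_def by (rule LeastI)
  then show "chi G \<le> n \<Longrightarrow> colorable G n" using mono by auto
  show "colorable G n \<Longrightarrow> chi G \<le> n" unfolding chi_def by (rule Least_le)
qed

lemma critical_iff_crit:
  assumes k: "k \<ge> 1" shows "critical (k + 1) (V, E) \<longleftrightarrow> crit k V E"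
proof
  assume c: "critical (k + 1) (V, E)"
  then have hg: "finite V" "E \<subseteq> Pow V" "\<And>e. e \<in> E \<Longrightarrow> 2 \<le> card e"
    unfolding critical_def hypergraph_def by auto
  have sub: "colorable H k" if "subhypergraph H (V, E)" "H \<noteq> (V, E)" for H
  proof -
    have "chi H < k + 1" using c that unfolding critical_def by blast
    then show ?thesis using that chi_le_iff[of H k] unfolding subhypergraph_def by auto
  qed
  have nc: "\<not> proper k E f" for f
    using c chi_le_iff[of "(V, E)" k] proper_colorable[of k E f V] unfolding critical_def by auto
  have "\<exists>f. proper k (E - {e}) f" if e: "e \<in> E" for e
  proof -
    have "colorable (V, E - {e}) k"
      using hg e by (intro sub) (auto simp: subhypergraph_def hypergraph_def)
    then show ?thesis using colorable_proper[OF _ k] hg(2) by (metis Sup_subset_mono Union_Pow_eq Diff_subset order_trans)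
  qed
  moreover have "V \<subseteq> \<Union>E"
  proof
    fix v assume v: "v \<in> V"
    show "v \<in> \<Union>E"
    proof (rule ccontr)
      assume "v \<notin> \<Union>E"
      then have s: "\<Union>E \<subseteq> V - {v}" using hg(2) by auto
      then have "subhypergraph (V - {v}, E) (V, E)"
        using hg unfolding subhypergraph_def hypergraph_def by auto
      moreover have "(V - {v}, E) \<noteq> (V, E)" using v by auto
      ultimately have "colorable (V - {v}, E) k" by (rule sub)
      then show False using colorable_proper[OF _ k s] nc by metis
    qed
  qed
  ultimately show "crit k V E" using hg nc unfolding crit_def by auto
next
  assume c: "crit k V E"
  have hg: "hypergraph (V, E)" using c unfolding crit_def hypergraph_def by auto
  have UE: "\<Union>E = V" using c unfolding crit_def by auto
  have "\<not> colorable (V, E) k" using colorable_proper[OF _ k] UE c crit_not_proper by (metis order_refl)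
  then have "\<not> chi (V, E) \<le> k" using chi_le_iff[OF hg] by simp
  \<comment> \<open>Colour without one edge \<open>e\<close> and give a vertex \<open>u\<close> of
    \<open>e\<close> the extra colour \<open>k\<close>.\<close>
  moreover have "chi (V, E) \<le> k + 1"
  proof -
    have "E \<noteq> {}" using c k crit_not_proper[OF c, of "\<lambda>_. 0"] unfolding proper_def by auto
    then obtain e where e: "e \<in> E" by auto
    obtain u where u: "u \<in> e" using crit_edge_other[OF c e] by metis
    obtain f where f: "proper k (E - {e}) f" using c e unfolding crit_def by auto
    have fk: "f x < k" for x using f unfolding proper_def by auto
    have "\<not> monochrom (f(u := k)) g" if g: "g \<in> E" for g
    proof (cases "u \<in> g")
      case True
      obtain y where "y \<in> g" "y \<noteq> u" using crit_edge_other[OF c g] by metis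
      then show ?thesis using True fk[of y] monochromD[of "f(u := k)" g u y] by auto
    next
      case False
      then have "monochrom (f(u := k)) g = monochrom f g" by (intro monochrom_cong) auto
      then show ?thesis using f g False u unfolding proper_def by auto
    qed
    then have "proper (k + 1) E (f(u := k))" using fk unfolding proper_def by (simp add: less_Suc_eq)
    then show ?thesis using chi_le_iff[OF hg] proper_colorable by blast
  qed
  ultimately have "chi (V, E) = k + 1" by linarith
  moreover have "chi H < k + 1" if H: "subhypergraph H (V, E)" "H \<noteq> (V, E)" for H
  proof -
    obtain V' E' where VE: "H = (V', E')" by (cases H)
    have hgH: "hypergraph H" "V' \<subseteq> V" "E' \<subseteq> E" "\<Union>E' \<subseteq> V'"
      using H VE unfolding subhypergraph_def hypergraph_def by auto
    then have "E' \<noteq> E" using H(2) UE VE by auto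
    then obtain f where "proper k E' f" using crit_sub_colourable[OF c hgH(3)] by metis
    then show ?thesis using chi_le_iff[OF hgH(1)] proper_colorable VE by (metis Suc_eq_plus1 le_imp_less_Suc)
  qed
  ultimately show "critical (k + 1) (V, E)" using hg unfolding critical_def by auto
qed

subsection \<open>Isomorphic copies\<close>

lemma monochrom_image: "monochrom g (f ` e) \<longleftrightarrow> monochrom (g \<circ> f) e"
  unfolding monochrom_def by auto

lemma proper_image_iff:
  "(\<forall>u. g u < k) \<Longrightarrow> proper k ((image f) ` E) g \<longleftrightarrow> proper k E (g \<circ> f)"
  unfolding proper_def by (auto simp: monochrom_image)

lemma crit_image:
  assumes cr: "crit k V E" and inj: "inj_on f V"
  shows "crit k (f ` V) ((image f) ` E)"
  unfolding crit_def
proof (intro conjI ballI allI)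
  have UE: "\<Union>E = V" and finV: "finite V" using cr unfolding crit_def by auto
  have injI: "inj_on (image f) E" by (rule inj_on_image) (simp add: UE inj)
  show "finite (f ` V)" using finV by simp
  show "\<Union>((image f) ` E) = f ` V" using UE by blast
  show "2 \<le> card d" if d: "d \<in> (image f) ` E" for d
  proof -
    obtain e where e: "e \<in> E" "d = f ` e" using d by auto
    have "inj_on f e" using inj crit_edge_subset[OF cr e(1)] by (rule inj_on_subset)
    then show ?thesis using e cr unfolding crit_def by (simp add: card_image)
  qed
  show "\<not> proper k ((image f) ` E) g" for g
  proof
    assume g: "proper k ((image f) ` E) g"
    then have "proper k E (g \<circ> f)" using proper_image_iff[of g k f E] unfolding proper_def by blast
    then show False using crit_not_proper[OF cr] by metis
  qed
  fix d assume "d \<in> (image f) ` E"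
  then obtain e where e: "e \<in> E" "d = f ` e" by auto
  obtain g where g: "proper k (E - {e}) g" using cr e unfolding crit_def by auto
  have "proper k (E - {e}) ((g \<circ> inv_into V f) \<circ> f)"
    unfolding proper_def
  proof (intro conjI allI ballI)
    fix u show "((g \<circ> inv_into V f) \<circ> f) u < k" using g unfolding proper_def by simp
  next
    fix a assume a: "a \<in> E - {e}"
    then have "a \<subseteq> V" using UE by auto
    then have "monochrom ((g \<circ> inv_into V f) \<circ> f) a = monochrom g a"
      using inv_into_f_f[OF inj] by (intro monochrom_cong) (simp add: subset_iff)
    then show "\<not> monochrom ((g \<circ> inv_into V f) \<circ> f) a" using g a unfolding proper_def by simp
  qed
  moreover have "(image f) ` E - {d} = (image f) ` (E - {e})"
    using inj_on_image_set_diff[OF injI, of E "{e}"] e by simp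
  ultimately have "proper k ((image f) ` E - {d}) (g \<circ> inv_into V f)"
    using proper_image_iff[of "g \<circ> inv_into V f" k f "E - {e}"] g unfolding proper_def by simp
  then show "\<exists>f'. proper k ((image f) ` E - {d}) f'" by blast
qed

lemma sep_le_image:
  assumes le: "sep_le k V E" and UE: "\<Union>E \<subseteq> V" and finE: "finite E" and inj: "inj_on f V"
  shows "sep_le k (f ` V) ((image f) ` E)"
  unfolding sep_le_def
proof (intro ballI impI)
  fix x' y' assume "x' \<in> f ` V" "y' \<in> f ` V" "x' \<noteq> y'"
  then obtain x y where xy: "x \<in> V" "y \<in> V" "x \<noteq> y" "x' = f x" "y' = f y" by auto
  obtain Z where Z: "Z \<subseteq> V" "(x \<in> Z) \<noteq> (y \<in> Z)" "card (bd E Z) \<le> k"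
    by (rule sep_leE[OF le UE xy(1-3), of x])
  have "bd ((image f) ` E) (f ` Z) \<subseteq> (image f) ` bd E Z"
  proof
    fix d assume d: "d \<in> bd ((image f) ` E) (f ` Z)"
    then obtain e where e: "e \<in> E" "d = f ` e" unfolding bd_def by auto
    have "e \<subseteq> V" using e UE by auto
    have "f ` e \<inter> f ` Z = f ` (e \<inter> Z)" using inj_on_image_Int[OF inj \<open>e \<subseteq> V\<close> Z(1)] by simp
    then have "e \<inter> Z \<noteq> {}" using d e unfolding bd_def by auto
    moreover have "e - Z \<noteq> {}" using d e unfolding bd_def by auto
    ultimately show "d \<in> (image f) ` bd E Z" using e unfolding bd_def by auto
  qed
  moreover have "finite (bd E Z)" using finE unfolding bd_def by auto
  ultimately have "card (bd ((image f) ` E) (f ` Z)) \<le> card (bd E Z)" by (rule surj_card_le[rotated])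
  moreover have "(x' \<in> f ` Z) \<noteq> (y' \<in> f ` Z)"
    using Z(1,2) xy inj_on_image_mem_iff[OF inj] by metis
  ultimately show "\<exists>Z. (x' \<in> Z) \<noteq> (y' \<in> Z) \<and> card (bd ((image f) ` E) Z) \<le> k"
    using Z(3) by (meson order_trans)
qed

subsection \<open>The basic hypergraphs\<close>

text \<open>One of the two vertices differs from \<open>w\<close>, and its singleton is a small
  enough cut.\<close>

lemma low_sep_le:
  assumes "finite E" and low: "\<And>u. u \<in> V - {w} \<Longrightarrow> card {e\<in>E. u \<in> e} \<le> k"
  shows "sep_le k V E"
  unfolding sep_le_def
proof (intro ballI impI)
  fix x y assume xy: "x \<in> V" "y \<in> V" "x \<noteq> y"
  define z where "z = (if x = w then y else x)"
  have "bd E {z} \<subseteq> {e\<in>E. z \<in> e}" unfolding bd_def by auto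
  then have "card (bd E {z}) \<le> card {e\<in>E. z \<in> e}" using assms(1) by (intro card_mono) auto
  also have "\<dots> \<le> k" using low xy unfolding z_def by auto
  finally have "card (bd E {z}) \<le> k" .
  moreover have "(x \<in> {z}) \<noteq> (y \<in> {z})" using xy unfolding z_def by auto
  ultimately show "\<exists>Z. (x \<in> Z) \<noteq> (y \<in> Z) \<and> card (bd E Z) \<le> k" by blast
qed

lemma complete_hg_crit:
  assumes k: "k \<ge> 2" and c: "complete_hg (k + 1) (V, E)"
  shows "crit k V E \<and> sep_le k V E"
proof -
  have finV: "finite V" and cV: "card V = k + 1" and E: "E = {e. e \<subseteq> V \<and> card e = 2}"
    using c unfolding complete_hg_def by auto
  have pair: "{x, y} \<in> E" if "x \<in> V" "y \<in> V" "x \<noteq> y" for x y using that unfolding E by auto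
  have finE: "finite E" using finV unfolding E by simp
  have deg: "card {e\<in>E. u \<in> e} \<le> k" if u: "u \<in> V" for u
  proof -
    have "{e\<in>E. u \<in> e} \<subseteq> (\<lambda>y. {u, y}) ` (V - {u})" unfolding E by (auto simp: card_2_iff)
    then have "card {e\<in>E. u \<in> e} \<le> card (V - {u})" using finV surj_card_le[of "V - {u}"] by blast
    then show ?thesis using u cV by simp
  qed
  obtain w where w: "w \<in> V" using cV by fastforce
  have conn: "conn_on E (V - {w})"
    unfolding conn_on_def
  proof (intro allI impI)
    fix T assume T: "T \<noteq> {} \<and> T \<subset> V - {w}"
    then obtain x y where xy: "x \<in> T" "y \<in> V - {w} - T" by auto
    then have "{x, y} \<in> E" using T by (intro pair) auto
    moreover have "{x, y} \<inter> T \<noteq> {} \<and> {x, y} \<inter> (V - {w} - T) \<noteq> {}" using xy by auto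
    ultimately show "\<exists>e\<in>E. e \<inter> T \<noteq> {} \<and> e \<inter> (V - {w} - T) \<noteq> {}" by (rule bexI[rotated])
  qed
  have nc: "\<not> proper k E f" for f
  proof
    assume f: "proper k E f"
    have "inj_on f V"
    proof (rule inj_onI, rule ccontr)
      fix x y assume "x \<in> V" "y \<in> V" "f x = f y" "x \<noteq> y"
      then have "{x, y} \<in> E" "monochrom f {x, y}" using pair unfolding monochrom_def by auto
      then show False using f unfolding proper_def by auto
    qed
    moreover have "f ` V \<subseteq> {..<k}" using f unfolding proper_def by auto
    ultimately have "card V \<le> k" by (metis card_image card_lessThan card_mono finite_lessThan)
    then show False using cV by simp
  qed
  have "V \<subseteq> \<Union>E"
  proof
    fix x assume x: "x \<in> V"
    then have "\<not> V \<subseteq> {x}" using card_mono[of "{x}" V] cV k by auto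
    then obtain y where "y \<in> V" "y \<noteq> x" by auto
    then show "x \<in> \<Union>E" using pair[of x y] x by auto
  qed
  then have UE: "\<Union>E = V" unfolding E by auto
  have "\<exists>f. proper k (E - {d}) f" if "d \<in> E" for d
    by (rule low_edge_removal[OF finV _ _ _ conn _ that]) (use UE E k deg in auto)
  then have "crit k V E" using finV UE nc unfolding crit_def by (auto simp: E)
  then show ?thesis using low_sep_le[OF finE, of V w k] deg by auto
qed

lemma odd_wheel_crit:
  assumes c: "odd_wheel (V, E)"
  shows "crit 3 V E \<and> sep_le 3 V E"
proof -
  obtain cs w where cs: "odd (length cs)" "length cs \<ge> 3" "distinct (w # cs)" "V = insert w (set cs)"
    "E = {{cs ! i, cs ! ((i + 1) mod length cs)} | i. i < length cs} \<union> {{w, cs ! i} | i. i < length cs}"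
    using c unfolding odd_wheel_def by auto
  define n where "n = length cs"
  define C where "C i = {cs ! i, cs ! ((i + 1) mod n)}" for i
  have n: "odd n" "n \<ge> 3" using cs unfolding n_def by auto
  have E: "E = C ` {..<n} \<union> (\<lambda>i. {w, cs ! i}) ` {..<n}" using cs(5) unfolding C_def n_def by auto
  have nth: "cs ! i = cs ! j \<longleftrightarrow> i = j" if "i < n" "j < n" for i j
    using cs(3) that unfolding n_def by (simp add: nth_eq_iff_index_eq)
  have sucn: "(i + 1) mod n < n" for i using n by simp
  have inr: "cs ! i \<in> set cs" if "i < n" for i using that unfolding n_def by simp
  have wcs: "w \<notin> set cs" using cs(3) by simp
  have card2: "card e = 2" if "e \<in> E" for e using hajos_base_card2[of 3 V E e] c that by simp
  have finV: "finite V" using cs(4) by simp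
  have UE: "\<Union>E = V"
  proof
    show "\<Union>E \<subseteq> V" unfolding E C_def cs(4) using inr sucn by auto
    show "V \<subseteq> \<Union>E"
    proof
      fix u assume "u \<in> V"
      then consider "u = w" | i where "i < n" "u = cs ! i"
        using cs(4) by (auto simp: in_set_conv_nth n_def)
      then show "u \<in> \<Union>E"
      proof cases
        case 1
        then show ?thesis unfolding E using n by (intro UnionI[of "{w, cs ! 0}"]) auto
      next
        case 2
        then show ?thesis unfolding E by (intro UnionI[of "{w, cs ! i}"]) auto
      qed
    qed
  qed
  have finE: "finite E" unfolding E by simp
  have deg: "card {e\<in>E. u \<in> e} \<le> 3" if u: "u \<in> V - {w}" for u
  proof -
    obtain i where i: "i < n" "u = cs ! i" using u cs(4) by (auto simp: in_set_conv_nth n_def)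
    define p where "p = (if i = 0 then n - 1 else i - 1)"
    have "{e\<in>E. u \<in> e} \<subseteq> {C i, C p, {w, cs ! i}}"
    proof
      fix e assume e: "e \<in> {e\<in>E. u \<in> e}"
      then consider j where "j < n" "e = C j" | j where "j < n" "e = {w, cs ! j}" unfolding E by auto
      then show "e \<in> {C i, C p, {w, cs ! i}}"
      proof cases
        case 1
        then have "i = j \<or> i = (j + 1) mod n" using e i nth sucn unfolding C_def by auto
        moreover have "j = p" if "i = (j + 1) mod n"
          using that 1(1) unfolding p_def by (cases "Suc j = n") auto
        ultimately show ?thesis using 1 by auto
      next
        case 2
        then show ?thesis using e u i nth by auto
      qed
    qed
    then have "card {e\<in>E. u \<in> e} \<le> card {C i, C p, {w, cs ! i}}" by (intro card_mono) auto
    also have "\<dots> \<le> 3" by (simp add: card_insert_if)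
    finally show ?thesis .
  qed
  have conn: "conn_on E (V - {w})"
    unfolding conn_on_def
  proof (intro allI impI, rule ccontr)
    fix T assume T: "T \<noteq> {} \<and> T \<subset> V - {w}"
      and no: "\<not> (\<exists>e\<in>E. e \<inter> T \<noteq> {} \<and> e \<inter> (V - {w} - T) \<noteq> {})"
    have Vw: "V - {w} = set cs" using cs(4) wcs by auto
    have step: "cs ! ((i + 1) mod n) \<in> T" if "i < n" "cs ! i \<in> T" for i
    proof (rule ccontr)
      assume a: "cs ! ((i + 1) mod n) \<notin> T"
      have "C i \<in> E" using that unfolding E by auto
      moreover have "cs ! i \<in> C i \<inter> T" "cs ! ((i + 1) mod n) \<in> C i \<inter> (V - {w} - T)"
        using that a inr[OF sucn] unfolding C_def Vw by auto
      ultimately show False using no by blast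
    qed
    obtain s where "s \<in> T" using T by auto
    then have "s \<in> set cs" using T Vw by auto
    then obtain i where i: "i < n" "s = cs ! i" by (metis in_set_conv_nth n_def)
    have all: "cs ! ((i + m) mod n) \<in> T" for m
    proof (induction m)
      case 0
      then show ?case using i \<open>s \<in> T\<close> by simp
    next
      case (Suc m)
      have "(i + m) mod n < n" using n by simp
      then have "cs ! (((i + m) mod n + 1) mod n) \<in> T" using Suc.IH by (rule step)
      then show ?case by (simp add: mod_Suc_eq)
    qed
    \<comment> \<open>From index \<open>i\<close>, \<open>j + n - i\<close> steps around the rim
      lead to \<open>j\<close>; the summand \<open>n\<close> keeps the subtraction from being
      truncated.\<close>
    have "cs ! j \<in> T" if j: "j < n" for j
    proof -
      have "i + (j + n - i) = j + n" using i by simp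
      then show ?thesis using all[of "j + n - i"] j by simp
    qed
    then have "set cs \<subseteq> T" by (auto simp: in_set_conv_nth n_def)
    then show False using T Vw by auto
  qed
  have nc: "\<not> proper 3 E f" for f
  proof
    assume f: "proper 3 E f"
    have f3: "f u < 3" for u using f unfolding proper_def by auto
    have rim: "f (cs ! i) \<noteq> f w" if "i < n" for i
    proof -
      have "{w, cs ! i} \<in> E" using that unfolding E by auto
      then show ?thesis using f unfolding proper_def monochrom_def by auto
    qed
    have ne: "f (cs ! i) \<noteq> f (cs ! ((i + 1) mod n))" if "i < n" for i
    proof -
      have "C i \<in> E" using that unfolding E by auto
      then show ?thesis using f unfolding proper_def monochrom_def C_def by auto
    qed
    \<comment> \<open>The rim avoids the colour of \<open>w\<close>, so the two remaining colours
      alternate along it; the last index \<open>n - 1\<close> is even and clashes with index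
      0.\<close>
    have alt: "f (cs ! i) = f (cs ! 0) \<longleftrightarrow> even i" if "i < n" for i
      using that
    proof (induction i)
      case (Suc i)
      have d: "f (cs ! i) \<noteq> f (cs ! Suc i)" using ne[of i] Suc.prems by simp
      show ?case
      proof (cases "even i")
        case True
        then show ?thesis using Suc d by auto
      next
        case False
        then have "f (cs ! i) \<noteq> f (cs ! 0)" using Suc by auto
        moreover have "f (cs ! 0) \<noteq> f w" "f (cs ! i) \<noteq> f w" "f (cs ! Suc i) \<noteq> f w"
          using rim Suc.prems by auto
        ultimately have "f (cs ! Suc i) = f (cs ! 0)"
          using d f3[of "cs ! 0"] f3[of "cs ! i"] f3[of "cs ! Suc i"] f3[of w] by linarith
        then show ?thesis using False by simp
      qed
    qed simp
    have "f (cs ! (n - 1)) = f (cs ! 0)" using alt[of "n - 1"] n by auto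
    then show False using ne[of "n - 1"] n by simp
  qed
  have "\<exists>f. proper 3 (E - {d}) f" if "d \<in> E" for d
    by (rule low_edge_removal[OF finV _ _ _ conn _ that]) (use UE card2 deg in auto)
  then have "crit 3 V E" using finV UE nc card2 unfolding crit_def by auto
  then show ?thesis using low_sep_le[OF finE, of V w 3] deg by auto
qed

subsection \<open>Joins and splittings\<close>

text \<open>A join seen in place: \<open>vs\<close> is the split vertex and the factor is a copy of
  the original hypergraph. The result for the second factor is obtained by exchanging the roles of
  the two.\<close>

lemma hajos_join_hsplit:
  assumes dis: "V1 \<inter> V2 = {}" and e1: "e1 \<in> E1" "v1 \<in> e1" and e2: "e2 \<in> E2" "v2 \<in> e2"
    and vs: "vs \<notin> V1 \<union> V2"
    and es: "es = (e1 \<union> e2) - {v1, v2} \<or> es = ((e1 \<union> e2) - {v1, v2}) \<union> {vs}"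
    and f: "f = (\<lambda>x. if x = v1 \<or> x = v2 then vs else x)"
    and E: "E = (image f) ` ((E1 - {e1}) \<union> (E2 - {e2})) \<union> {es}"
    and E1: "\<Union>E1 = V1" "\<And>e. e \<in> E1 \<Longrightarrow> 2 \<le> card e"
    and E2: "\<Union>E2 = V2" "\<And>e. e \<in> E2 \<Longrightarrow> 2 \<le> card e"
  shows "hsplit (f ` (V1 \<union> V2)) E (f ` V1) (f ` V2) vs es"
    and "hpart E (f ` V1) vs es = (image f) ` E1"
    and "inj_on f V1"
    and "insert vs (es \<inter> f ` V1) \<notin> E"
proof -
  have v1: "v1 \<in> V1" "v1 \<notin> V2" "v2 \<in> V2" "v2 \<notin> V1" using dis e1 e2 E1 E2 by auto
  have e12: "e1 \<subseteq> V1" "e2 \<subseteq> V2" using E1 E2 e1 e2 by auto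
  have fe: "f v1 = vs" "f v2 = vs" "\<And>x. x \<noteq> v1 \<Longrightarrow> x \<noteq> v2 \<Longrightarrow> f x = x" unfolding f by auto
  have A: "f ` V1 = insert vs (V1 - {v1})" and B: "f ` V2 = insert vs (V2 - {v2})"
    unfolding f using v1 by auto
  have AB: "f ` V1 \<inter> f ` V2 = {vs}" unfolding A B using dis vs by auto
  have oth: "\<exists>y\<in>d. y \<noteq> u" if "2 \<le> card d" for d :: "'a set" and u
    using that card_mono[of "{u}" d] by fastforce
  show inj1: "inj_on f V1" unfolding f inj_on_def using v1 vs by auto
  have inj2: "inj_on f V2" unfolding f inj_on_def using v1 vs by auto
  obtain a where a: "a \<in> e1" "a \<noteq> v1" using oth[OF E1(2)[OF e1(1)]] by metis
  obtain b where b: "b \<in> e2" "b \<noteq> v2" using oth[OF E2(2)[OF e2(1)]] by metis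
  have aV: "a \<in> V1" "a \<noteq> v2" "a \<noteq> vs" "a \<notin> f ` V2" using a e12 v1 vs dis unfolding B by auto
  have bV: "b \<in> V2" "b \<noteq> v1" "b \<noteq> vs" "b \<notin> f ` V1" using b e12 v1 vs dis unfolding A by auto
  have ab: "a \<in> es" "b \<in> es" using es a b aV bV by auto
  show "hsplit (f ` (V1 \<union> V2)) E (f ` V1) (f ` V2) vs es"
    unfolding hsplit_def
  proof (intro conjI ballI impI)
    show "f ` V1 \<union> f ` V2 = f ` (V1 \<union> V2)" by auto
    show "f ` V1 \<inter> f ` V2 = {vs}" by (rule AB)
    show "es \<in> E" unfolding E by simp
    show "es \<inter> (f ` V1 - {vs}) \<noteq> {}" using ab a aV unfolding A by auto
    show "es \<inter> (f ` V2 - {vs}) \<noteq> {}" using ab b bV unfolding B by auto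
    fix g assume "g \<in> E" "g \<noteq> es"
    then obtain d where "g = f ` d" "d \<in> E1 \<or> d \<in> E2" unfolding E by auto
    then show "g \<subseteq> f ` V1 \<or> g \<subseteq> f ` V2" using E1(1) E2(1) by blast
  qed
  have a1: "insert vs (es \<inter> f ` V1) = f ` e1"
  proof -
    have "f ` e1 = insert vs (e1 - {v1})" unfolding f using e1(2) e12 v1 by auto
    moreover have "insert vs (es \<inter> f ` V1) = insert vs (e1 - {v1})"
      using es e12 v1 dis vs unfolding A by auto
    ultimately show ?thesis by simp
  qed
  have notA: "\<not> f ` d \<subseteq> f ` V1" if d: "d \<in> E2" for d
  proof
    assume "f ` d \<subseteq> f ` V1"
    moreover have "d \<subseteq> V2" using d E2(1) by auto
    ultimately have "f ` d \<subseteq> {vs}" using AB by blast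
    moreover have "card (f ` d) = card d" using inj_on_subset[OF inj2 \<open>d \<subseteq> V2\<close>] by (rule card_image)
    ultimately show False using E2(2)[OF d] card_mono[of "{vs}" "f ` d"] by auto
  qed
  have "inside E (f ` V1) = (image f) ` (E1 - {e1})"
  proof
    show "inside E (f ` V1) \<subseteq> (image f) ` (E1 - {e1})"
    proof
      fix g assume "g \<in> inside E (f ` V1)"
      then have g: "g \<in> E" "g \<subseteq> f ` V1" unfolding inside_def by auto
      have "g \<noteq> es" using g(2) ab(2) bV(4) by auto
      then obtain d where d: "g = f ` d" "d \<in> E1 - {e1} \<or> d \<in> E2" using g(1) unfolding E by auto
      then have "d \<notin> E2" using notA g(2) by auto
      then show "g \<in> (image f) ` (E1 - {e1})" using d by auto
    qed
    show "(image f) ` (E1 - {e1}) \<subseteq> inside E (f ` V1)"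
      unfolding inside_def E using E1(1) by auto
  qed
  then show hp: "hpart E (f ` V1) vs es = (image f) ` E1"
    unfolding hpart_def a1 using e1(1) by auto
  show "insert vs (es \<inter> f ` V1) \<notin> E"
  proof
    assume "insert vs (es \<inter> f ` V1) \<in> E"
    then have "f ` e1 \<in> inside E (f ` V1)" using a1 e12 unfolding inside_def by auto
    then have "f ` e1 \<in> (image f) ` (E1 - {e1})" using \<open>inside E (f ` V1) = _\<close> by simp
    then obtain d where "f ` e1 = f ` d" "d \<in> E1 - {e1}" by (rule imageE)
    then have d: "d \<in> E1" "d \<noteq> e1" "f ` d = f ` e1" by auto
    then show False using inj_on_image_eq_iff[OF inj1, of d e1] E1(1) e12 by auto
  qed
qed

lemma hajos_join_crit:
  assumes k: "k \<ge> 3" and G1: "crit k (fst G1) (snd G1)" "sep_le k (fst G1) (snd G1)"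
    and G2: "crit k (fst G2) (snd G2)" "sep_le k (fst G2) (snd G2)" and j: "hajos_join G1 G2 G"
  shows "crit k (fst G) (snd G) \<and> sep_le k (fst G) (snd G)"
proof -
  obtain V1 E1 V2 E2 where VE: "G1 = (V1, E1)" "G2 = (V2, E2)" by (cases G1, cases G2)
  obtain e1 e2 v1 v2 vs es where dis: "V1 \<inter> V2 = {}" and e: "e1 \<in> E1" "v1 \<in> e1" "e2 \<in> E2" "v2 \<in> e2"
    and vs: "vs \<notin> V1 \<union> V2"
    and es: "es = (e1 \<union> e2) - {v1, v2} \<or> es = ((e1 \<union> e2) - {v1, v2}) \<union> {vs}"
    and G: "G = ((\<lambda>x. if x = v1 \<or> x = v2 then vs else x) ` (V1 \<union> V2),
      (image (\<lambda>x. if x = v1 \<or> x = v2 then vs else x)) ` ((E1 - {e1}) \<union> (E2 - {e2})) \<union> {es})"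
    using j unfolding hajos_join_def VE Let_def fst_conv snd_conv by (elim exE conjE) (rule that)
  define f where "f = (\<lambda>x. if x = v1 \<or> x = v2 then vs else x)"
  define E where "E = (image f) ` ((E1 - {e1}) \<union> (E2 - {e2})) \<union> {es}"
  have G': "fst G = f ` (V1 \<union> V2)" "snd G = E" unfolding G f_def E_def by auto
  have c1: "\<Union>E1 = V1" "\<And>e. e \<in> E1 \<Longrightarrow> 2 \<le> card e" using G1 VE unfolding crit_def by auto
  have c2: "\<Union>E2 = V2" "\<And>e. e \<in> E2 \<Longrightarrow> 2 \<le> card e" using G2 VE unfolding crit_def by auto
  note J1 = hajos_join_hsplit[OF dis e vs es f_def E_def c1 c2]
  have dis': "V2 \<inter> V1 = {}" using dis by auto
  have vs': "vs \<notin> V2 \<union> V1" using vs by auto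
  have es': "es = (e2 \<union> e1) - {v2, v1} \<or> es = ((e2 \<union> e1) - {v2, v1}) \<union> {vs}" using es by blast
  have f': "f = (\<lambda>x. if x = v2 \<or> x = v1 then vs else x)" unfolding f_def by auto
  have E': "E = (image f) ` ((E2 - {e2}) \<union> (E1 - {e1})) \<union> {es}" unfolding E_def by blast
  note J2 = hajos_join_hsplit[OF dis' e(3,4) e(1,2) vs' es' f' E' c2 c1]
  have cA: "crit k (f ` V1) (hpart E (f ` V1) vs es)" and cB: "crit k (f ` V2) (hpart E (f ` V2) vs es)"
    using crit_image[of k V1 E1 f] crit_image[of k V2 E2 f] J1(2,3) J2(2,3) G1 G2 VE by simp_all
  have lA: "sep_le k (f ` V1) (hpart E (f ` V1) vs es)" and lB: "sep_le k (f ` V2) (hpart E (f ` V2) vs es)"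
    using sep_le_image[OF _ _ _ J1(3), of k E1] sep_le_image[OF _ _ _ J2(3), of k E2] J1(2) J2(2) G1 G2 VE
      c1(1) c2(1) crit_finite_edges[OF G1(1)] crit_finite_edges[OF G2(1)] by simp_all
  have finE: "finite E"
    using crit_finite_edges[OF G1(1)] crit_finite_edges[OF G2(1)] VE unfolding E_def by auto
  have esV: "es \<subseteq> f ` (V1 \<union> V2)"
  proof -
    have "e1 \<union> e2 - {v1, v2} \<subseteq> f ` (V1 \<union> V2)"
    proof
      fix x assume "x \<in> e1 \<union> e2 - {v1, v2}"
      then have "f x = x" "x \<in> V1 \<union> V2" using e c1(1) c2(1) unfolding f_def by auto
      then show "x \<in> f ` (V1 \<union> V2)" by (metis imageI)
    qed
    moreover have "vs \<in> f ` (V1 \<union> V2)" using e(1,2) c1(1) unfolding f_def by auto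
    ultimately show ?thesis using es by auto
  qed
  have UE: "\<Union>E \<subseteq> f ` (V1 \<union> V2)"
  proof
    fix x assume "x \<in> \<Union>E"
    then obtain g where g: "g \<in> E" "x \<in> g" by auto
    then consider "g = es" | d where "d \<in> E1 \<union> E2" "g = f ` d" unfolding E_def by auto
    then show "x \<in> f ` (V1 \<union> V2)"
    proof cases
      case 1 then show ?thesis using g esV by auto
    next
      case 2
      then have "d \<subseteq> V1 \<union> V2" using c1(1) c2(1) by auto
      then show ?thesis using 2 g by auto
    qed
  qed
  have "2 \<le> card g" if g: "g \<in> E" for g
  proof (cases "g = es")
    case True
    obtain a where a: "a \<in> es" "a \<in> f ` V1" "a \<noteq> vs" "a \<notin> f ` V2" by (rule hsplit_witness[OF J1(1)])
    obtain b where b: "b \<in> es" "b \<in> f ` V2" "b \<noteq> vs" "b \<notin> f ` V1" by (rule hsplit_witness[OF J2(1)])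
    have "finite es" using esV G1 G2 VE unfolding crit_def by (auto intro: finite_subset)
    then have "card {a, b} \<le> card es" using a b by (intro card_mono) auto
    moreover have "a \<noteq> b" using a b by metis
    ultimately show ?thesis using True by simp
  next
    case False
    then have "g \<in> (image f) ` E1 \<or> g \<in> (image f) ` E2" using g unfolding E_def by auto
    then have "g \<in> hpart E (f ` V1) vs es \<or> g \<in> hpart E (f ` V2) vs es" using J1(2) J2(2) by simp
    then show ?thesis using cA cB unfolding crit_def by auto
  qed
  then have "crit k (f ` (V1 \<union> V2)) E"
    using crit_join[OF _ J1(1) UE _ cA cB J1(4) J2(4)] k by auto
  moreover have "sep_le k (f ` (V1 \<union> V2)) E"
    using join_sep_le[OF finE J1(1) UE lA lB J1(4) J2(4)] .
  ultimately show ?thesis unfolding G' by simp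
qed

lemma hajos_closure_crit:
  assumes k: "k \<ge> 3" and c: "hajos_closure (hajos_base k) G"
  shows "crit k (fst G) (snd G) \<and> sep_le k (fst G) (snd G)"
  using c
proof induction
  case (base G)
  show ?case
  proof (cases "k = 3")
    case True
    then show ?thesis using odd_wheel_crit[of "fst G" "snd G"] base by simp
  next
    case False
    then show ?thesis using complete_hg_crit[of k "fst G" "snd G"] base k by simp
  qed
next
  case (join G1 G2 G)
  then show ?case using hajos_join_crit[OF k] by blast
next
  case (iso G f V')
  then have inj: "inj_on f (fst G)" and V': "V' = f ` fst G" unfolding bij_betw_def by auto
  have "\<Union>(snd G) \<subseteq> fst G" using iso.IH unfolding crit_def by auto
  moreover have "finite (snd G)" using iso.IH crit_finite_edges by blast
  ultimately show ?case using crit_image[OF _ inj] sep_le_image[OF _ _ _ inj] iso.IH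
    unfolding V' by auto
qed

text \<open>To get disjoint factors, \<open>\<rho>\<close> renames \<open>v\<close> in the second
  one to a fresh \<open>v2\<close>. The join merges \<open>v\<close> and \<open>v2\<close> into a
  fresh \<open>vs\<close>, and \<open>\<sigma>\<close> renames \<open>vs\<close> back to
  \<open>v\<close>.\<close>

lemma hajos_closure_split:
  fixes V :: "'a set"
  assumes inf: "infinite (UNIV :: 'a set)" and finV: "finite V" and UE: "\<Union>E = V"
    and sp: "hsplit V E A B v e" and nA: "insert v (e \<inter> A) \<notin> E" and nB: "insert v (e \<inter> B) \<notin> E"
    and cA: "hajos_closure base (A, hpart E A v e)" and cB: "hajos_closure base (B, hpart E B v e)"
  shows "hajos_closure base (V, E)"
proof -
  note D = hsplitD[OF sp]
  obtain v2 where v2: "v2 \<notin> V" using ex_new_if_finite[OF inf finV] by auto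
  obtain vs where vs: "vs \<notin> V" "vs \<noteq> v2"
    using ex_new_if_finite[OF inf, of "insert v2 V"] finV by auto
  have vV: "v \<in> V" and AV: "A \<subseteq> V" and BV: "B \<subseteq> V" using D by auto
  have ne: "v2 \<noteq> v" "vs \<noteq> v" using v2 vs vV by auto
  define \<rho> where "\<rho> u = (if u = v then v2 else u)" for u
  define f where "f = (\<lambda>u. if u = v \<or> u = v2 then vs else u)"
  define \<sigma> where "\<sigma> u = (if u = vs then v else u)" for u
  let ?a = "insert v (e \<inter> A)" and ?b = "insert v (e \<inter> B)"
  have eV: "e \<subseteq> V" using D(5) UE by auto
  have inj: "inj_on \<rho> B" unfolding inj_on_def \<rho>_def using v2 BV by auto
  then have "bij_betw \<rho> (fst (B, hpart E B v e)) (\<rho> ` B)" unfolding bij_betw_def by simp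
  from hajos_closure.iso[OF cB this]
  have cB': "hajos_closure base (\<rho> ` B, (image \<rho>) ` hpart E B v e)" by simp
  have \<rho>B: "\<rho> ` B = insert v2 (B - {v})" unfolding \<rho>_def using D(2) by auto
  have \<rho>b: "\<rho> ` ?b = insert v2 (e \<inter> B - {v})" unfolding \<rho>_def by auto
  \<comment> \<open>The two admissible forms of the new edge correspond to whether \<open>e\<close>
    contains the split vertex.\<close>
  define es where "es = (if v \<in> e then insert vs (e - {v}) else e)"
  define F where "F = (image f) ` ((hpart E A v e - {?a}) \<union> ((image \<rho>) ` hpart E B v e - {\<rho> ` ?b})) \<union> {es}"
  have "hajos_join (A, hpart E A v e) (\<rho> ` B, (image \<rho>) ` hpart E B v e) (f ` (A \<union> \<rho> ` B), F)"
    unfolding hajos_join_def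
  proof (rule exI[of _ ?a], rule exI[of _ "\<rho> ` ?b"], rule exI[of _ v], rule exI[of _ v2],
      rule exI[of _ vs], rule exI[of _ es], intro conjI)
    show "fst (A, hpart E A v e) \<inter> fst (\<rho> ` B, (image \<rho>) ` hpart E B v e) = {}"
      unfolding \<rho>B using D(4) v2 AV by auto
    show "?a \<in> snd (A, hpart E A v e)" "\<rho> ` ?b \<in> snd (\<rho> ` B, (image \<rho>) ` hpart E B v e)"
      unfolding hpart_def by auto
    show "v \<in> ?a" by simp
    show "v2 \<in> \<rho> ` ?b" unfolding \<rho>b by simp
    show "vs \<notin> fst (A, hpart E A v e) \<union> fst (\<rho> ` B, (image \<rho>) ` hpart E B v e)"
      unfolding \<rho>B using vs AV BV by auto
    have "?a \<union> \<rho> ` ?b - {v, v2} = e - {v}" unfolding \<rho>b using eV D(3) v2 by auto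
    then show "es = ?a \<union> \<rho> ` ?b - {v, v2} \<or> es = ?a \<union> \<rho> ` ?b - {v, v2} \<union> {vs}"
      unfolding es_def by auto
    show "let g = \<lambda>x. if x = v \<or> x = v2 then vs else x in
      (f ` (A \<union> \<rho> ` B), F) = (g ` (fst (A, hpart E A v e) \<union> fst (\<rho> ` B, (image \<rho>) ` hpart E B v e)),
       (image g) ` ((snd (A, hpart E A v e) - {?a}) \<union> (snd (\<rho> ` B, (image \<rho>) ` hpart E B v e) - {\<rho> ` ?b})) \<union> {es})"
      unfolding F_def f_def Let_def by simp
  qed
  with cA cB' have cF: "hajos_closure base (f ` (A \<union> \<rho> ` B), F)" by (rule hajos_closure.join)
  have fV: "f ` (A \<union> \<rho> ` B) = insert vs (V - {v})"
    unfolding \<rho>B f_def using D(1-3) v2 by auto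
  have "inj_on \<sigma> (f ` (A \<union> \<rho> ` B))" unfolding fV inj_on_def \<sigma>_def by auto
  moreover have "\<sigma> ` f ` (A \<union> \<rho> ` B) = V" unfolding fV \<sigma>_def using vV vs by auto
  ultimately have bij: "bij_betw \<sigma> (fst (f ` (A \<union> \<rho> ` B), F)) V" unfolding bij_betw_def by simp
  have closed: "hajos_closure base (V, (image \<sigma>) ` F)" using hajos_closure.iso[OF cF bij] by simp
  have hA: "hpart E A v e - {?a} = inside E A" using nA unfolding hpart_def inside_def by auto
  have hB: "(image \<rho>) ` hpart E B v e - {\<rho> ` ?b} = (image \<rho>) ` inside E B"
  proof -
    have "inj_on (image \<rho>) (hpart E B v e)"
      by (rule inj_on_image, rule inj_on_subset[OF inj]) (use D(2) in \<open>auto simp: hpart_def inside_def\<close>)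
    moreover have "{?b} \<subseteq> hpart E B v e" unfolding hpart_def by simp
    ultimately have "(image \<rho>) ` (hpart E B v e - {?b}) = (image \<rho>) ` hpart E B v e - (image \<rho>) ` {?b}"
      by (intro inj_on_image_set_diff) auto
    then have "(image \<rho>) ` (hpart E B v e - {?b}) = (image \<rho>) ` hpart E B v e - {\<rho> ` ?b}" by simp
    moreover have "hpart E B v e - {?b} = inside E B" using nB unfolding hpart_def inside_def by auto
    ultimately show ?thesis by simp
  qed
  have idA: "\<sigma> (f u) = u" if "u \<in> V" for u using that v2 vs unfolding \<sigma>_def f_def by auto
  have idB: "\<sigma> (f (\<rho> u)) = u" if "u \<in> V" for u using that v2 vs unfolding \<sigma>_def f_def \<rho>_def by auto
  have sA: "\<sigma> ` f ` g = g" if "g \<in> E" for g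
  proof -
    have "(\<lambda>u. \<sigma> (f u)) ` g = id ` g" using that UE idA by (intro image_cong) auto
    then show ?thesis by (simp add: image_image)
  qed
  have sB: "\<sigma> ` f ` \<rho> ` g = g" if "g \<in> E" for g
  proof -
    have "(\<lambda>u. \<sigma> (f (\<rho> u))) ` g = id ` g" using that UE idB by (intro image_cong) auto
    then show ?thesis by (simp add: image_image)
  qed
  have se: "\<sigma> ` es = e"
  proof -
    have "\<sigma> u = u" if "u \<in> e" for u using that eV vs unfolding \<sigma>_def by auto
    then have "\<sigma> ` (e - {v}) = e - {v}" "\<sigma> ` e = e" by (auto intro: image_eqI[OF sym])
    moreover have "\<sigma> vs = v" unfolding \<sigma>_def by simp
    ultimately show ?thesis unfolding es_def by auto
  qed
  have "(image \<sigma>) ` F = (\<lambda>g. \<sigma> ` f ` g) ` inside E A \<union> (\<lambda>g. \<sigma> ` f ` \<rho> ` g) ` inside E B \<union> {\<sigma> ` es}"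
    unfolding F_def hA hB by (simp add: image_Un image_image)
  also have "\<dots> = inside E A \<union> inside E B \<union> {e}"
    using sA sB unfolding se inside_def by (auto simp: image_iff)
  also have "\<dots> = E" using D(5,6) unfolding inside_def by blast
  finally show ?thesis using closed by simp
qed

lemma crit_hajos_closure:
  fixes V :: "'a set"
  assumes k: "k \<ge> 3" and inf: "infinite (UNIV :: 'a set)"
  shows "crit k V E \<Longrightarrow> sep_le k V E \<Longrightarrow> hajos_closure (hajos_base k) (V, E)"
proof (induction "card V" arbitrary: V E rule: less_induct)
  case less
  note cr = less.prems(1) and le = less.prems(2)
  have finV: "finite V" and UE: "\<Union>E = V" using cr unfolding crit_def by auto
  have part: "hajos_closure (hajos_base k) (A, hpart E A v e)" if sp: "hsplit V E A B v e" for A B v e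
  proof (rule less.hyps)
    obtain z where "z \<in> B" "z \<notin> A" using hsplit_witness[OF hsplit_commute[OF sp]] by metis
    then show "card A < card V" using finV hsplitD(3)[OF sp] by (intro psubset_card_mono) auto
    show "crit k A (hpart E A v e)" by (rule hsplit_crit[OF cr k sp])
    show "sep_le k A (hpart E A v e)" by (rule hsplit_sep_le[OF cr k sp le])
  qed
  show ?case
  proof (cases "hajos_base k (V, E)")
    case True
    then show ?thesis by (rule hajos_closure.base)
  next
    case False
    then obtain A B v e where sp: "hsplit V E A B v e"
      using critical_base_or_split[OF k cr le] by blast
    note sp' = hsplit_commute[OF sp]
    show ?thesis
      by (rule hajos_closure_split[OF inf finV UE sp hsplit_edge_notin[OF cr k sp]
            hsplit_edge_notin[OF cr k sp'] part[OF sp] part[OF sp']])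
  qed
qed

subsection \<open>Menger's theorem\<close>

abbreviation linked :: "('v \<times> 'v) set \<Rightarrow> 'v list \<Rightarrow> bool" where
  "linked R \<equiv> successively (\<lambda>x y. (x, y) \<in> R)"

definition walk_between :: "('v \<times> 'v) set \<Rightarrow> 'v set \<Rightarrow> 'v set \<Rightarrow> 'v list \<Rightarrow> bool" where
  "walk_between R A B xs \<longleftrightarrow> xs \<noteq> [] \<and> linked R xs \<and> hd xs \<in> A \<and> last xs \<in> B"

definition separates :: "('v \<times> 'v) set \<Rightarrow> 'v set \<Rightarrow> 'v set \<Rightarrow> 'v set \<Rightarrow> bool" where
  "separates R A B S \<longleftrightarrow> (\<forall>xs. walk_between R A B xs \<longrightarrow> set xs \<inter> S \<noteq> {})"

text \<open>An indexed family rather than a set of walks, so that it can be reindexed by the end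
  vertices of its walks.\<close>

definition linkage :: "('v \<times> 'v) set \<Rightarrow> 'v set \<Rightarrow> 'v set \<Rightarrow> 'v set \<Rightarrow> ('v \<Rightarrow> 'v list) \<Rightarrow> bool" where
  "linkage R A B I p \<longleftrightarrow> (\<forall>s\<in>I. walk_between R A B (p s) \<and> distinct (p s))
     \<and> (\<forall>s\<in>I. \<forall>t\<in>I. s \<noteq> t \<longrightarrow> set (p s) \<inter> set (p t) = {})"

lemma linked_mono: "linked R xs \<Longrightarrow> R \<subseteq> R' \<Longrightarrow> linked R' xs"
  by (erule successively_mono) auto

lemma linked_insert_avoid_fst:
  "linked (insert (x, y) R) (us @ [z]) \<Longrightarrow> x \<notin> set us \<Longrightarrow> linked R (us @ [z])"
proof (induction us)
  case (Cons u us)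
  then show ?case by (cases us) auto
qed simp

lemma linked_insert_avoid_snd:
  "linked (insert (x, y) R) (z # vs) \<Longrightarrow> y \<notin> set vs \<Longrightarrow> linked R (z # vs)"
  by (induction vs arbitrary: z) auto

lemma linkage_reindex:
  assumes l: "linkage R A B I p" and inj: "inj_on g I"
  obtains q where "linkage R A B (g ` I) q" "\<And>s. s \<in> I \<Longrightarrow> q (g s) = p s"
proof
  let ?q = "\<lambda>t. p (inv_into I g t)"
  show q: "?q (g s) = p s" if "s \<in> I" for s using that inj by simp
  show "linkage R A B (g ` I) ?q"
    unfolding linkage_def using l inj q unfolding linkage_def by (auto simp: inj_on_eq_iff)
qed

lemma set_tl_subset: "set (tl xs) \<subseteq> set xs"
  by (cases xs) auto

text \<open>Goering's proof: if deleting the arc \<open>(x, y)\<close> creates a small separator \<open>S\<close>, link \<open>A\<close> to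
  \<open>insert x S\<close> and \<open>insert y S\<close> to \<open>B\<close>, and splice.\<close>

lemma linkage_splice:
  assumes finS: "finite S" and xy: "x \<notin> S" "y \<notin> S" and sep: "separates R A B S"
    and p: "linkage R A (insert x S) (insert x S) p" "\<And>s. s \<in> insert x S \<Longrightarrow> last (p s) = s"
    and q: "linkage R (insert y S) B (insert y S) q" "\<And>s. s \<in> insert y S \<Longrightarrow> hd (q s) = s"
  shows "\<exists>r. linkage (insert (x, y) R) A B (insert x S) r"
proof -
  have pw: "p s \<noteq> []" "linked R (p s)" "hd (p s) \<in> A" "distinct (p s)" if "s \<in> insert x S" for s
    using p(1) that unfolding linkage_def walk_between_def by auto
  have qw: "q s \<noteq> []" "linked R (q s)" "last (q s) \<in> B" "distinct (q s)" if "s \<in> insert y S" for s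
    using q(1) that unfolding linkage_def walk_between_def by auto
  have pS: "t = s" if "s \<in> insert x S" "t \<in> insert x S" "t \<in> set (p s)" for s t
  proof (rule ccontr)
    assume "t \<noteq> s"
    then have "set (p s) \<inter> set (p t) = {}" using p(1) that unfolding linkage_def by metis
    moreover have "t \<in> set (p t)" using pw(1)[OF that(2)] p(2)[OF that(2)] by (metis last_in_set)
    ultimately show False using that(3) by auto
  qed
  have qS: "t = s" if "s \<in> insert y S" "t \<in> insert y S" "t \<in> set (q s)" for s t
  proof (rule ccontr)
    assume "t \<noteq> s"
    then have "set (q s) \<inter> set (q t) = {}" using q(1) that unfolding linkage_def by metis
    moreover have "t \<in> set (q t)" using qw(1)[OF that(2)] q(2)[OF that(2)] by (metis hd_in_set)
    ultimately show False using that(3) by auto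
  qed
  \<comment> \<open>A common vertex \<open>z\<close> outside \<open>S\<close> would allow passing
    from \<open>p s\<close> to \<open>q t\<close> at \<open>z\<close>. The resulting walk avoids
    \<open>S\<close>, because \<open>p s\<close> meets \<open>S\<close> at most at its end and
    \<open>q t\<close> at most at its start.\<close>
  have key: "z \<in> S \<and> s = z \<and> t = z"
    if st: "s \<in> insert x S" "t \<in> insert y S" and z: "z \<in> set (p s)" "z \<in> set (q t)" for s t z
  proof -
    have "z \<in> S"
    proof (rule ccontr)
      assume zS: "z \<notin> S"
      obtain us vs where ps: "p s = us @ z # vs" using z(1) by (meson split_list)
      obtain us' vs' where qt: "q t = us' @ z # vs'" using z(2) by (meson split_list)
      have "linked R (us @ [z])" "linked R (z # vs')"
        using pw(2)[OF st(1)] qw(2)[OF st(2)] unfolding ps qt by (auto simp: successively_append_iff)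
      then have "linked R (us @ z # vs')" by (auto simp: successively_append_iff)
      moreover have "hd (us @ z # vs') \<in> A" using pw(3)[OF st(1)] unfolding ps by (cases us) auto
      moreover have "last (us @ z # vs') \<in> B" using qw(3)[OF st(2)] unfolding qt by simp
      ultimately have "walk_between R A B (us @ z # vs')" unfolding walk_between_def by auto
      then have "set (us @ z # vs') \<inter> S \<noteq> {}" using sep unfolding separates_def by metis
      then obtain w where w: "w \<in> S" "w \<in> set us \<or> w \<in> set vs'" using zS by auto
      from w(2) show False
      proof
        assume a: "w \<in> set us"
        then have "w = s" using pS[OF st(1), of w] w(1) unfolding ps by auto
        then have "w = last (z # vs)" using p(2)[OF st(1)] unfolding ps by auto
        then have "w \<in> set (z # vs)" by (metis last_in_set list.discI)
        then show False using a pw(4)[OF st(1)] unfolding ps by auto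
      next
        assume a: "w \<in> set vs'"
        then have "w = t" using qS[OF st(2), of w] w(1) unfolding qt by auto
        then have "w = hd (us' @ [z])" using q(2)[OF st(2)] unfolding qt by (cases us') auto
        then have "w \<in> set (us' @ [z])" by (metis hd_in_set snoc_eq_iff_butlast)
        then show False using a qw(4)[OF st(2)] unfolding qt by auto
      qed
    qed
    then show ?thesis using pS[OF st(1), of z] qS[OF st(2), of z] z by auto
  qed
  \<comment> \<open>For \<open>s\<close> in \<open>S\<close> the vertex \<open>s\<close> ends
    \<open>p s\<close> and starts \<open>q s\<close>, so it is dropped once; the walk ending in
    \<open>x\<close> continues over the arc to the whole of \<open>q y\<close>.\<close>
  define c where "c s = (if s = x then q y else tl (q s))" for s
  define r where "r s = p s @ c s" for s
  define i where "i s = (if s = x then y else s)" for s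
  have i: "i s \<in> insert y S" if "s \<in> insert x S" for s using that unfolding i_def by auto
  have cset: "set (c s) \<subseteq> set (q (i s))" for s
    unfolding c_def i_def by (auto dest: subsetD[OF set_tl_subset])
  have inji: "i s \<noteq> i t" if "s \<in> insert x S" "t \<in> insert x S" "s \<noteq> t" for s t
    using that xy unfolding i_def by auto
  have pc: "s = t \<and> s \<in> S" if "s \<in> insert x S" "t \<in> insert x S" "z \<in> set (p s)" "z \<in> set (c t)" for s t z
  proof -
    have "z \<in> S \<and> s = z \<and> i t = z" using key[OF that(1) i[OF that(2)] that(3)] that(4) cset by auto
    then show ?thesis using that(2) xy unfolding i_def by (auto split: if_splits)
  qed
  have self: "set (p s) \<inter> set (c s) = {}" if s: "s \<in> insert x S" for s
  proof (rule ccontr)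
    assume "set (p s) \<inter> set (c s) \<noteq> {}"
    then obtain z where z: "z \<in> set (p s)" "z \<in> set (c s)" by auto
    then have "s \<in> S" using pc[OF s s] by auto
    then have "s \<noteq> x" using xy by auto
    then have "z \<in> set (tl (q s))" "i s = s" using z(2) unfolding c_def i_def by auto
    moreover have "z = s" using key[OF s _ z(1), of s] \<open>s \<in> S\<close> subsetD[OF set_tl_subset calculation(1)] by auto
    moreover have "q s = s # tl (q s)" using qw(1)[of s] q(2)[of s] \<open>s \<in> S\<close> by (metis insertI2 list.collapse)
    ultimately show False using qw(4)[of s] \<open>s \<in> S\<close> by (metis distinct.simps(2) insertI2)
  qed
  have "walk_between (insert (x, y) R) A B (r s) \<and> distinct (r s)" if s: "s \<in> insert x S" for s
  proof (cases "s = x")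
    case True
    have "linked R (p x)" "linked R (q y)" using pw(2) qw(2) by auto
    then have "linked (insert (x, y) R) (p x)" "linked (insert (x, y) R) (q y)"
      using linked_mono[OF _ subset_insertI] by metis+
    moreover have "p x \<noteq> []" "q y \<noteq> []" using pw(1) qw(1) by auto
    ultimately have "linked (insert (x, y) R) (p x @ q y)"
      using p(2)[of x] q(2)[of y] by (simp add: successively_append_iff)
    then show ?thesis using True pw[of x] qw[of y] self[of x]
      unfolding r_def c_def walk_between_def by auto
  next
    case False
    then have sS: "s \<in> S" using s by auto
    then have qs: "q s = s # tl (q s)" using qw(1)[of s] q(2)[of s] by (metis insertI2 list.collapse)
    have "linked R (s # tl (q s))" using qw(2)[of s] qs sS by simp
    then have "linked R (tl (q s))" "tl (q s) = [] \<or> (s, hd (tl (q s))) \<in> R"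
      by (cases "tl (q s)"; simp)+
    then have "linked R (r s)" using pw(2)[OF s] p(2)[OF s] False
      unfolding r_def c_def by (auto simp: successively_append_iff)
    then have "linked (insert (x, y) R) (r s)" by (rule linked_mono) auto
    moreover have "last (r s) \<in> B"
    proof (cases "tl (q s) = []")
      case True
      then show ?thesis using qs qw(3)[of s] p(2)[OF s] sS False unfolding r_def c_def
        by (metis append_Nil2 insertI2 last_ConsL)
    next
      case tl: False
      then have "last (r s) = last (tl (q s))" using False unfolding r_def c_def by simp
      also have "\<dots> = last (q s)" using qs tl by (metis last_ConsR)
      finally show ?thesis using qw(3)[of s] sS by simp
    qed
    moreover have "distinct (r s)" using pw(4)[OF s] self[OF s] qw(4)[of s] sS False
      unfolding r_def c_def by (auto simp: distinct_tl)
    ultimately show ?thesis using pw(1,3)[OF s] unfolding walk_between_def r_def by auto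
  qed
  moreover have "set (r s) \<inter> set (r t) = {}" if st: "s \<in> insert x S" "t \<in> insert x S" "s \<noteq> t" for s t
  proof -
    have "set (p s) \<inter> set (p t) = {}" using p(1) st unfolding linkage_def by metis
    moreover have "set (q (i s)) \<inter> set (q (i t)) = {}"
      using q(1) i[OF st(1)] i[OF st(2)] inji[OF st] unfolding linkage_def by metis
    moreover have "set (p s) \<inter> set (c t) = {}" "set (p t) \<inter> set (c s) = {}" using pc st by blast+
    ultimately show ?thesis using cset[of s] cset[of t] unfolding r_def by auto
  qed
  ultimately show ?thesis unfolding linkage_def by blast
qed

lemma menger:
  assumes "finite R" "finite A"
    and "\<And>S. finite S \<Longrightarrow> separates R A B S \<Longrightarrow> m \<le> card S"
  shows "\<exists>I p. finite I \<and> card I = m \<and> linkage R A B I p"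
  using assms
proof (induction arbitrary: A B m rule: finite_induct)
  case empty
  \<comment> \<open>Without arcs, every walk is a single vertex.\<close>
  have "separates {} A B (A \<inter> B)"
    unfolding separates_def walk_between_def
  proof (intro allI impI)
    fix xs assume xs: "xs \<noteq> [] \<and> linked {} xs \<and> hd xs \<in> A \<and> last xs \<in> B"
    then obtain x where "xs = [x]" by (cases xs; cases "tl xs") auto
    then show "set xs \<inter> (A \<inter> B) \<noteq> {}" using xs by auto
  qed
  then have "m \<le> card (A \<inter> B)" using empty by auto
  then obtain I where I: "I \<subseteq> A \<inter> B" "card I = m" by (metis obtain_subset_with_card_n)
  then have "linkage {} A B I (\<lambda>s. [s])" unfolding linkage_def walk_between_def by auto
  moreover have "finite I" using I(1) empty(1) by (meson finite_Int finite_subset)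
  ultimately show ?case using I(2) by auto
next
  case (insert e R)
  obtain x y where e: "e = (x, y)" by (cases e)
  show ?case
  proof (cases "\<forall>S. finite S \<longrightarrow> separates R A B S \<longrightarrow> m \<le> card S")
    case True
    then obtain I p where I: "finite I" "card I = m" "linkage R A B I p"
      using insert.IH[OF insert.prems(1), of B m] by auto
    have "linkage (insert e R) A B I p"
      using I(3) linked_mono[of R _ "insert e R"] unfolding linkage_def walk_between_def by auto
    then show ?thesis using I by auto
  next
    case False
    then obtain S where S: "finite S" "separates R A B S" "card S < m" by auto
    have notin: "linked R xs" if "linked (insert e R) xs" "x \<notin> set xs \<or> y \<notin> set xs" for xs
    proof (cases xs rule: rev_cases)
      case (snoc us z)
      show ?thesis
      proof (cases "x \<in> set xs")
        case False
        then show ?thesis using linked_insert_avoid_fst[of x y R us z] that snoc e by auto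
      next
        case True
        then show ?thesis using linked_insert_avoid_snd[of x y R "hd xs" "tl xs"] that snoc e
          by (metis list.collapse list.set_sel(2) snoc_eq_iff_butlast)
      qed
    qed simp
    \<comment> \<open>A walk using the arc visits both \<open>x\<close> and \<open>y\<close>, so
      adding either of them to \<open>S\<close> gives a separator again.\<close>
    have sepz: "separates (insert e R) A B (insert z S)" if z: "z = x \<or> z = y" for z
      unfolding separates_def
    proof (intro allI impI, rule ccontr)
      fix xs assume xs: "walk_between (insert e R) A B xs" and em: "\<not> set xs \<inter> insert z S \<noteq> {}"
      then have "linked R xs" using notin[of xs] z unfolding walk_between_def by auto
      then have "walk_between R A B xs" using xs unfolding walk_between_def by auto
      then show False using S(2) em unfolding separates_def by auto
    qed
    \<comment> \<open>\<open>S\<close> has fewer than \<open>m\<close> elements and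
      \<open>insert z S\<close> does not, so \<open>S\<close> has exactly
      \<open>m - 1\<close>.\<close>
    have cz: "z \<notin> S \<and> card (insert z S) = m" if z: "z = x \<or> z = y" for z
    proof -
      have "m \<le> card (insert z S)" using insert.prems(2)[OF _ sepz[OF z]] S(1) by auto
      then show ?thesis using S by (auto simp: card_insert_if split: if_splits)
    qed
    \<comment> \<open>Every walk meets \<open>insert x S\<close>. Up to the first such vertex it has
      not yet left \<open>x\<close>, so this part is a walk in \<open>R\<close> and meets
      \<open>T\<close>.\<close>
    have "m \<le> card T" if T: "finite T" "separates R A (insert x S) T" for T
    proof (rule insert.prems(2)[OF T(1)])
      show "separates (insert e R) A B T"
        unfolding separates_def
      proof (intro allI impI)
        fix xs assume xs: "walk_between (insert e R) A B xs"
        then have "\<exists>z\<in>set xs. z \<in> insert x S" using sepz[of x] unfolding separates_def by blast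
        then obtain us z vs where s: "xs = us @ z # vs" "z \<in> insert x S" "\<forall>u\<in>set us. u \<notin> insert x S"
          using split_list_first_prop[of xs "\<lambda>z. z \<in> insert x S"] by blast
        have "linked (insert e R) (us @ [z])" using xs s(1) unfolding walk_between_def
          by (auto simp: successively_append_iff)
        then have "linked R (us @ [z])" using linked_insert_avoid_fst[of x y R us z] s(3) e by auto
        moreover have "hd (us @ [z]) \<in> A" using xs s(1) unfolding walk_between_def by (cases us) auto
        ultimately have "walk_between R A (insert x S) (us @ [z])" using s(2) unfolding walk_between_def by auto
        then have "set (us @ [z]) \<inter> T \<noteq> {}" using T(2) unfolding separates_def by metis
        then show "set xs \<inter> T \<noteq> {}" using s(1) by auto
      qed
    qed
    then obtain I p where I: "finite I" "card I = m" "linkage R A (insert x S) I p"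
      using insert.IH[OF insert.prems(1), of "insert x S" m] by auto
    have "m \<le> card T" if T: "finite T" "separates R (insert y S) B T" for T
    proof (rule insert.prems(2)[OF T(1)])
      show "separates (insert e R) A B T"
        unfolding separates_def
      proof (intro allI impI)
        fix xs assume xs: "walk_between (insert e R) A B xs"
        then have "\<exists>z\<in>set xs. z \<in> insert y S" using sepz[of y] unfolding separates_def by blast
        then obtain us z vs where s: "xs = us @ z # vs" "z \<in> insert y S" "\<forall>u\<in>set vs. u \<notin> insert y S"
          using split_list_last_prop[of xs "\<lambda>z. z \<in> insert y S"] by blast
        have "linked (insert e R) (z # vs)" using xs s(1) unfolding walk_between_def
          by (auto simp: successively_append_iff)
        then have "linked R (z # vs)" using linked_insert_avoid_snd[of x y R z vs] s(3) e by auto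
        moreover have "last (z # vs) \<in> B" using xs s(1) unfolding walk_between_def by auto
        ultimately have "walk_between R (insert y S) B (z # vs)" using s(2) unfolding walk_between_def by auto
        then have "set (z # vs) \<inter> T \<noteq> {}" using T(2) unfolding separates_def by metis
        then show "set xs \<inter> T \<noteq> {}" using s(1) by auto
      qed
    qed
    then obtain J q where J: "finite J" "card J = m" "linkage R (insert y S) B J q"
      using insert.IH[of "insert y S" B m] S(1) by auto
    have lastp: "last (p s) \<in> insert x S" "last (p s) \<in> set (p s)" if "s \<in> I" for s
      using I(3) that unfolding linkage_def walk_between_def by auto
    have injp: "inj_on (\<lambda>s. last (p s)) I"
      using I(3) lastp(2) unfolding linkage_def inj_on_def by (metis disjoint_iff)
    \<comment> \<open>The \<open>m\<close> disjoint walks have distinct ends in a set of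
      \<open>m\<close> vertices, so they can be indexed by these ends.\<close>
    then have imgp: "(\<lambda>s. last (p s)) ` I = insert x S"
      using lastp(1) I(2) cz[of x] S(1) by (intro card_subset_eq) (auto simp: card_image)
    obtain p' where p': "linkage R A (insert x S) (insert x S) p'" "\<And>s. s \<in> I \<Longrightarrow> p' (last (p s)) = p s"
      using linkage_reindex[OF I(3) injp] imgp by metis
    have hdq: "hd (q s) \<in> insert y S" "hd (q s) \<in> set (q s)" if "s \<in> J" for s
      using J(3) that unfolding linkage_def walk_between_def by auto
    have injq: "inj_on (\<lambda>s. hd (q s)) J"
      using J(3) hdq(2) unfolding linkage_def inj_on_def by (metis disjoint_iff)
    then have imgq: "(\<lambda>s. hd (q s)) ` J = insert y S"
      using hdq(1) J(2) cz[of y] S(1) by (intro card_subset_eq) (auto simp: card_image)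
    obtain q' where q': "linkage R (insert y S) B (insert y S) q'" "\<And>s. s \<in> J \<Longrightarrow> q' (hd (q s)) = q s"
      using linkage_reindex[OF J(3) injq] imgq by metis
    have "last (p' s) = s" if "s \<in> insert x S" for s
    proof -
      have "s \<in> (\<lambda>s. last (p s)) ` I" using that imgp by simp
      then show ?thesis using p'(2) by auto
    qed
    moreover have "hd (q' s) = s" if "s \<in> insert y S" for s
    proof -
      have "s \<in> (\<lambda>s. hd (q s)) ` J" using that imgq by simp
      then show ?thesis using q'(2) by auto
    qed
    ultimately obtain r where "linkage (insert (x, y) R) A B (insert x S) r"
      using linkage_splice[OF S(1) _ _ S(2) p'(1) _ q'(1)] cz by metis
    then show ?thesis using cz[of x] S(1) e by blast
  qed
qed

subsection \<open>Hyperpaths and edge cuts\<close>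

lemma hyperpath_crosses:
  assumes p: "hyperpath (V, E) v w p" and Z: "(v \<in> Z) \<noteq> (w \<in> Z)"
  shows "\<exists>e\<in>set (snd p). e \<in> bd E Z"
proof (rule ccontr)
  assume no: "\<not> ?thesis"
  obtain vs es where pp: "p = (vs, es)" by (cases p)
  have h: "vs \<noteq> []" "length es + 1 = length vs" "set es \<subseteq> E" "hd vs = v" "last vs = w"
    "\<And>i. i < length es \<Longrightarrow> vs ! i \<in> es ! i \<and> vs ! Suc i \<in> es ! i"
    using p unfolding pp hyperpath_def by (auto simp: Let_def)
  have step: "vs ! Suc i \<in> Z \<longleftrightarrow> vs ! i \<in> Z" if i: "i < length es" for i
  proof -
    have "es ! i \<notin> bd E Z" "es ! i \<in> E" using no i h(3) unfolding pp by auto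
    then show ?thesis using h(6)[OF i] unfolding bd_def by auto
  qed
  have "vs ! i \<in> Z \<longleftrightarrow> v \<in> Z" if "i \<le> length es" for i
    using that step h(1,4) by (induction i) (auto simp: hd_conv_nth)
  moreover have "w = vs ! length es" using h(1,2,5) last_conv_nth[of vs] by (metis add_diff_cancel_right')
  ultimately show False using Z by auto
qed

definition edge_disjoint_paths :: "'a hgraph \<Rightarrow> 'a \<Rightarrow> 'a \<Rightarrow> ('a list \<times> 'a set list) set \<Rightarrow> bool" where
  "edge_disjoint_paths G v w P \<longleftrightarrow> (\<forall>p\<in>P. hyperpath G v w p)
     \<and> (\<forall>p\<in>P. \<forall>q\<in>P. p \<noteq> q \<longrightarrow> set (snd p) \<inter> set (snd q) = {})"

lemma local_lambda_alt: "local_lambda G v w = Max {card P | P. edge_disjoint_paths G v w P}"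
  unfolding local_lambda_def edge_disjoint_paths_def ..

lemma edge_disjoint_paths_card:
  assumes P: "edge_disjoint_paths (V, E) v w P" and finE: "finite E" and Z: "(v \<in> Z) \<noteq> (w \<in> Z)"
  shows "card P \<le> card (bd E Z)"
proof -
  have "\<exists>c. \<forall>p\<in>P. c p \<in> set (snd p) \<and> c p \<in> bd E Z"
    using P hyperpath_crosses[OF _ Z] unfolding edge_disjoint_paths_def by metis
  then obtain c where c: "\<And>p. p \<in> P \<Longrightarrow> c p \<in> set (snd p) \<and> c p \<in> bd E Z" by metis
  then have "inj_on c P" using P unfolding edge_disjoint_paths_def inj_on_def by (metis disjoint_iff)
  moreover have "c ` P \<subseteq> bd E Z" using c by auto
  moreover have "finite (bd E Z)" using finE unfolding bd_def by auto
  ultimately show ?thesis by (rule card_inj_on_le)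
qed

text \<open>Makes the \<open>Max\<close> in \<open>local_lambda\<close> meaningful: the edges at
  \<open>v\<close> bound the number of paths.\<close>

lemma finite_path_cards:
  assumes "finite E" "v \<noteq> w"
  shows "finite {card P | P. edge_disjoint_paths (V, E) v w P}"
proof -
  have "{card P | P. edge_disjoint_paths (V, E) v w P} \<subseteq> {..card (bd E {v})}"
    using edge_disjoint_paths_card[OF _ assms(1), of V v w _ "{v}"] assms(2) by auto
  then show ?thesis by (rule finite_subset) simp
qed

lemma hyperpath_extend:
  assumes p: "hyperpath (V, E) v u (vs, es)" and i: "i \<le> length es" "vs ! i \<in> e"
    and e: "e \<in> E" "e \<notin> set (take i es)" and u': "u' \<in> e" "u' \<in> V" "u' \<notin> set vs"
  shows "hyperpath (V, E) v u' (take (Suc i) vs @ [u'], take i es @ [e])"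
proof -
  have h: "vs \<noteq> []" "length es + 1 = length vs" "distinct vs" "distinct es" "set vs \<subseteq> V" "set es \<subseteq> E" "hd vs = v"
    "\<And>i. i < length es \<Longrightarrow> vs ! i \<in> es ! i \<and> vs ! Suc i \<in> es ! i"
    using p unfolding hyperpath_def by (auto simp: Let_def)
  let ?vs = "take (Suc i) vs @ [u']" and ?es = "take i es @ [e]"
  have len: "length (take (Suc i) vs) = Suc i" "length (take i es) = i" using i(1) h(2) by auto
  have "?vs ! j \<in> ?es ! j \<and> ?vs ! Suc j \<in> ?es ! j" if j: "j < length ?es" for j
  proof (cases "j = i")
    case True
    then show ?thesis using len i(2) u'(1) by (simp add: nth_append)
  next
    case False
    then have "j < i" using j len by simp
    then show ?thesis using len h(8)[of j] i(1) by (simp add: nth_append)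
  qed
  moreover have "hd ?vs = v" using h(1,7) by (cases vs) auto
  moreover have "distinct ?vs" using h(3) u'(3) by (auto dest: in_set_takeD)
  moreover have "set (take (Suc i) vs) \<subseteq> V" "set (take i es) \<subseteq> E" using h(5,6) by (auto dest: in_set_takeD)
  ultimately show ?thesis using h(4) e u'(2) len unfolding hyperpath_def by (simp add: Let_def)
qed

lemma hyperpath_prefix:
  assumes p: "hyperpath (V, E) v u (vs, es)" and j: "j < length vs"
  shows "hyperpath (V, E) v (vs ! j) (take (Suc j) vs, take j es)"
proof -
  have h: "vs \<noteq> []" "length es + 1 = length vs" "distinct vs" "distinct es" "set vs \<subseteq> V" "set es \<subseteq> E" "hd vs = v"
    "\<And>i. i < length es \<Longrightarrow> vs ! i \<in> es ! i \<and> vs ! Suc i \<in> es ! i"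
    using p unfolding hyperpath_def by (auto simp: Let_def)
  have len: "length (take (Suc j) vs) = Suc j" "length (take j es) = j" using j h(2) by auto
  have "last (take (Suc j) vs) = vs ! j" using j by (simp add: take_Suc_conv_app_nth)
  moreover have "hd (take (Suc j) vs) = v" using h(1,7) by (cases vs) auto
  moreover have "set (take (Suc j) vs) \<subseteq> V" "set (take j es) \<subseteq> E" using h(5,6) by (auto dest: in_set_takeD)
  moreover have "take (Suc j) vs \<noteq> []" using h(1) by simp
  ultimately show ?thesis using h(2-4,8) len j unfolding hyperpath_def by (simp add: Let_def)
qed

text \<open>The vertices reachable from \<open>v\<close> by hyperpaths with edges in
  \<open>P\<close> form a set that no edge of \<open>P\<close> leaves, so \<open>w\<close> is among
  them.\<close>

lemma crossing_set_hyperpath: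
  assumes P: "P \<subseteq> E" "\<And>X. v \<in> X \<Longrightarrow> w \<notin> X \<Longrightarrow> \<exists>e\<in>P. e \<inter> X \<noteq> {} \<and> e - X \<noteq> {}"
    and V: "\<Union>E \<subseteq> V" "v \<in> V"
  shows "\<exists>p. hyperpath (V, E) v w p \<and> set (snd p) \<subseteq> P"
proof -
  let ?X = "{u. \<exists>p. hyperpath (V, E) v u p \<and> set (snd p) \<subseteq> P}"
  have "hyperpath (V, E) v v ([v], [])" using V(2) unfolding hyperpath_def by (simp add: Let_def)
  then have vX: "v \<in> ?X" by force
  have "w \<in> ?X"
  proof (rule ccontr)
    assume "w \<notin> ?X"
    then obtain e where e: "e \<in> P" "e \<inter> ?X \<noteq> {}" "e - ?X \<noteq> {}" using P(2)[OF vX] by blast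
    then obtain u u' where u: "u \<in> e" "u \<in> ?X" and u': "u' \<in> e" "u' \<notin> ?X" by blast
    obtain vs es where p: "hyperpath (V, E) v u (vs, es)" "set es \<subseteq> P" using u(2) by auto
    have len: "length es + 1 = length vs" and di: "distinct es" and la: "last vs = u" and ne: "vs \<noteq> []"
      using p(1) unfolding hyperpath_def by (auto simp: Let_def)
    have pre: "vs ! i \<in> es ! i" if "i < length es" for i
      using p(1) that unfolding hyperpath_def by (auto simp: Let_def)
    have nu: "u' \<notin> set vs"
    proof
      assume "u' \<in> set vs"
      then obtain j where j: "j < length vs" "u' = vs ! j" by (metis in_set_conv_nth)
      then have "hyperpath (V, E) v u' (take (Suc j) vs, take j es)" using hyperpath_prefix[OF p(1)] by simp
      moreover have "set (take j es) \<subseteq> P" using p(2) by (auto dest: in_set_takeD)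
      ultimately show False using u'(2) by force
    qed
    \<comment> \<open>If the path already uses \<open>e\<close>, it is left at the vertex before
      that edge, which keeps its edges distinct; otherwise at its end \<open>u\<close>.\<close>
    have "\<exists>i\<le>length es. vs ! i \<in> e \<and> e \<notin> set (take i es)"
    proof (cases "e \<in> set es")
      case True
      then obtain i where i: "i < length es" "es ! i = e" by (metis in_set_conv_nth)
      have "e \<notin> set (take i es)"
      proof
        assume "e \<in> set (take i es)"
        then obtain j where "j < i" "es ! j = e" by (auto simp: in_set_conv_nth)
        then show False using i nth_eq_iff_index_eq[OF di, of j i] by auto
      qed
      then show ?thesis using i pre[of i] by (intro exI[of _ i]) auto
    next
      case False
      have "vs ! length es = u" using la ne len last_conv_nth[of vs] by (metis add_diff_cancel_right')
      then show ?thesis using False u(1) by (intro exI[of _ "length es"]) auto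
    qed
    then obtain i where i: "i \<le> length es" "vs ! i \<in> e" "e \<notin> set (take i es)" by auto
    have "u' \<in> V" using u'(1) e(1) P(1) V(1) by auto
    then have "hyperpath (V, E) v u' (take (Suc i) vs @ [u'], take i es @ [e])"
      using hyperpath_extend[OF p(1) i(1,2) _ i(3) u'(1) _ nu] e(1) P(1) by auto
    moreover have "set (take i es @ [e]) \<subseteq> P" using p(2) e(1) by (auto dest: in_set_takeD)
    ultimately show False using u'(2) by force
  qed
  then show ?thesis by auto
qed

text \<open>The vertex version of Menger's theorem, applied to the intersection graph of the edges:
  vertex-disjoint walks there are edge-disjoint here, and each contains the edges of a
  hyperpath.\<close>

lemma cut_menger:
  assumes finE: "finite E" and UE: "\<Union>E \<subseteq> V" and v: "v \<in> V" "v \<noteq> w"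
    and cut: "\<And>X. v \<in> X \<Longrightarrow> w \<notin> X \<Longrightarrow> m \<le> card (bd E X)"
  shows "\<exists>P. edge_disjoint_paths (V, E) v w P \<and> card P = m"
proof -
  let ?R = "{(e, f). e \<in> E \<and> f \<in> E \<and> e \<inter> f \<noteq> {}}"
  let ?A = "{e\<in>E. v \<in> e}" and ?B = "{e\<in>E. w \<in> e}"
  have finR: "finite ?R" by (rule finite_subset[of _ "E \<times> E"]) (use finE in auto)
  have sub: "set es \<subseteq> E" if "linked ?R es" "hd es \<in> E" for es
    using that
  proof (induction es)
    case (Cons e es)
    then show ?case by (cases es) auto
  qed simp
  have "m \<le> card S" if S: "finite S" "separates ?R ?A ?B S" for S
  proof -
    \<comment> \<open>\<open>X\<close> collects what is reachable from \<open>v\<close> by edges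
      outside the separator, so all edges leaving \<open>X\<close> belong to
      \<open>S\<close>.\<close>
    define X where "X = insert v {u. \<exists>es. es \<noteq> [] \<and> linked ?R es \<and> hd es \<in> ?A \<and> u \<in> last es \<and> set es \<inter> S = {}}"
    have wX: "w \<notin> X"
    proof
      assume "w \<in> X"
      then obtain es where es: "es \<noteq> []" "linked ?R es" "hd es \<in> ?A" "w \<in> last es" "set es \<inter> S = {}"
        using v(2) unfolding X_def by auto
      moreover have "last es \<in> E" using sub[OF es(2)] es(1,3) last_in_set by blast
      ultimately have "walk_between ?R ?A ?B es" unfolding walk_between_def by auto
      then show False using S(2) es(5) unfolding separates_def by auto
    qed
    have "bd E X \<subseteq> S"
    proof
      fix e assume e: "e \<in> bd E X"
      show "e \<in> S"
      proof (rule ccontr)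
        assume eS: "e \<notin> S"
        obtain u where u: "u \<in> e" "u \<in> X" "e \<in> E" using e unfolding bd_def by auto
        have "\<exists>es. es \<noteq> [] \<and> linked ?R es \<and> hd es \<in> ?A \<and> last es = e \<and> set es \<inter> S = {}"
        proof (cases "u = v")
          case True
          then show ?thesis using u eS by (intro exI[of _ "[e]"]) auto
        next
          case False
          then obtain es where es: "es \<noteq> []" "linked ?R es" "hd es \<in> ?A" "u \<in> last es" "set es \<inter> S = {}"
            using u(2) unfolding X_def by auto
          have "last es \<in> E" using sub[OF es(2)] es(1,3) last_in_set by blast
          then have "linked ?R (es @ [e])" using es u by (auto simp: successively_append_iff)
          then show ?thesis using es eS by (intro exI[of _ "es @ [e]"]) auto
        qed
        then have "e \<subseteq> X" unfolding X_def by blast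
        then show False using e unfolding bd_def by auto
      qed
    qed
    then have "card (bd E X) \<le> card S" using S(1) by (rule card_mono[rotated])
    then show ?thesis using cut[OF _ wX] unfolding X_def by auto
  qed
  then obtain I p where I: "finite I" "card I = m" "linkage ?R ?A ?B I p"
    using menger[OF finR, of ?A ?B m] finE by auto
  have path: "\<exists>h. hyperpath (V, E) v w h \<and> set (snd h) \<subseteq> set (p s)" if s: "s \<in> I" for s
  proof (rule crossing_set_hyperpath[OF _ _ UE v(1)])
    have ps: "p s \<noteq> []" "linked ?R (p s)" "hd (p s) \<in> ?A" "last (p s) \<in> ?B"
      using I(3) s unfolding linkage_def walk_between_def by auto
    show "set (p s) \<subseteq> E" using sub[OF ps(2)] ps(3) by auto
    fix X assume X: "v \<in> X" "w \<notin> X"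
    show "\<exists>e\<in>set (p s). e \<inter> X \<noteq> {} \<and> e - X \<noteq> {}"
    proof (rule ccontr)
      assume "\<not> ?thesis"
      then have no: "\<And>e. e \<in> set (p s) \<Longrightarrow> e \<inter> X \<noteq> {} \<Longrightarrow> e \<subseteq> X" by blast
      have "last es \<subseteq> X" if "es \<noteq> []" "linked ?R es" "hd es \<inter> X \<noteq> {}" "set es \<subseteq> set (p s)" for es
        using that
      proof (induction es)
        case (Cons e es)
        have eX: "e \<subseteq> X" using Cons.prems no by auto
        show ?case
        proof (cases es)
          case Nil
          then show ?thesis using eX by simp
        next
          case (Cons f fs)
          then have "hd es \<inter> X \<noteq> {}" using Cons.prems(2) eX by auto
          then show ?thesis using Cons.IH Cons.prems Cons by auto
        qed
      qed simp
      then have "last (p s) \<subseteq> X" using ps X(1) by blast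
      then show False using ps(4) X(2) by auto
    qed
  qed
  then obtain h where h: "\<And>s. s \<in> I \<Longrightarrow> hyperpath (V, E) v w (h s) \<and> set (snd (h s)) \<subseteq> set (p s)" by metis
  \<comment> \<open>As \<open>v \<noteq> w\<close>, each path has an edge, so edge-disjoint paths
    are distinct and \<open>h\<close> is injective.\<close>
  have ne: "set (snd (h s)) \<noteq> {}" if "s \<in> I" for s
    using hyperpath_crosses[of V E v w "h s" "{v}"] h[OF that] v(2) by auto
  have dis: "set (snd (h s)) \<inter> set (snd (h t)) = {}" if "s \<in> I" "t \<in> I" "s \<noteq> t" for s t
    using I(3) that h[of s] h[of t] unfolding linkage_def by blast
  have "inj_on h I" using ne dis unfolding inj_on_def by (metis Int_absorb)
  then have "card (h ` I) = m" using I(2) by (simp add: card_image)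
  moreover have "edge_disjoint_paths (V, E) v w (h ` I)"
    unfolding edge_disjoint_paths_def
  proof (intro conjI ballI impI)
    show "hyperpath (V, E) v w q" if "q \<in> h ` I" for q using that h by auto
    fix q q' assume "q \<in> h ` I" "q' \<in> h ` I" "q \<noteq> q'"
    then obtain s t where "q = h s" "q' = h t" "s \<in> I" "t \<in> I" "s \<noteq> t" by auto
    then show "set (snd q) \<inter> set (snd q') = {}" using dis by simp
  qed
  ultimately show ?thesis by blast
qed

text \<open>A cut bounds the number of paths by \<open>edge_disjoint_paths_card\<close>; conversely,
  if all cuts had more than \<open>k\<close> edges, \<open>cut_menger\<close> would give
  \<open>k + 1\<close> paths. The convention \<open>lambda = 0\<close> for at most one vertex fits,
  as there is no pair to separate.\<close>

lemma lambda_le_iff: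
  assumes hg: "hypergraph (V, E)" shows "lambda (V, E) \<le> k \<longleftrightarrow> sep_le k V E"
proof -
  have finV: "finite V" and UE: "\<Union>E \<subseteq> V" using hg unfolding hypergraph_def by auto
  have finE: "finite E" using finV UE by (meson finite_UnionD finite_subset)
  have ll: "local_lambda (V, E) v w \<le> k \<longleftrightarrow> (\<exists>Z. (v \<in> Z) \<noteq> (w \<in> Z) \<and> card (bd E Z) \<le> k)"
    if vw: "v \<in> V" "w \<in> V" "v \<noteq> w" for v w
  proof
    have fin: "finite {card P | P. edge_disjoint_paths (V, E) v w P}"
      by (rule finite_path_cards[OF finE vw(3)])
    have "edge_disjoint_paths (V, E) v w {}" unfolding edge_disjoint_paths_def by simp
    then have nonempty: "{card P | P. edge_disjoint_paths (V, E) v w P} \<noteq> {}" by blast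
    show "local_lambda (V, E) v w \<le> k" if ex: "\<exists>Z. (v \<in> Z) \<noteq> (w \<in> Z) \<and> card (bd E Z) \<le> k"
    proof -
      obtain Z where Z: "(v \<in> Z) \<noteq> (w \<in> Z)" "card (bd E Z) \<le> k" using ex by blast
      show ?thesis unfolding local_lambda_alt
      proof (rule Max.boundedI[OF fin nonempty])
        fix c assume "c \<in> {card P | P. edge_disjoint_paths (V, E) v w P}"
        then obtain P where "edge_disjoint_paths (V, E) v w P" "c = card P" by blast
        then show "c \<le> k" using edge_disjoint_paths_card[OF _ finE Z(1)] Z(2) by (meson order_trans le_refl eq_imp_le)
      qed
    qed
    show "\<exists>Z. (v \<in> Z) \<noteq> (w \<in> Z) \<and> card (bd E Z) \<le> k" if le: "local_lambda (V, E) v w \<le> k"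
    proof (rule ccontr)
      assume no: "\<not> ?thesis"
      have "k + 1 \<le> card (bd E X)" if "v \<in> X" "w \<notin> X" for X
        using no that by (metis Suc_eq_plus1 not_less_eq_eq)
      then obtain P where P: "edge_disjoint_paths (V, E) v w P" "card P = k + 1"
        using cut_menger[OF finE UE vw(1,3), of "k + 1"] by auto
      then have "k + 1 \<in> {card P | P. edge_disjoint_paths (V, E) v w P}" by force
      then have "k + 1 \<le> local_lambda (V, E) v w" unfolding local_lambda_alt by (rule Max_ge[OF fin])
      then show False using le by simp
    qed
  qed
  show ?thesis
  proof (cases "card V \<le> 1")
    case True
    have "x = y" if "x \<in> V" "y \<in> V" for x y
      using True finV that by (metis One_nat_def card_le_Suc0_iff_eq)
    then show ?thesis using True unfolding lambda_def sep_le_def by auto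
  next
    case False
    let ?M = "{local_lambda (V, E) v w | v w. v \<in> V \<and> w \<in> V \<and> v \<noteq> w}"
    have "?M \<subseteq> (\<lambda>(v, w). local_lambda (V, E) v w) ` (V \<times> V)" by auto
    then have fin: "finite ?M" by (rule finite_subset) (use finV in simp)
    obtain x y where "x \<in> V" "y \<in> V" "x \<noteq> y" using False finV by (metis One_nat_def card_le_Suc0_iff_eq)
    then have ne: "?M \<noteq> {}" by blast
    have "lambda (V, E) \<le> k \<longleftrightarrow> (\<forall>v\<in>V. \<forall>w\<in>V. v \<noteq> w \<longrightarrow> local_lambda (V, E) v w \<le> k)"
      using False Max_le_iff[OF fin ne, of k] unfolding lambda_def by auto
    also have "\<dots> \<longleftrightarrow> sep_le k V E" unfolding sep_le_def by (intro ball_cong refl imp_cong ll)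
    finally show ?thesis .
  qed
qed

section \<open>Comparison of the two classes\<close>

lemma class_C_iff:
  assumes "k \<ge> 1" shows "class_C k (V, E) \<longleftrightarrow> crit k V E \<and> sep_le k V E"
proof -
  have "hypergraph (V, E)" if "crit k V E"
    using that critical_iff_crit[OF assms, of V E] unfolding critical_def by simp
  then show ?thesis unfolding class_C_def critical_iff_crit[OF assms] using lambda_le_iff by blast
qed

theorem theorem14:
  fixes k :: nat
  assumes "k \<ge> 3" and "infinite (UNIV :: 'a set)"
  shows "{G :: 'a hgraph. class_C k G} = {G. class_H k G}"
proof -
  have "class_C k G \<longleftrightarrow> class_H k G" for G :: "'a hgraph"
  proof -
    obtain V E where G: "G = (V, E)" by (cases G)
    show ?thesis
      using crit_hajos_closure[OF assms, of V E] hajos_closure_crit[OF assms(1), of "(V, E)"]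
        class_C_iff[of k V E] assms(1)
      unfolding G class_H_def by auto
  qed
  then show ?thesis by auto
qed

end
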